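(* For an arbitrarily small constant $\epsilon>0$, there exists an algorithm for the BVU problem which runs in $r^{O(mr/\epsilon)}+n^{O(m^5/\epsilon^5)}$ time and returns a feasible solution with objective value no smaller than $\mathrm{OPT}-\epsilon$, where $\mathrm{OPT}\in[0,1]$ is the optimal objective value.
   Context: The (Plurality-)BVU problem. Input: candidates $c_1,\dots,c_m$ ($m\ge2$) and voters $v_1,\dots,v_n$ partitioned as $V_1\cup\dots\cup V_m$, where $V_j$ is the set of voters voting for $c_j$ without bribery, $|V_1|>|V_j|$ for all $j>1$; $c_m$ is the designated candidate and $r=|V_1|-|V_m|$ (positive integer). Each voter $v_i$ has price $q_i$ and probability $p_i\in[0,1]$; budget $Q$. A feasible solution is $I\subseteq\{1,\dots,n\}$ with $\sum_{i\in I}q_i\le Q$; the voters in $\{v_i\in V\setminus V_m: i\in I\}$ are bribed. Independently, the vote of a bribed voter $v_i$ goes to $c_m$ and is counted with probability $p_i$, and with probability $1-p_i$ is not counted for any candidate; unbribed voters vote as originally. $c_m$ wins if it receives strictly more counted votes than every other candidate. The objective value of $I$ is the probability that $c_m$ wins, to be maximized; OPT is the maximum. *)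

theory Defs
  imports "HOL-Probability.Probability"
begin

section \<open>Bribery with voting uncertainty under plurality\<close>

text \<open>
  Candidates are \<open>1, \<dots>, num_cands\<close>, voters are \<open>1, \<dots>, num_voters\<close>. The partition of the
  voters is given by \<open>vote\<close>, and the last candidate is the designated one. The values of
  \<open>vote\<close>, \<open>price\<close> and \<open>prob\<close> outside the range of voters are irrelevant.
\<close>

record bvu =
  num_cands :: nat
  num_voters :: nat
  vote :: "nat \<Rightarrow> nat"
  price :: "nat \<Rightarrow> real"
  prob :: "nat \<Rightarrow> real"
  budget :: real

definition voters :: "bvu \<Rightarrow> nat set" where
  "voters B = {1..num_voters B}"

definition supporters :: "bvu \<Rightarrow> nat \<Rightarrow> nat set" where
  "supporters B j = {i \<in> voters B. vote B i = j}"

definition bvu_instance :: "bvu \<Rightarrow> bool" where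
  "bvu_instance B \<longleftrightarrow>
     num_cands B \<ge> 2 \<and>
     (\<forall>i\<in>voters B. vote B i \<in> {1..num_cands B}) \<and>
     (\<forall>j\<in>{2..num_cands B}. card (supporters B j) < card (supporters B 1)) \<and>
     (\<forall>i\<in>voters B. price B i \<ge> 0) \<and>
     (\<forall>i\<in>voters B. prob B i \<in> {0..1}) \<and>
     budget B \<ge> 0"

text \<open>For an instance the difference below is positive, so truncated subtraction is harmless.\<close>

definition gap :: "bvu \<Rightarrow> nat" where
  "gap B = card (supporters B 1) - card (supporters B (num_cands B))"

definition feasible :: "bvu \<Rightarrow> nat set \<Rightarrow> bool" where
  "feasible B I \<longleftrightarrow> I \<subseteq> voters B \<and> (\<Sum>i\<in>I. price B i) \<le> budget B"

definition bribed :: "bvu \<Rightarrow> nat set \<Rightarrow> nat set" where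
  "bribed B I = {i \<in> voters B - supporters B (num_cands B). i \<in> I}"

text \<open>
  An outcome \<open>w\<close> tells for each bribed voter whether the vote is counted;
  \<open>None\<close> is a vote that is not counted for any candidate.
\<close>

definition ballot :: "bvu \<Rightarrow> nat set \<Rightarrow> (nat \<Rightarrow> bool) \<Rightarrow> nat \<Rightarrow> nat option" where
  "ballot B I w i =
     (if i \<in> bribed B I then (if w i then Some (num_cands B) else None) else Some (vote B i))"

definition counted_votes :: "bvu \<Rightarrow> nat set \<Rightarrow> (nat \<Rightarrow> bool) \<Rightarrow> nat \<Rightarrow> nat" where
  "counted_votes B I w j = card {i \<in> voters B. ballot B I w i = Some j}"

definition designated_wins :: "bvu \<Rightarrow> nat set \<Rightarrow> (nat \<Rightarrow> bool) \<Rightarrow> bool" where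
  "designated_wins B I w \<longleftrightarrow>
     (\<forall>j\<in>{1..<num_cands B}. counted_votes B I w j < counted_votes B I w (num_cands B))"

definition objective :: "bvu \<Rightarrow> nat set \<Rightarrow> real" where
  "objective B I =
     measure_pmf.prob (Pi_pmf (bribed B I) False (\<lambda>i. bernoulli_pmf (prob B i)))
       {w. designated_wins B I w}"

definition OPT :: "bvu \<Rightarrow> real" where
  "OPT B = Max (objective B ` {I. feasible B I})"


section \<open>Algorithms and their running time\<close>

text \<open>
  A structured real random access machine. Programs work on named, unbounded arrays of natural
  numbers and of reals (a scalar variable is the entry \<open>0\<close> of an array); only natural numbers
  serve as addresses. Natural numbers are added, subtracted (truncated) and compared, reals are
  added, subtracted, multiplied, divided and compared, each at unit cost. There is no rounding
  of reals to natural numbers, no multiplication of natural numbers and no real constant other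
  than the natural numbers, so a program is a finite object without hidden information in its
  constants, and unit-cost arithmetic gives no access to the binary digits of a number.
\<close>

record store =
  nats :: "string \<Rightarrow> nat \<Rightarrow> nat"
  reals :: "string \<Rightarrow> nat \<Rightarrow> real"

datatype nexp =
    NConst nat
  | NGet string nexp
  | NPlus nexp nexp
  | NMinus nexp nexp

datatype rexp =
    ROfNat nexp
  | RGet string nexp
  | RPlus rexp rexp
  | RMinus rexp rexp
  | RTimes rexp rexp
  | RDiv rexp rexp

datatype cond =
    NLess nexp nexp
  | RLess rexp rexp
  | CNot cond
  | CAnd cond cond

datatype com =
    Skip
  | NAssign string nexp nexp
  | RAssign string nexp rexp
  | Seq com com
  | Cond cond com com
  | While cond com

primrec nval :: "nexp \<Rightarrow> store \<Rightarrow> nat" where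
  "nval (NConst k) s = k"
| "nval (NGet x a) s = nats s x (nval a s)"
| "nval (NPlus a b) s = nval a s + nval b s"
| "nval (NMinus a b) s = nval a s - nval b s"

primrec rval :: "rexp \<Rightarrow> store \<Rightarrow> real" where
  "rval (ROfNat a) s = real (nval a s)"
| "rval (RGet x a) s = reals s x (nval a s)"
| "rval (RPlus a b) s = rval a s + rval b s"
| "rval (RMinus a b) s = rval a s - rval b s"
| "rval (RTimes a b) s = rval a s * rval b s"
| "rval (RDiv a b) s = rval a s / rval b s"

primrec cval :: "cond \<Rightarrow> store \<Rightarrow> bool" where
  "cval (NLess a b) s \<longleftrightarrow> nval a s < nval b s"
| "cval (RLess a b) s \<longleftrightarrow> rval a s < rval b s"
| "cval (CNot c) s \<longleftrightarrow> \<not> cval c s"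
| "cval (CAnd c d) s \<longleftrightarrow> cval c s \<and> cval d s"

text \<open>The cost of evaluating an expression is the number of its nodes.\<close>

primrec ncost :: "nexp \<Rightarrow> nat" where
  "ncost (NConst k) = 1"
| "ncost (NGet x a) = 1 + ncost a"
| "ncost (NPlus a b) = 1 + ncost a + ncost b"
| "ncost (NMinus a b) = 1 + ncost a + ncost b"

primrec rcost :: "rexp \<Rightarrow> nat" where
  "rcost (ROfNat a) = 1 + ncost a"
| "rcost (RGet x a) = 1 + ncost a"
| "rcost (RPlus a b) = 1 + rcost a + rcost b"
| "rcost (RMinus a b) = 1 + rcost a + rcost b"
| "rcost (RTimes a b) = 1 + rcost a + rcost b"
| "rcost (RDiv a b) = 1 + rcost a + rcost b"

primrec ccost :: "cond \<Rightarrow> nat" where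
  "ccost (NLess a b) = 1 + ncost a + ncost b"
| "ccost (RLess a b) = 1 + rcost a + rcost b"
| "ccost (CNot c) = 1 + ccost c"
| "ccost (CAnd c d) = 1 + ccost c + ccost d"

definition nupd :: "string \<Rightarrow> nat \<Rightarrow> nat \<Rightarrow> store \<Rightarrow> store" where
  "nupd x k v s = s\<lparr>nats := (nats s)(x := (nats s x)(k := v))\<rparr>"

definition rupd :: "string \<Rightarrow> nat \<Rightarrow> real \<Rightarrow> store \<Rightarrow> store" where
  "rupd x k v s = s\<lparr>reals := (reals s)(x := (reals s x)(k := v))\<rparr>"

text \<open>\<open>exec c s t s'\<close>: started in \<open>s\<close>, the program \<open>c\<close> halts in \<open>s'\<close> after \<open>t\<close> steps.\<close>

inductive exec :: "com \<Rightarrow> store \<Rightarrow> nat \<Rightarrow> store \<Rightarrow> bool" where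
  Skip: "exec Skip s 1 s"
| NAssign: "exec (NAssign x a e) s (1 + ncost a + ncost e) (nupd x (nval a s) (nval e s) s)"
| RAssign: "exec (RAssign x a e) s (1 + ncost a + rcost e) (rupd x (nval a s) (rval e s) s)"
| Seq: "exec c s t s' \<Longrightarrow> exec d s' t' s'' \<Longrightarrow> exec (Seq c d) s (t + t') s''"
| CondTrue: "cval b s \<Longrightarrow> exec c s t s' \<Longrightarrow> exec (Cond b c d) s (1 + ccost b + t) s'"
| CondFalse: "\<not> cval b s \<Longrightarrow> exec d s t s' \<Longrightarrow> exec (Cond b c d) s (1 + ccost b + t) s'"
| WhileFalse: "\<not> cval b s \<Longrightarrow> exec (While b c) s (1 + ccost b) s"
| WhileTrue: "cval b s \<Longrightarrow> exec c s t s' \<Longrightarrow> exec (While b c) s' t' s'' \<Longrightarrow>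
    exec (While b c) s (1 + ccost b + t + t') s''"

lemma exec_deterministic:
  assumes "exec c s t s'" and "exec c s u s''"
  shows "u = t \<and> s'' = s'"
  using assms
proof (induction arbitrary: u s'' rule: exec.induct)
  case (Seq c s t s' d t' s1)
  from Seq.prems show ?case by cases (use Seq.IH in blast)
next
  case (CondTrue b s c t s' d)
  from CondTrue.prems show ?case by cases (use CondTrue.IH CondTrue.hyps in blast)+
next
  case (CondFalse b s d t s' c)
  from CondFalse.prems show ?case by cases (use CondFalse.IH CondFalse.hyps in blast)+
next
  case (WhileTrue b s c t s' t' s1)
  from WhileTrue.prems show ?case by cases (use WhileTrue.IH WhileTrue.hyps in blast)+
qed (auto elim: exec.cases)

text \<open>
  Input: \<open>m\<close>, \<open>n\<close> and \<open>Q\<close> are scalars, and \<open>vote\<close>, \<open>q\<close>, \<open>p\<close> are arrays whose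
  entries \<open>1, \<dots>, n\<close> hold the original votes, the prices and the probabilities. All other
  entries of the memory are \<open>0\<close>. Output: the voters whose entry in the array \<open>I\<close> is nonzero.
\<close>

definition input_store :: "bvu \<Rightarrow> store" where
  "input_store B =
     \<lparr>nats = (\<lambda>x k.
         if x = ''m'' \<and> k = 0 then num_cands B
         else if x = ''n'' \<and> k = 0 then num_voters B
         else if x = ''vote'' \<and> k \<in> voters B then vote B k
         else 0),
      reals = (\<lambda>x k.
         if x = ''Q'' \<and> k = 0 then budget B
         else if x = ''q'' \<and> k \<in> voters B then price B k
         else if x = ''p'' \<and> k \<in> voters B then prob B k
         else 0)\<rparr>"

definition output_set :: "bvu \<Rightarrow> store \<Rightarrow> nat set" where
  "output_set B s = {i \<in> voters B. nats s ''I'' i \<noteq> 0}"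

end

theory Submission
  imports Defs
begin

text \<open>
  Whether the designated candidate wins depends on the number of bribed voters of each candidate and
  on a tail of a Poisson binomial distribution. This tail hardly changes when the number of bribed
  voters and the sum of their probabilities are kept within each of \<open>K\<close> buckets of probabilities of width
  \<open>1 / K\<close>: the two probability vectors are connected by transfers of mass between two voters of one
  bucket, such a transfer changes the generating polynomial only by a multiple of \<open>(X - 1)\<^sup>2\<close> times
  the polynomial of the remaining voters, and consecutive probabilities of a Poisson binomial
  distribution of variance \<open>v\<close> differ by \<open>O(1 / (1 + v))\<close>, by Fourier inversion. Altogether the error
  is \<open>O(1 / K)\<close>. It therefore suffices to find, for each possible value of these statistics, with the
  probabilities rounded to multiples of \<open>1 / (K * n)\<close>, the cheapest set of voters, and to compare
  the exact objective values of the affordable ones. The statistics are packed into a single number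
  with \<open>O(m + K)\<close> digits in radix \<open>n\<^sup>2 + 1\<close>, and dynamic programming over these numbers takes
  \<open>n\<^bsup>O(m + K)\<^esup>\<close> steps with \<open>K = O(1 / \<epsilon>)\<close>.
\<close>

subsection \<open>Generating polynomials of sums of Bernoulli variables\<close>

text \<open>The obstacle: up to n voters may each have to move by up to \<open>1 / K\<close>, so an
  estimate by the l1 distance alone is worthless. Three savings combine. A transfer keeps the sum of
  two probabilities, so in the product of two factors \<open>1 + p * (X - 1)\<close> the linear term
  cancels and the quadratic one is at most the transferred mass times \<open>1 / K\<close>. Partial
  sums of coefficients telescope against one factor \<open>X - 1\<close>; the other leaves a
  difference of consecutive probabilities, of order \<open>1 / (1 + v)\<close> rather than
  \<open>1 / sqrt (1 + v)\<close>. Finally, the total mass to be moved is itself O(v): in a middle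
  bucket a voter moves by at most \<open>1 / K\<close> and has variance at least
  \<open>1 / (2 * K)\<close>; in the first and last bucket both are controlled by \<open>p\<close>
  and \<open>1 - p\<close>. So the loss does not depend on n. Rivals need no approximation: a bribed
  vote never goes to a rival, so the rivals' totals follow from the numbers of bribed voters.
  Constants: 4 for smoothness, 16 after removing two voters, 32 after multiplying by the mass, 34
  with the rounding of two vectors; hence
  \<open>K = nat \<lceil>34 / \<epsilon>\<rceil>\<close>.\<close>

definition lin :: "real \<Rightarrow> 'a::real_field poly" where
  "lin p = [:of_real (1 - p), of_real p:]"

text \<open>The coefficient field is left open: over the reals the coefficients are probabilities,
  over the complex numbers the polynomial is evaluated on the unit circle for Fourier inversion.
  \<open>coeff_gen_of_real\<close> links the two.\<close>

definition gen :: "'b set \<Rightarrow> ('b \<Rightarrow> real) \<Rightarrow> 'a::real_field poly" where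
  "gen A p = (\<Prod>i\<in>A. lin (p i))"

definition head :: "nat \<Rightarrow> real poly \<Rightarrow> real" where
  "head k q = (\<Sum>j<k. coeff q j)"

lemma coeff_lin_mult_0: "coeff (lin p * q) 0 = of_real (1 - p) * coeff q 0"
  by (simp add: lin_def mult_pCons_left)

lemma coeff_lin_mult_Suc:
  "coeff (lin p * q) (Suc k) = of_real (1 - p) * coeff q (Suc k) + of_real p * coeff q k"
  by (simp add: lin_def mult_pCons_left coeff_pCons)

lemma coeff_diff_mult_0: "coeff ([:- 1, 1:] * q) 0 = - coeff (q :: 'a::real_field poly) 0"
  by (simp add: mult_pCons_left)

lemma coeff_diff_mult_Suc:
  "coeff ([:- 1, 1:] * q) (Suc k) = coeff q k - coeff (q :: 'a::real_field poly) (Suc k)"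
  by (simp add: mult_pCons_left coeff_pCons)

lemma gen_insert: "finite A \<Longrightarrow> a \<notin> A \<Longrightarrow> gen (insert a A) p = lin (p a) * gen A p"
  by (simp add: gen_def)

lemma gen_remove: "finite A \<Longrightarrow> a \<in> A \<Longrightarrow> gen A p = lin (p a) * gen (A - {a}) p"
  by (simp add: gen_def prod.remove)

lemma gen_cong: "(\<And>i. i \<in> A \<Longrightarrow> p i = p' i) \<Longrightarrow> gen A p = gen A p'"
  unfolding gen_def by (rule prod.cong) auto

lemma head_add: "head k (q + r) = head k q + head k r"
  by (simp add: head_def sum.distrib)

lemma head_diff: "head k (q - r) = head k q - head k r"
  by (simp add: head_def sum_subtractf)

lemma head_smult: "head k (smult c q) = c * head k q"
  by (simp add: head_def sum_distrib_left)

lemma head_0: "head 0 q = 0"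
  by (simp add: head_def)

text \<open>\<open>[:- 1, 1:]\<close> is \<open>X - 1\<close>, so the partial sum telescopes. This
  absorbs one of the two factors \<open>X - 1\<close> that a transfer leaves.\<close>

lemma head_diff_mult_Suc: "head (Suc k) ([:- 1, 1:] * q) = - coeff q k"
proof (induction k)
  case 0
  show ?case by (simp add: head_def mult_pCons_left)
next
  case (Suc k)
  have "head (Suc (Suc k)) ([:- 1, 1:] * q)
      = head (Suc k) ([:- 1, 1:] * q) + coeff ([:- 1, 1:] * q) (Suc k)"
    by (simp add: head_def)
  then show ?case
    unfolding Suc.IH coeff_diff_mult_Suc by simp
qed

text \<open>Follows by telescoping from \<open>lin p = 1 + p * (X - 1)\<close>. It expresses
  conditioning on one voter and is the recurrence by which the program updates its table
  \<open>T\<close>.\<close>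

lemma head_lin_mult_Suc: "head (Suc k) (lin p * q) = (1 - p) * head (Suc k) q + p * head k q"
proof -
  have "lin p * q = q + smult p ([:- 1, 1:] * q)"
    by (simp add: lin_def mult_pCons_left smult_diff_left smult_diff_right algebra_simps)
  then have "head (Suc k) (lin p * q) = head (Suc k) q - p * coeff q k"
    by (simp only: head_add head_smult head_diff_mult_Suc mult_minus_right add_uminus_conv_diff)
  moreover have "head (Suc k) q = head k q + coeff q k"
    by (simp add: head_def)
  ultimately show ?thesis by (simp add: algebra_simps)
qed

lemma coeff_gen_bounds:
  assumes "finite A" and "\<And>i. i \<in> A \<Longrightarrow> p i \<in> {0..1}"
  shows "coeff (gen A p :: real poly) k \<in> {0..1}"
  using assms
proof (induction A arbitrary: k rule: finite_induct)
  case empty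
  show ?case by (simp add: gen_def coeff_1)
next
  case (insert a A)
  have p: "0 \<le> p a" "p a \<le> 1" using insert.prems by auto
  have IH: "0 \<le> coeff (gen A p :: real poly) j" "coeff (gen A p :: real poly) j \<le> 1" for j
    using insert.IH[of j] insert.prems by auto
  show ?case
  proof (cases k)
    case 0
    then show ?thesis
      using p IH[of 0] insert.hyps by (simp add: gen_insert coeff_lin_mult_0 mult_le_one)
  next
    case (Suc j)
    have "(1 - p a) * coeff (gen A p :: real poly) (Suc j) + p a * coeff (gen A p) j \<le> (1 - p a) * 1 + p a * 1"
      by (intro add_mono mult_left_mono) (use p IH in auto)
    then show ?thesis
      using p IH insert.hyps by (simp add: Suc gen_insert coeff_lin_mult_Suc)
  qed
qed

lemma coeff_gen_of_real:
  "finite A \<Longrightarrow> coeff (gen A p :: complex poly) k = of_real (coeff (gen A p) k)"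
proof (induction A arbitrary: k rule: finite_induct)
  case empty
  show ?case by (simp add: gen_def coeff_1)
next
  case (insert a A)
  then show ?case
    by (cases k) (simp_all add: gen_insert coeff_lin_mult_0 coeff_lin_mult_Suc)
qed

subsection \<open>Smoothness of Poisson binomial distributions\<close>

text \<open>Orthogonality of the characters of the circle: for \<open>d \<noteq> 0\<close> the
  antiderivative takes the same value at both ends.\<close>

lemma has_integral_cis_int:
  "((\<lambda>\<theta>. cis (of_int d * \<theta>)) has_integral (if d = 0 then 2 * pi else 0)) {- pi..pi}"
proof (cases "d = 0")
  case True
  have "((\<lambda>\<theta>. 1 :: complex) has_integral (pi - (- pi)) *\<^sub>R 1) {- pi..pi}"
    by (rule has_integral_const_real[of "1::complex" "- pi" pi, THEN has_integral_eq_rhs]) simp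
  then show ?thesis using True by (simp add: scaleR_conv_of_real)
next
  case False
  have "((\<lambda>\<theta>. cis (of_int d * \<theta>)) has_integral
      (cis (of_int d * pi) / (\<i> * of_int d) - cis (of_int d * (- pi)) / (\<i> * of_int d))) {- pi..pi}"
  proof (rule fundamental_theorem_of_calculus)
    fix x :: real
    have "((\<lambda>\<theta>. exp (\<i> * of_int d * of_real \<theta>) / (\<i> * of_int d)) has_vector_derivative
         exp (\<i> * of_int d * of_real x)) (at x within {- pi..pi})"
      by (rule derivative_eq_intros has_vector_derivative_real_field refl)+ (use False in auto)
    then show "((\<lambda>\<theta>. cis (of_int d * \<theta>) / (\<i> * of_int d)) has_vector_derivative
         cis (of_int d * x)) (at x within {- pi..pi})"
      by (simp add: cis_conv_exp mult.assoc)
  qed simp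
  moreover have "cis (of_int d * pi) = cis (of_int d * (- pi))"
  proof -
    have "cis (of_int d * pi) = cis (of_int d * (- pi)) * cis (2 * pi * of_int d)"
      by (simp add: cis_mult algebra_simps)
    also have "cis (2 * pi * of_int d) = 1"
      by (rule cis_multiple_2pi) auto
    finally show ?thesis by simp
  qed
  ultimately show ?thesis using False by simp
qed

lemma has_integral_coeff:
  fixes q :: "complex poly"
  shows "((\<lambda>\<theta>. poly q (cis \<theta>) * cis (- (of_nat k * \<theta>))) has_integral 2 * pi * coeff q k) {- pi..pi}"
proof -
  \<comment> \<open>Summing up to \<open>max k (degree q)\<close> makes the index \<open>k\<close>
    occur even if it exceeds the degree.\<close>
  have "((\<lambda>\<theta>. \<Sum>j\<le>max k (degree q). coeff q j * cis (of_int (int j - int k) * \<theta>)) has_integral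
      (\<Sum>j\<le>max k (degree q). coeff q j * (if int j - int k = 0 then 2 * pi else 0))) {- pi..pi}"
    by (intro has_integral_sum has_integral_mult_right has_integral_cis_int) auto
  also have "(\<Sum>j\<le>max k (degree q). coeff q j * (if int j - int k = 0 then 2 * pi else 0))
      = (\<Sum>j\<le>max k (degree q). if j = k then 2 * pi * coeff q k else 0)"
    by (rule sum.cong) auto
  also have "\<dots> = 2 * pi * coeff q k" by (simp add: sum.delta)
  also have "(\<lambda>\<theta>. \<Sum>j\<le>max k (degree q). coeff q j * cis (of_int (int j - int k) * \<theta>))
      = (\<lambda>\<theta>. poly q (cis \<theta>) * cis (- (of_nat k * \<theta>)))"
  proof
    fix \<theta> :: real
    have "poly q (cis \<theta>) = (\<Sum>j\<le>max k (degree q). coeff q j * cis \<theta> ^ j)"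
      unfolding poly_altdef
      by (rule sum.mono_neutral_left) (auto simp: coeff_eq_0)
    then show "(\<Sum>j\<le>max k (degree q). coeff q j * cis (of_int (int j - int k) * \<theta>))
        = poly q (cis \<theta>) * cis (- (of_nat k * \<theta>))"
      by (simp add: sum_distrib_right Complex.DeMoivre mult.assoc cis_mult left_diff_distrib)
  qed
  finally show ?thesis .
qed

text \<open>The constant 16 serves two ranges. Up to 2 the expansion of order 4 gives even
  \<open>x^2 / 3\<close>; beyond 2, which exceeds \<open>pi / 2\<close>, the cosine is at most 0
  while \<open>x^2 \<le> 16\<close>, both because \<open>pi < 4\<close>.\<close>

lemma one_minus_cos_ge:
  assumes "\<bar>x\<bar> \<le> pi"
  shows "1 - cos x \<ge> x\<^sup>2 / 16"
proof (cases "\<bar>x\<bar> \<le> 2")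
  case True
  have "\<exists>t. cos x = (\<Sum>m<4. cos_coeff m * x ^ m) + cos (t + 1 / 2 * real 4 * pi) / fact 4 * x ^ 4"
    using Maclaurin_cos_expansion[of x 4] by blast
  then obtain t where t: "cos x = (\<Sum>m<4. cos_coeff m * x ^ m) + cos (t + 1 / 2 * real 4 * pi) / fact 4 * x ^ 4"
    by blast
  have "(\<Sum>m<4. cos_coeff m * x ^ m) = 1 - x\<^sup>2 / 2"
    by (simp add: cos_coeff_def lessThan_nat_numeral)
  moreover have "cos (t + 1 / 2 * real 4 * pi) / fact 4 * x ^ 4 \<le> 1 / fact 4 * x ^ 4"
    by (intro mult_right_mono divide_right_mono) auto
  moreover have "x ^ 4 \<le> x\<^sup>2 * 4"
  proof -
    have "x\<^sup>2 \<le> 4" using True abs_le_square_iff[of x 2] by simp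
    then have "x\<^sup>2 * x\<^sup>2 \<le> x\<^sup>2 * 4" by (intro mult_left_mono) auto
    then show ?thesis by (simp add: power4_eq_xxxx power2_eq_square mult.assoc)
  qed
  moreover have "0 \<le> x\<^sup>2" by simp
  moreover have "1 / fact 4 * x ^ 4 = x ^ 4 / 24" by (simp add: fact_numeral)
  ultimately show ?thesis using t by linarith
next
  case False
  have "cos \<bar>x\<bar> \<le> cos (pi / 2)"
    by (rule cos_monotone_0_pi_le) (use False assms pi_less_4 in auto)
  moreover have "\<bar>x\<bar>\<^sup>2 \<le> 4\<^sup>2"
    by (rule power_mono) (use assms pi_less_4 in auto)
  ultimately show ?thesis by simp
qed

text \<open>The squared norm is \<open>1 - 2 * p * (1 - p) * (1 - cos \<theta>)\<close>, which
  brings in the variance; \<open>1 + y \<le> exp y\<close> does the rest.\<close>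

lemma norm_lin_cis_le:
  assumes "p \<in> {0..1}" "\<bar>\<theta>\<bar> \<le> pi"
  shows "norm (poly (lin p) (cis \<theta>)) \<le> exp (- (p * (1 - p) * \<theta>\<^sup>2 / 16))"
proof -
  have "(norm (poly (lin p) (cis \<theta>)))\<^sup>2 = (1 - p + p * cos \<theta>)\<^sup>2 + (p * sin \<theta>)\<^sup>2"
    by (simp add: lin_def cmod_power2 mult.commute)
  also have "\<dots> = (1 - p)\<^sup>2 + 2 * p * (1 - p) * cos \<theta> + p\<^sup>2 * ((sin \<theta>)\<^sup>2 + (cos \<theta>)\<^sup>2)"
    unfolding power2_eq_square distrib_left distrib_right left_diff_distrib right_diff_distrib
    by (simp only: mult_ac add_ac)
  also have "\<dots> = 1 - 2 * (p * (1 - p)) * (1 - cos \<theta>)"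
    by (simp add: power2_eq_square algebra_simps)
  also have "\<dots> \<le> 1 - 2 * (p * (1 - p)) * (\<theta>\<^sup>2 / 16)"
    using one_minus_cos_ge[OF assms(2)] assms(1)
    by (intro diff_left_mono mult_left_mono) auto
  also have "\<dots> = 1 + 2 * (- (p * (1 - p) * \<theta>\<^sup>2 / 16))" by simp
  also have "\<dots> \<le> exp (2 * (- (p * (1 - p) * \<theta>\<^sup>2 / 16)))" by (rule exp_ge_add_one_self)
  also have "\<dots> = (exp (- (p * (1 - p) * \<theta>\<^sup>2 / 16)))\<^sup>2" by (rule exp_double)
  finally show ?thesis by (rule power2_le_imp_le) simp
qed

lemma norm_gen_cis_le:
  assumes "finite A" "\<And>i. i \<in> A \<Longrightarrow> p i \<in> {0..1}" "\<bar>\<theta>\<bar> \<le> pi"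
  shows "norm (poly (gen A p) (cis \<theta>)) \<le> exp (- ((\<Sum>i\<in>A. p i * (1 - p i)) / 16 * \<theta>\<^sup>2))"
proof -
  have "norm (poly (gen A p) (cis \<theta>)) = (\<Prod>i\<in>A. norm (poly (lin (p i)) (cis \<theta>)))"
    by (simp add: gen_def poly_prod prod_norm)
  also have "\<dots> \<le> (\<Prod>i\<in>A. exp (- (p i * (1 - p i) * \<theta>\<^sup>2 / 16)))"
    by (rule prod_mono) (use norm_lin_cis_le assms in auto)
  also have "\<dots> = exp (\<Sum>i\<in>A. - (p i * (1 - p i) * \<theta>\<^sup>2 / 16))"
    using assms(1) by (simp add: exp_sum)
  also have "(\<Sum>i\<in>A. - (p i * (1 - p i) * \<theta>\<^sup>2 / 16)) = - ((\<Sum>i\<in>A. p i * (1 - p i)) / 16 * \<theta>\<^sup>2)"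
    by (simp add: sum_negf sum_distrib_right sum_divide_distrib)
  finally show ?thesis .
qed

text \<open>The factor \<open>\<bar>\<theta>\<bar>\<close> will dominate the norm of
  \<open>cis \<theta> - 1\<close>. It makes the integrand elementary and improves the
  \<open>1 / sqrt a\<close> of a plain Gaussian to \<open>1 / a\<close>.\<close>

lemma integral_gauss_abs_le:
  assumes "a > 0"
  obtains I where "((\<lambda>\<theta>. \<bar>\<theta>\<bar> * exp (- (a * \<theta>\<^sup>2))) has_integral I) {- pi..pi}" "I \<le> 1 / a"
proof -
  define F where "F \<theta> = - exp (- (a * \<theta>\<^sup>2)) / (2 * a)" for \<theta> :: real
  have F: "(F has_real_derivative \<theta> * exp (- (a * \<theta>\<^sup>2))) (at \<theta> within S)" for \<theta> S
    unfolding F_def by (rule derivative_eq_intros refl)+ (use assms in \<open>auto simp: field_simps\<close>)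
  have "((\<lambda>\<theta>. \<theta> * exp (- (a * \<theta>\<^sup>2))) has_integral (F pi - F 0)) {0..pi}"
    by (rule fundamental_theorem_of_calculus)
       (use F in \<open>auto simp: has_real_derivative_iff_has_vector_derivative\<close>)
  then have pos: "((\<lambda>\<theta>. \<bar>\<theta>\<bar> * exp (- (a * \<theta>\<^sup>2))) has_integral (F pi - F 0)) {0..pi}"
    by (rule has_integral_eq[rotated]) auto
  have "((\<lambda>\<theta>. - (\<theta> * exp (- (a * \<theta>\<^sup>2)))) has_integral - (F 0 - F (- pi))) {- pi..0}"
    by (rule has_integral_neg, rule fundamental_theorem_of_calculus)
       (use F in \<open>auto simp: has_real_derivative_iff_has_vector_derivative\<close>)
  then have neg: "((\<lambda>\<theta>. \<bar>\<theta>\<bar> * exp (- (a * \<theta>\<^sup>2))) has_integral - (F 0 - F (- pi))) {- pi..0}"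
    by (rule has_integral_eq[rotated]) auto
  have "((\<lambda>\<theta>. \<bar>\<theta>\<bar> * exp (- (a * \<theta>\<^sup>2))) has_integral (- (F 0 - F (- pi)) + (F pi - F 0))) {- pi..pi}"
    by (rule has_integral_combine[OF _ _ neg pos]) auto
  moreover have "- (F 0 - F (- pi)) + (F pi - F 0) \<le> 1 / a"
    using assms by (simp add: F_def field_simps)
  ultimately show ?thesis using that by blast
qed

text \<open>Two bounds on the coefficient \<open>c\<close> are added: a difference of two
  probabilities is at most 1, and Fourier inversion with Gaussian decay gives
  \<open>\<bar>c\<bar> * v \<le> 8 / pi \<le> 3\<close>.\<close>

lemma coeff_diff_gen_le:
  assumes A: "finite A" "\<And>i. i \<in> A \<Longrightarrow> p i \<in> {0..1}"
  shows "\<bar>coeff ([:- 1, 1:] * gen A p) k\<bar> \<le> 4 / (1 + (\<Sum>i\<in>A. p i * (1 - p i)))"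
proof -
  define v where "v = (\<Sum>i\<in>A. p i * (1 - p i))"
  have v: "v \<ge> 0" unfolding v_def using A by (intro sum_nonneg) auto
  let ?c = "coeff ([:- 1, 1:] * gen A p :: real poly) k"
  have le1: "\<bar>?c\<bar> \<le> 1"
  proof -
    have b: "0 \<le> coeff (gen A p :: real poly) j" "coeff (gen A p :: real poly) j \<le> 1" for j
      using coeff_gen_bounds[of A p j] A by auto
    show ?thesis
    proof (cases k)
      case 0
      then show ?thesis
        using b[of 0] unfolding 0 coeff_diff_mult_0 by simp
    next
      case (Suc j)
      then show ?thesis
        using b[of j] b[of "Suc j"] unfolding Suc coeff_diff_mult_Suc by (simp add: abs_le_iff)
    qed
  qed
  have lev: "\<bar>?c\<bar> * v \<le> 8 / pi" if "v > 0"
  proof -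
    let ?q = "[:- 1, 1:] * gen A p :: complex poly"
    obtain I where I: "((\<lambda>\<theta>. \<bar>\<theta>\<bar> * exp (- (v / 16 * \<theta>\<^sup>2))) has_integral I) {- pi..pi}" "I \<le> 1 / (v / 16)"
      using integral_gauss_abs_le[of "v / 16"] \<open>v > 0\<close> by auto
    have c: "coeff ?q k = of_real ?c"
      by (cases k) (simp_all only: coeff_diff_mult_0 coeff_diff_mult_Suc coeff_gen_of_real[OF A(1)]
          of_real_minus of_real_diff)
    have "norm (integral {- pi..pi} (\<lambda>\<theta>. poly ?q (cis \<theta>) * cis (- (of_nat k * \<theta>)))) \<le>
        integral {- pi..pi} (\<lambda>\<theta>. \<bar>\<theta>\<bar> * exp (- (v / 16 * \<theta>\<^sup>2)))"
    proof (rule integral_norm_bound_integral)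
      show "(\<lambda>\<theta>. poly ?q (cis \<theta>) * cis (- (of_nat k * \<theta>))) integrable_on {- pi..pi}"
        using has_integral_coeff[of ?q k] by (auto simp: integrable_on_def)
      show "(\<lambda>\<theta>. \<bar>\<theta>\<bar> * exp (- (v / 16 * \<theta>\<^sup>2))) integrable_on {- pi..pi}"
        using I(1) by (auto simp: integrable_on_def)
      fix \<theta> :: real assume "\<theta> \<in> {- pi..pi}"
      then have \<theta>: "\<bar>\<theta>\<bar> \<le> pi" by auto
      have "norm (cis \<theta> - 1) \<le> \<bar>\<theta>\<bar>"
        using iexp_approx1[of \<theta> 0] by (simp add: cis_conv_exp)
      moreover have "norm (poly (gen A p) (cis \<theta>)) \<le> exp (- (v / 16 * \<theta>\<^sup>2))"
        using norm_gen_cis_le[OF A \<theta>] by (simp add: v_def)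
      ultimately have "norm (cis \<theta> - 1) * norm (poly (gen A p) (cis \<theta>)) \<le> \<bar>\<theta>\<bar> * exp (- (v / 16 * \<theta>\<^sup>2))"
        by (intro mult_mono) auto
      then show "norm (poly ?q (cis \<theta>) * cis (- (of_nat k * \<theta>))) \<le> \<bar>\<theta>\<bar> * exp (- (v / 16 * \<theta>\<^sup>2))"
        unfolding poly_mult norm_mult norm_cis by simp
    qed
    also have "integral {- pi..pi} (\<lambda>\<theta>. \<bar>\<theta>\<bar> * exp (- (v / 16 * \<theta>\<^sup>2))) = I"
      using I(1) by (rule integral_unique)
    also have "integral {- pi..pi} (\<lambda>\<theta>. poly ?q (cis \<theta>) * cis (- (of_nat k * \<theta>))) = 2 * pi * coeff ?q k"
      by (rule integral_unique[OF has_integral_coeff])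
    finally have "2 * pi * \<bar>?c\<bar> \<le> 16 / v" using I(2) unfolding c norm_mult norm_of_real by simp
    then show ?thesis using \<open>v > 0\<close> by (simp add: field_simps)
  qed
  have "8 / pi \<le> 3"
    using pi_ge_two pi_approx by (simp add: field_simps)
  then have "\<bar>?c\<bar> * v \<le> 3" using lev v by (cases "v = 0") auto
  then have "\<bar>?c\<bar> * (1 + v) \<le> 4" using le1 by (simp add: algebra_simps)
  then show ?thesis using v unfolding v_def[symmetric] by (simp add: field_simps)
qed

section \<open>Comparing probability vectors by transfers of mass\<close>

lemma sum_update_two:
  fixes f :: "'b \<Rightarrow> real"
  assumes "finite A" "a \<in> A" "b \<in> A" "a \<noteq> b"
    and "\<And>i. i \<in> A - {a, b} \<Longrightarrow> g i = f i"
  shows "sum g A = sum f A - f a - f b + g a + g b"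
proof -
  have A: "A = insert a (insert b (A - {a, b}))" using assms by auto
  have "sum g (A - {a, b}) = sum f (A - {a, b})"
    by (rule sum.cong) (use assms in auto)
  moreover have "sum h A = h a + h b + sum h (A - {a, b})" for h :: "'b \<Rightarrow> real"
    by (subst A) (use assms in \<open>auto simp: sum.insert\<close>)
  ultimately show ?thesis by simp
qed

text \<open>With \<open>lin p = 1 + p * (X - 1)\<close>, the product of the two factors changes by
  \<open>t * (x a - x b - t) * (X - 1)^2\<close>. One \<open>X - 1\<close> is summed away, the other
  is covered by \<open>D\<close>.\<close>

lemma head_gen_transfer:
  assumes A: "finite A" "a \<in> A" "b \<in> A" "a \<noteq> b"
    and D: "\<And>k. \<bar>coeff ([:- 1, 1:] * gen (A - {a, b}) x) k\<bar> \<le> D"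
  shows "\<bar>head R (gen A (x(a := x a - t, b := x b + t))) - head R (gen A x)\<bar>
       \<le> \<bar>t * (x a - x b - t)\<bar> * D"
proof -
  let ?y = "x(a := x a - t, b := x b + t)"
  let ?G = "gen (A - {a, b}) x :: real poly"
  have D0: "D \<ge> 0" using D[of 0] by linarith
  have dec: "gen A f = lin (f a) * (lin (f b) * gen (A - {a, b}) f)" for f :: "_ \<Rightarrow> real"
  proof -
    have "A - {a, b} = A - {a} - {b}" by auto
    then show ?thesis
      using A by (subst gen_remove[OF A(1,2)], subst gen_remove[of "A - {a}" b]) auto
  qed
  have G: "gen (A - {a, b}) ?y = ?G" by (rule gen_cong) auto
  have "gen A ?y - gen A x = smult (t * (x a - x b - t)) ([:- 1, 1:] * ([:- 1, 1:] * ?G))"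
  proof -
    have "lin (x a - t) * lin (x b + t) - lin (x a) * lin (x b)
        = smult (t * (x a - x b - t)) ([:- 1, 1:] * [:- 1, 1:] :: real poly)"
      by (simp add: lin_def algebra_simps)
    then have "(lin (x a - t) * lin (x b + t) - lin (x a) * lin (x b)) * ?G
        = smult (t * (x a - x b - t)) ([:- 1, 1:] * ([:- 1, 1:] * ?G))"
      by (simp only: mult_smult_left mult.assoc)
    then show ?thesis
      unfolding dec G using A by (simp add: algebra_simps)
  qed
  then have "head R (gen A ?y) - head R (gen A x)
      = t * (x a - x b - t) * head R ([:- 1, 1:] * ([:- 1, 1:] * ?G))"
    by (simp only: head_diff[symmetric] head_smult)
  also have "\<bar>\<dots>\<bar> \<le> \<bar>t * (x a - x b - t)\<bar> * D"
  proof (cases R)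
    case 0
    then show ?thesis using D0 by (simp add: head_0)
  next
    case (Suc k)
    then show ?thesis unfolding Suc head_diff_mult_Suc abs_mult
      using D[of k] by (intro mult_left_mono) (auto simp: abs_mult)
  qed
  finally show ?thesis .
qed

text \<open>Each transfer settles at least one coordinate, and its cost is charged to the decrease
  \<open>2 * t\<close> of the l1 distance. The hypothesis on \<open>D\<close> speaks of all vectors
  with the given intervals and group sums because this is all that is known of the intermediate
  vectors.\<close>

lemma head_gen_same_group_sums:
  fixes g :: "'b \<Rightarrow> 'c"
  assumes A: "finite A" and box: "\<And>c. {lo c..hi c :: real} \<noteq> {} \<Longrightarrow> hi c - lo c \<le> d"
    and D: "\<And>x a b k. a \<in> A \<Longrightarrow> b \<in> A \<Longrightarrow> a \<noteq> b \<Longrightarrow> (\<And>i. i \<in> A \<Longrightarrow> x i \<in> {lo (g i)..hi (g i)}) \<Longrightarrow>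
        (\<And>c. (\<Sum>i | i \<in> A \<and> g i = c. x i) = s c) \<Longrightarrow>
        \<bar>coeff ([:- 1, 1:] * gen (A - {a, b}) x) k\<bar> \<le> D"
    and p: "\<And>i. i \<in> A \<Longrightarrow> p i \<in> {lo (g i)..hi (g i)}" "\<And>c. (\<Sum>i | i \<in> A \<and> g i = c. p i) = s c"
    and p': "\<And>i. i \<in> A \<Longrightarrow> p' i \<in> {lo (g i)..hi (g i)}" "\<And>c. (\<Sum>i | i \<in> A \<and> g i = c. p' i) = s c"
  shows "\<bar>head R (gen A p) - head R (gen A p')\<bar> \<le> d * D * (\<Sum>i\<in>A. \<bar>p i - p' i\<bar>)"
  using p
proof (induction "card {i \<in> A. p i \<noteq> p' i}" arbitrary: p rule: less_induct)
  case less
  show ?case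
  proof (cases "\<exists>i\<in>A. p i \<noteq> p' i")
    case False
    then have "gen A p = (gen A p' :: real poly)" by (intro gen_cong) auto
    moreover have "(\<Sum>i\<in>A. \<bar>p i - p' i\<bar>) = 0" using False by (intro sum.neutral) auto
    ultimately show ?thesis by simp
  next
    case True
    then obtain i where i: "i \<in> A" "p i \<noteq> p' i" by blast
    define C where "C = {l \<in> A. g l = g i}"
    have C: "finite C" "i \<in> C" "C \<subseteq> A" "sum p C = sum p' C"
      using A i less.prems(2)[of "g i"] p'(2)[of "g i"] by (auto simp: C_def)
    have "\<exists>a\<in>C. p a > p' a"
    proof (rule ccontr)
      assume "\<not> ?thesis"
      then have "\<And>l. l \<in> C \<Longrightarrow> p l \<le> p' l" by force
      moreover have "p i < p' i" using calculation[OF C(2)] i by auto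
      ultimately have "sum p C < sum p' C" using C by (intro sum_strict_mono_ex1) auto
      then show False using C by simp
    qed
    then obtain a where a: "a \<in> C" "p a > p' a" by blast
    have "\<exists>b\<in>C. p b < p' b"
    proof (rule ccontr)
      assume "\<not> ?thesis"
      then have "\<And>l. l \<in> C \<Longrightarrow> p' l \<le> p l" by force
      moreover have "p' i < p i" using calculation[OF C(2)] i by auto
      ultimately have "sum p' C < sum p C" using C by (intro sum_strict_mono_ex1) auto
      then show False using C by simp
    qed
    then obtain b where b: "b \<in> C" "p b < p' b" by blast
    have ab: "a \<noteq> b" "a \<in> A" "b \<in> A" "g a = g b" using a b C by (auto simp: C_def)
    \<comment> \<open>The smaller of surplus and deficit: one coordinate reaches its target and
      neither overshoots, so both stay in their interval.\<close>
    define t where "t = min (p a - p' a) (p' b - p b)"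
    have t: "t > 0" "t \<le> p a - p' a" "t \<le> p' b - p b" using a b by (auto simp: t_def)
    define y where "y = p(a := p a - t, b := p b + t)"
    have y: "y a = p a - t" "y b = p b + t" "\<And>l. l \<noteq> a \<Longrightarrow> l \<noteq> b \<Longrightarrow> y l = p l"
      using ab by (auto simp: y_def)
    have pin: "lo (g l) \<le> p l" "p l \<le> hi (g l)" if "l \<in> A" for l using less.prems(1)[OF that] by auto
    have p'in: "lo (g l) \<le> p' l" "p' l \<le> hi (g l)" if "l \<in> A" for l using p'(1)[OF that] by auto
    have yin: "y l \<in> {lo (g l)..hi (g l)}" if "l \<in> A" for l
    proof -
      consider "l = a" | "l = b" | "l \<noteq> a" "l \<noteq> b" by blast
      then show ?thesis
      proof cases
        case 1
        then show ?thesis using t pin[of a] p'in[of a] ab y by auto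
      next
        case 2
        then show ?thesis using t pin[of b] p'in[of b] ab y by auto
      next
        case 3
        then show ?thesis using pin[OF that] y by auto
      qed
    qed
    have ysum: "(\<Sum>l | l \<in> A \<and> g l = c. y l) = s c" for c
    proof (cases "c = g a")
      case True
      have "(\<Sum>l | l \<in> A \<and> g l = c. y l) = (\<Sum>l | l \<in> A \<and> g l = c. p l) - p a - p b + y a + y b"
        by (rule sum_update_two) (use A ab True y in auto)
      then show ?thesis using y less.prems(2) by simp
    next
      case False
      have "(\<Sum>l | l \<in> A \<and> g l = c. y l) = (\<Sum>l | l \<in> A \<and> g l = c. p l)"
        by (rule sum.cong[OF refl], rule y(3)) (use False ab in auto)
      then show ?thesis using less.prems(2) by simp
    qed
    have "{l \<in> A. y l \<noteq> p' l} \<subset> {l \<in> A. p l \<noteq> p' l}"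
    proof
      show "{l \<in> A. y l \<noteq> p' l} \<subseteq> {l \<in> A. p l \<noteq> p' l}"
      proof
        fix l assume "l \<in> {l \<in> A. y l \<noteq> p' l}"
        then show "l \<in> {l \<in> A. p l \<noteq> p' l}"
          using y(3)[of l] a b by (cases "l = a"; cases "l = b") auto
      qed
      have "y a = p' a \<or> y b = p' b" using y by (auto simp: t_def min_def)
      then show "{l \<in> A. y l \<noteq> p' l} \<noteq> {l \<in> A. p l \<noteq> p' l}" using a b ab by force
    qed
    then have "card {l \<in> A. y l \<noteq> p' l} < card {l \<in> A. p l \<noteq> p' l}"
      using A by (intro psubset_card_mono) auto
    then have IH: "\<bar>head R (gen A y) - head R (gen A p')\<bar> \<le> d * D * (\<Sum>l\<in>A. \<bar>y l - p' l\<bar>)"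
      by (rule less.hyps) (use yin ysum in auto)
    have Dp: "\<bar>coeff ([:- 1, 1:] * gen (A - {a, b}) p) k\<bar> \<le> D" for k
      by (rule D) (use ab less.prems in auto)
    have D0: "D \<ge> 0" using Dp[of 0] by linarith
    have step: "\<bar>head R (gen A y) - head R (gen A p)\<bar> \<le> \<bar>t * (p a - p b - t)\<bar> * D"
      unfolding y_def by (rule head_gen_transfer) (use A ab Dp in auto)
    \<comment> \<open>Both \<open>p a - t\<close> and \<open>p b\<close> lie in the interval of the
      common group.\<close>
    have "\<bar>p a - p b - t\<bar> \<le> d"
    proof -
      have "hi (g a) - lo (g a) \<le> d" using box[of "g a"] pin[OF ab(2)] by auto
      moreover have "lo (g a) \<le> p a - t" "p a - t \<le> hi (g a)" using yin[OF ab(2)] y by auto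
      ultimately show ?thesis using pin[OF ab(3)] ab(4) by (auto simp: abs_le_iff)
    qed
    then have "\<bar>t * (p a - p b - t)\<bar> * D \<le> t * d * D"
      using t D0 by (auto simp: abs_mult intro!: mult_right_mono mult_left_mono)
    moreover have "(\<Sum>l\<in>A. \<bar>y l - p' l\<bar>) =
        (\<Sum>l\<in>A. \<bar>p l - p' l\<bar>) - \<bar>p a - p' a\<bar> - \<bar>p b - p' b\<bar> + \<bar>y a - p' a\<bar> + \<bar>y b - p' b\<bar>"
      by (rule sum_update_two) (use A ab y in auto)
    then have Sy: "(\<Sum>l\<in>A. \<bar>y l - p' l\<bar>) = (\<Sum>l\<in>A. \<bar>p l - p' l\<bar>) - 2 * t"
      using y t a b by auto
    have "d * D * (\<Sum>l\<in>A. \<bar>y l - p' l\<bar>) = d * D * (\<Sum>l\<in>A. \<bar>p l - p' l\<bar>) - 2 * t * d * D"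
      unfolding Sy by (simp add: algebra_simps)
    moreover have "t * d * D \<le> 2 * t * d * D"
    proof -
      have "d \<ge> 0" using \<open>\<bar>p a - p b - t\<bar> \<le> d\<close> by linarith
      then show ?thesis using t D0 by (intro mult_right_mono) auto
    qed
    ultimately show ?thesis using IH step by linarith
  qed
qed

text \<open>Used for rounding only, which need not keep bucket sums. A single coefficient is at most
  1, so each unit of l1 distance costs at most 1.\<close>

lemma head_gen_lipschitz:
  assumes "finite A" "\<And>i. i \<in> A \<Longrightarrow> p i \<in> {0..1}" "\<And>i. i \<in> A \<Longrightarrow> p' i \<in> {0..1}"
  shows "\<bar>head R (gen A p) - head R (gen A p')\<bar> \<le> (\<Sum>i\<in>A. \<bar>p i - p' i\<bar>)"
  using assms
proof (induction A arbitrary: R rule: finite_induct)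
  case empty
  show ?case by (simp add: gen_def)
next
  case (insert a A)
  let ?s = "\<Sum>i\<in>A. \<bar>p i - p' i\<bar>"
  have IH: "\<bar>head R (gen A p) - head R (gen A p')\<bar> \<le> ?s" for R
    using insert by auto
  show ?case
  proof (cases R)
    case 0
    then show ?thesis by (simp add: head_0 sum_nonneg)
  next
    case (Suc k)
    have b: "0 \<le> coeff (gen A p :: real poly) k" "coeff (gen A p :: real poly) k \<le> 1"
      using coeff_gen_bounds[of A p k] insert by auto
    have h: "head (Suc k) (gen A p) = head k (gen A p) + coeff (gen A p) k"
      by (simp add: head_def)
    have pa: "0 \<le> p' a" "p' a \<le> 1" using insert by auto
    have "head R (gen (insert a A) p) - head R (gen (insert a A) p') =
        (1 - p' a) * (head (Suc k) (gen A p) - head (Suc k) (gen A p'))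
        + p' a * (head k (gen A p) - head k (gen A p')) + (p' a - p a) * coeff (gen A p) k"
      unfolding Suc gen_insert[OF insert.hyps] head_lin_mult_Suc h by (simp add: algebra_simps)
    also have "\<bar>\<dots>\<bar> \<le> \<bar>(1 - p' a) * (head (Suc k) (gen A p) - head (Suc k) (gen A p'))\<bar>
        + \<bar>p' a * (head k (gen A p) - head k (gen A p'))\<bar> + \<bar>(p' a - p a) * coeff (gen A p) k\<bar>"
      by linarith
    also have "\<dots> = (1 - p' a) * \<bar>head (Suc k) (gen A p) - head (Suc k) (gen A p')\<bar>
        + p' a * \<bar>head k (gen A p) - head k (gen A p')\<bar> + \<bar>p a - p' a\<bar> * coeff (gen A p) k"
      using pa b by (simp add: abs_mult abs_minus_commute)
    also have "\<dots> \<le> (1 - p' a) * ?s + p' a * ?s + \<bar>p a - p' a\<bar> * 1"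
      using pa b by (intro add_mono mult_left_mono IH) auto
    also have "\<dots> = \<bar>p a - p' a\<bar> + ?s" by (simp add: algebra_simps)
    finally show ?thesis using insert.hyps by simp
  qed
qed

text \<open>
  Transfers inside a bucket preserve the sum \<open>u\<close> below, which is comparable both with the variance
  and with the total mass that has to be transferred.
\<close>

lemma head_gen_same_bucket_sums:
  fixes g :: "'b \<Rightarrow> nat" and K :: nat
  assumes A: "finite A" and K: "K \<ge> 2"
    and p: "\<And>i. i \<in> A \<Longrightarrow> real (g i) / K \<le> p i \<and> p i \<le> (real (g i) + 1) / K"
    and p': "\<And>i. i \<in> A \<Longrightarrow> real (g i) / K \<le> p' i \<and> p' i \<le> (real (g i) + 1) / K"
    and g: "\<And>i. i \<in> A \<Longrightarrow> g i < K"
    and eq: "\<And>c. (\<Sum>i | i \<in> A \<and> g i = c. p i) = (\<Sum>i | i \<in> A \<and> g i = c. p' i)"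
  shows "\<bar>head R (gen A p) - head R (gen A p')\<bar> \<le> 32 / K"
proof -
  define lo where "lo c = real c / K" for c :: nat
  define hi where "hi c = (real c + 1) / K" for c :: nat
  \<comment> \<open>The weight \<open>w x i\<close> is \<open>x i\<close> in the first bucket,
    \<open>1 - x i\<close> in the last and \<open>1 / K\<close> in between: a substitute for the
    variance that is affine in \<open>x\<close> with coefficients depending on the bucket only, so
    its sum is fixed by the bucket sums.\<close>
  define \<alpha> where "\<alpha> c = (if c = 0 then 0 else if c = K - 1 then 1 else 1 / real K)" for c :: nat
  define \<gamma> where "\<gamma> c = (if c = 0 then 1 else if c = K - 1 then - 1 else 0 :: real)" for c :: nat
  define w where "w x i = \<alpha> (g i) + \<gamma> (g i) * x i" for x :: "'b \<Rightarrow> real" and i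
  define u where "u = (\<Sum>i\<in>A. w p i)"
  define s where "s c = (\<Sum>i | i \<in> A \<and> g i = c. p i)" for c
  have K0: "real K > 0" using K by simp
  have sum_w: "(\<Sum>i\<in>A. w x i) = u" if x: "\<And>c. (\<Sum>i | i \<in> A \<and> g i = c. x i) = s c" for x
  proof -
    have "(\<Sum>i\<in>A. \<gamma> (g i) * y i) = (\<Sum>c\<in>g ` A. \<gamma> c * (\<Sum>i | i \<in> A \<and> g i = c. y i))" for y :: "'b \<Rightarrow> real"
      using A by (subst sum.image_gen[OF A, of _ g]) (auto intro!: sum.cong simp: sum_distrib_left)
    then have "(\<Sum>i\<in>A. \<gamma> (g i) * x i) = (\<Sum>i\<in>A. \<gamma> (g i) * p i)"
      by (simp add: x s_def)
    then show ?thesis by (simp add: w_def u_def sum.distrib)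
  qed
  \<comment> \<open>At least half of the weight is variance: one of \<open>y\<close> and
    \<open>1 - y\<close> is at least 1/2, the other is at least the weight.\<close>
  have pt: "0 \<le> y \<and> y \<le> 1 \<and> 0 \<le> \<alpha> c + \<gamma> c * y \<and> (\<alpha> c + \<gamma> c * y) / 2 \<le> y * (1 - y)"
    if y: "lo c \<le> y" "y \<le> hi c" and c: "c < K" for y c
  proof -
    have y01: "0 \<le> y" "y \<le> 1"
    proof -
      have "0 \<le> lo c" by (simp add: lo_def)
      then show "0 \<le> y" using y by linarith
      have "hi c \<le> 1" using c K0 by (simp add: hi_def)
      then show "y \<le> 1" using y by linarith
    qed
    have Kh: "1 / real K \<le> 1 / 2" using K by (simp add: field_simps)
    consider "c = 0" | "c \<noteq> 0" "c = K - 1" | "c \<noteq> 0" "c < K - 1" using c by linarith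
    then show ?thesis
    proof cases
      case 1
      then have "y \<le> 1 / 2" using y Kh by (simp add: hi_def)
      then have "y * (1 / 2) \<le> y * (1 - y)" using y01 by (intro mult_left_mono) auto
      then show ?thesis using 1 y01 by (simp add: \<alpha>_def \<gamma>_def)
    next
      case 2
      have "real c = real K - 1" using 2 K by simp
      then have "lo c = 1 - 1 / K" using K0 by (simp add: lo_def field_simps)
      then have "1 / 2 \<le> y" using y Kh by linarith
      then have "(1 / 2) * (1 - y) \<le> y * (1 - y)" using y01 by (intro mult_right_mono) auto
      then show ?thesis using 2 y01 by (simp add: \<alpha>_def \<gamma>_def)
    next
      case 3
      have "1 / K \<le> lo c" using 3 K0 by (simp add: lo_def field_simps)
      then have 1: "1 / K \<le> y" using y by linarith
      have "real c + 1 \<le> real K - 1" using 3 by linarith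
      then have "hi c \<le> (real K - 1) / K" using K0 unfolding hi_def by (intro divide_right_mono) auto
      then have "hi c \<le> 1 - 1 / K" using K0 by (simp add: field_simps)
      then have 2: "1 / K \<le> 1 - y" using y by linarith
      have "1 / K / 2 \<le> y * (1 - y)"
      proof (cases "y \<le> 1 / 2")
        case True
        have "1 / K * (1 / 2) \<le> y * (1 - y)" using 1 True y01 by (intro mult_mono) auto
        then show ?thesis by simp
      next
        case False
        have "(1 / 2) * (1 / K) \<le> y * (1 - y)" using 2 False y01 by (intro mult_mono) auto
        then show ?thesis by simp
      qed
      then show ?thesis using 3 y01 by (simp add: \<alpha>_def \<gamma>_def)
    qed
  qed
  have u0: "u \<ge> 0" unfolding u_def
    by (rule sum_nonneg) (use pt p g in \<open>auto simp: w_def lo_def hi_def\<close>)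
  \<comment> \<open>Dropping \<open>a\<close> and \<open>b\<close> costs variance at most 1/4 each,
    so at least \<open>(u - 1) / 2\<close> remains, and never less than 0.\<close>
  have D: "\<bar>coeff ([:- 1, 1:] * gen (A - {a, b}) x) k\<bar> \<le> 16 / (1 + u)"
    if ab: "a \<in> A" "b \<in> A" "a \<noteq> b" and x: "\<And>i. i \<in> A \<Longrightarrow> x i \<in> {lo (g i)..hi (g i)}"
      and xs: "\<And>c. (\<Sum>i | i \<in> A \<and> g i = c. x i) = s c" for x a b k
  proof -
    have xp: "0 \<le> x i" "x i \<le> 1" "w x i / 2 \<le> x i * (1 - x i)" if "i \<in> A" for i
      using pt[of "g i" "x i"] x[OF that] g[OF that] by (auto simp: w_def)
    let ?v = "\<lambda>i. x i * (1 - x i)"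
    have q: "?v i \<le> 1 / 4" for i
      using zero_le_power2[of "x i - 1 / 2"] by (simp add: power2_eq_square algebra_simps)
    have "sum ?v A = ?v a + ?v b + sum ?v (A - {a, b})"
    proof -
      have "A - {a, b} = A - {a} - {b}" by auto
      then show ?thesis using A ab
        by (simp add: sum.remove[of A a] sum.remove[of "A - {a}" b])
    qed
    moreover have "u / 2 \<le> sum ?v A"
      unfolding sum_w[OF xs, symmetric] sum_divide_distrib by (rule sum_mono) (use xp in auto)
    ultimately have v: "u / 2 - 1 / 2 \<le> sum ?v (A - {a, b})" using q[of a] q[of b] by linarith
    have v0: "0 \<le> sum ?v (A - {a, b})" by (rule sum_nonneg) (use xp in auto)
    have "\<bar>coeff ([:- 1, 1:] * gen (A - {a, b}) x) k\<bar> \<le> 4 / (1 + sum ?v (A - {a, b}))"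
      by (rule coeff_diff_gen_le) (use A xp in auto)
    also have "\<dots> \<le> 16 / (1 + u)"
      using v v0 u0 by (simp add: divide_simps)
    finally show ?thesis .
  qed
  have main: "\<bar>head R (gen A p) - head R (gen A p')\<bar> \<le> 1 / K * (16 / (1 + u)) * (\<Sum>i\<in>A. \<bar>p i - p' i\<bar>)"
  proof (rule head_gen_same_group_sums[where lo = lo and hi = hi and g = g and s = s])
    show "hi c - lo c \<le> 1 / K" for c by (simp add: lo_def hi_def diff_divide_distrib[symmetric])
  qed (use A D p p' eq in \<open>auto simp: lo_def hi_def s_def\<close>)
  \<comment> \<open>The mass to be moved is at most \<open>2 * u\<close>; against the smoothness
    bound it leaves \<open>u / (1 + u) \<le> 1\<close>, so the size of \<open>A\<close>
    disappears.\<close>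
  have "(\<Sum>i\<in>A. \<bar>p i - p' i\<bar>) \<le> (\<Sum>i\<in>A. w p i + w p' i)"
  proof (rule sum_mono)
    fix i assume i: "i \<in> A"
    have p01: "0 \<le> p i" "p i \<le> 1" "0 \<le> p' i" "p' i \<le> 1"
      using pt[of "g i" "p i"] pt[of "g i" "p' i"] p[OF i] p'[OF i] g[OF i] by (auto simp: lo_def hi_def)
    have "\<bar>p i - p' i\<bar> \<le> (real (g i) + 1) / K - real (g i) / K"
      using p[OF i] p'[OF i] by (auto simp: abs_le_iff)
    then have d: "\<bar>p i - p' i\<bar> \<le> 1 / K" by (simp add: diff_divide_distrib[symmetric])
    have "1 / K \<ge> 0" using K0 by simp
    then show "\<bar>p i - p' i\<bar> \<le> w p i + w p' i"
      using p01 d by (auto simp: w_def \<alpha>_def \<gamma>_def)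
  qed
  also have "\<dots> = 2 * u"
    using sum_w[of p] sum_w[of p'] eq by (simp add: sum.distrib s_def)
  finally have "1 / K * (16 / (1 + u)) * (\<Sum>i\<in>A. \<bar>p i - p' i\<bar>) \<le> 1 / K * (16 / (1 + u)) * (2 * u)"
    using K0 u0 by (intro mult_left_mono) auto
  also have "\<dots> = 32 / K * (u / (1 + u))" by simp
  also have "\<dots> \<le> 32 / K * 1" using K0 u0 by (intro mult_left_mono) auto
  finally show ?thesis using main by simp
qed

section \<open>Poisson binomial tails as partial sums of coefficients\<close>

lemma prob_bernoulli_bind:
  assumes "0 \<le> p" "p \<le> 1"
  shows "measure_pmf.prob (bernoulli_pmf p \<bind> f) X
       = p * measure_pmf.prob (f True) X + (1 - p) * measure_pmf.prob (f False) X"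
proof -
  have "measure_pmf.prob (bernoulli_pmf p \<bind> f) X
      = measure_pmf.expectation (bernoulli_pmf p) (\<lambda>b. measure_pmf.prob (f b) X)"
    unfolding measure_pmf_bind
    by (subst measure_pmf.measure_bind[where N = "count_space UNIV"]) (auto simp: space_subprob_algebra
        intro!: measure_pmf.subprob_space_axioms)
  then show ?thesis using assms by simp
qed

lemma prob_card_less_eq_head:
  assumes "finite A" "\<And>i. i \<in> A \<Longrightarrow> p i \<in> {0..1}"
  shows "measure_pmf.prob (Pi_pmf A False (\<lambda>i. bernoulli_pmf (p i))) {w. card {i \<in> A. w i} < k}
       = head k (gen A p)"
  using assms
proof (induction A arbitrary: k rule: finite_induct)
  case empty
  show ?case by (cases k) (simp_all add: gen_def head_def coeff_1 sum.If_cases)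
next
  case (insert a A)
  have pa: "0 \<le> p a" "p a \<le> 1" using insert.prems by auto
  let ?P = "Pi_pmf A False (\<lambda>i. bernoulli_pmf (p i))"
  have card: "card {i \<in> insert a A. (f(a := y)) i} = (if y then Suc (card {i \<in> A. f i}) else card {i \<in> A. f i})"
    for f :: "'a \<Rightarrow> bool" and y
  proof -
    have "{i \<in> insert a A. (f(a := y)) i} = (if y then insert a {i \<in> A. f i} else {i \<in> A. f i})"
      using insert.hyps by auto
    then show ?thesis using insert.hyps by simp
  qed
  have upd: "measure_pmf.prob (?P \<bind> (\<lambda>f. return_pmf (f(a := y)))) {w. card {i \<in> insert a A. w i} < k}
      = measure_pmf.prob ?P {f. (if y then Suc (card {i \<in> A. f i}) else card {i \<in> A. f i}) < k}" for y
    unfolding map_pmf_def[symmetric] measure_map_pmf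
    by (rule arg_cong[where f = "measure_pmf.prob ?P"]) (simp only: vimage_def mem_Collect_eq card)
  have "measure_pmf.prob (Pi_pmf (insert a A) False (\<lambda>i. bernoulli_pmf (p i))) {w. card {i \<in> insert a A. w i} < k}
      = p a * measure_pmf.prob ?P {f. Suc (card {i \<in> A. f i}) < k}
      + (1 - p a) * measure_pmf.prob ?P {f. card {i \<in> A. f i} < k}"
    unfolding Pi_pmf_insert'[OF insert.hyps] prob_bernoulli_bind[OF pa] upd by simp
  also have "\<dots> = head k (gen (insert a A) p)"
  proof (cases k)
    case 0
    then show ?thesis by (simp add: head_0)
  next
    case (Suc j)
    then show ?thesis using insert by (simp add: gen_insert head_lin_mult_Suc)
  qed
  finally show ?case .
qed

text \<open>\<open>[:0, 1:]\<close> is \<open>lin 1\<close>: a certain vote lowers the threshold by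
  one. Truncated subtraction is right because \<open>head 0\<close> vanishes.\<close>

lemma head_monom_mult: "head k ([:0, 1:] ^ v * q) = head (k - v) q"
proof (induction v arbitrary: k)
  case (Suc v)
  have "head k ([:0, 1:] * r) = head (k - 1) r" for r
  proof (cases k)
    case (Suc j)
    have "[:0, 1:] = (lin 1 :: real poly)" by (simp add: lin_def)
    then show ?thesis using head_lin_mult_Suc[of j 1 r] Suc by simp
  qed (simp add: head_0)
  then show ?case using Suc by (simp add: mult.assoc)
qed simp

subsection \<open>The objective value\<close>

text \<open>For a rival this is the final count: a bribed vote goes to the designated candidate or
  is lost, whatever the outcome of the lottery.\<close>

definition unbribed_votes :: "bvu \<Rightarrow> nat set \<Rightarrow> nat \<Rightarrow> nat" where
  "unbribed_votes B J j = card {i \<in> voters B. i \<notin> bribed B J \<and> vote B i = j}"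

text \<open>A relation instead of \<open>Max\<close>, so that it can be read off the loop invariant
  for the program variable \<open>mx\<close>; the alternative \<open>x = 0\<close> is the initial
  value of that variable.\<close>

definition rival_max :: "bvu \<Rightarrow> nat set \<Rightarrow> nat \<Rightarrow> bool" where
  "rival_max B J x \<longleftrightarrow> (\<forall>j\<in>{1..<num_cands B}. unbribed_votes B J j \<le> x) \<and>
     (x = 0 \<or> (\<exists>j\<in>{1..<num_cands B}. x = unbribed_votes B J j))"

text \<open>Every voter gets a factor, certain supporters with probability 1 and unbribed voters of
  rivals with 0. This lets the evaluation treat all voters alike.\<close>

definition gain_prob :: "bvu \<Rightarrow> nat set \<Rightarrow> nat \<Rightarrow> real" where
  "gain_prob B J i = (if vote B i = num_cands B then 1 else if i \<in> J then prob B i else 0)"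

lemma finite_voters [simp]: "finite (voters B)"
  by (simp add: voters_def)

lemma finite_bribed [simp]: "finite (bribed B J)"
  by (simp add: bribed_def)

lemma finite_supporters [simp]: "finite (supporters B j)"
  by (simp add: supporters_def)

lemma gen_gain_prob:
  "(gen (voters B) (gain_prob B J) :: real poly)
   = [:0, 1:] ^ card (supporters B (num_cands B)) * gen (bribed B J) (prob B)"
proof -
  let ?S = "supporters B (num_cands B)" and ?R = "voters B - supporters B (num_cands B) - bribed B J"
  let ?G = "\<lambda>A. gen A :: _ \<Rightarrow> real poly"
  have V: "voters B = (?S \<union> bribed B J) \<union> ?R" by (auto simp: supporters_def bribed_def)
  have Un: "?G (X \<union> Y) f = ?G X f * ?G Y f" if "finite X" "finite Y" "X \<inter> Y = {}"
    for X Y :: "nat set" and f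
    using that by (simp add: gen_def prod.union_disjoint)
  have "?G (voters B) (gain_prob B J)
      = ?G ?S (gain_prob B J) * ?G (bribed B J) (gain_prob B J) * ?G ?R (gain_prob B J)"
    by (subst V, subst Un, simp, simp, blast, subst Un) (auto simp: bribed_def)
  moreover have "?G ?S (gain_prob B J) = [:0, 1:] ^ card ?S"
    unfolding gen_def by (subst prod.cong[OF refl, of _ _ "\<lambda>_. [:0, 1:]"])
      (auto simp: supporters_def gain_prob_def lin_def)
  moreover have "?G ?R (gain_prob B J) = 1"
    unfolding gen_def by (intro prod.neutral) (auto simp: supporters_def bribed_def gain_prob_def lin_def one_pCons)
  moreover have "?G (bribed B J) (gain_prob B J) = ?G (bribed B J) (prob B)"
    by (rule gen_cong) (auto simp: supporters_def bribed_def gain_prob_def)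
  ultimately show ?thesis by simp
qed

lemma objective_eq_head:
  assumes B: "bvu_instance B" and x: "rival_max B J x"
  shows "objective B J = 1 - head (Suc x) (gen (voters B) (gain_prob B J))"
proof -
  let ?m = "num_cands B"
  let ?v = "card (supporters B ?m)"
  let ?P = "Pi_pmf (bribed B J) False (\<lambda>i. bernoulli_pmf (prob B i))"
  have m: "?m \<ge> 2" using B by (simp add: bvu_instance_def)
  have "designated_wins B J w \<longleftrightarrow> \<not> card {i \<in> bribed B J. w i} < Suc x - ?v" for w
  proof -
    have other: "counted_votes B J w j = unbribed_votes B J j" if "j \<in> {1..<?m}" for j
      unfolding counted_votes_def unbribed_votes_def
      by (rule arg_cong[where f = card]) (use that in \<open>auto simp: ballot_def\<close>)
    have "{i \<in> voters B. ballot B J w i = Some ?m} = {i \<in> bribed B J. w i} \<union> supporters B ?m"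
      by (auto simp: ballot_def bribed_def supporters_def)
    then have own: "counted_votes B J w ?m = card {i \<in> bribed B J. w i} + ?v"
      unfolding counted_votes_def by (subst card_Un_disjoint[symmetric]) (auto simp: bribed_def)
    \<comment> \<open>Candidate 1 is a rival since there are at least two candidates; so for
      \<open>x = 0\<close> the maximum is attained, too.\<close>
    have "designated_wins B J w \<longleftrightarrow> x < counted_votes B J w ?m"
      using x m unfolding designated_wins_def rival_max_def by (auto simp: other)
         (metis atLeastLessThan_iff le_refl less_numeral_extra(3) not_less_eq_eq numeral_2_eq_2 One_nat_def
           other bot_nat_0.not_eq_extremum Suc_le_eq le_less_trans)+
    then show ?thesis unfolding own by auto
  qed
  then have "{w. designated_wins B J w} = UNIV - {w. card {i \<in> bribed B J. w i} < Suc x - ?v}"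
    by auto
  then have "objective B J = 1 - measure_pmf.prob ?P {w. card {i \<in> bribed B J. w i} < Suc x - ?v}"
    unfolding objective_def by (simp add: measure_pmf.prob_compl[simplified])
  also have "measure_pmf.prob ?P {w. card {i \<in> bribed B J. w i} < Suc x - ?v}
      = head (Suc x - ?v) (gen (bribed B J) (prob B))"
    by (rule prob_card_less_eq_head) (use B in \<open>auto simp: bvu_instance_def bribed_def\<close>)
  finally show ?thesis unfolding gen_gain_prob head_monom_mult .
qed

lemma rival_max_exists:
  assumes "bvu_instance B"
  obtains x where "rival_max B J x"
proof -
  let ?S = "unbribed_votes B J ` {1..<num_cands B}"
  have S: "finite ?S" "?S \<noteq> {}" using assms by (auto simp: bvu_instance_def)
  have "rival_max B J (Max ?S)"
    using Max_in[OF S] Max_ge[OF S(1)] unfolding rival_max_def by blast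
  then show thesis by (rule that)
qed

lemma objective_bounds: "0 \<le> objective B J" "objective B J \<le> 1"
  by (simp_all add: objective_def)

lemma objective_bribed: "bribed B J = bribed B J' \<Longrightarrow> objective B J = objective B J'"
proof -
  assume eq: "bribed B J = bribed B J'"
  have "designated_wins B J = designated_wins B J'"
    by (intro ext) (simp add: designated_wins_def counted_votes_def ballot_def eq)
  then show ?thesis by (simp add: objective_def eq)
qed

lemma OPT_attained:
  assumes "bvu_instance B"
  obtains J where "feasible B J" "OPT B = objective B J" "OPT B \<in> {0..1}"
proof -
  have fin: "finite {I. feasible B I}"
    by (rule finite_subset[of _ "Pow (voters B)"]) (auto simp: feasible_def)
  have "feasible B {}" using assms by (auto simp: feasible_def bvu_instance_def)
  then have "OPT B \<in> objective B ` {I. feasible B I}"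
    unfolding OPT_def by (intro Max_in) (use fin in auto)
  then show thesis using that objective_bounds by auto
qed

subsection \<open>Rounding the probabilities\<close>

text \<open>The minimum with \<open>K - 1\<close> puts \<open>p = 1\<close> into the last
  bucket.\<close>

definition bucket :: "nat \<Rightarrow> real \<Rightarrow> nat" where
  "bucket K p = min (nat \<lfloor>p * K\<rfloor>) (K - 1)"

text \<open>Position inside the bucket in units of \<open>1 / (K * n)\<close>; for
  \<open>p = 1\<close> it is \<open>n\<close>, not \<open>n - 1\<close>.\<close>

definition offset :: "nat \<Rightarrow> nat \<Rightarrow> real \<Rightarrow> nat" where
  "offset K n p = nat \<lfloor>(p * K - bucket K p) * n\<rfloor>"

lemma bucket_bounds:
  assumes "p \<in> {0..1}" "K > 0"
  shows "bucket K p < K" "real (bucket K p) \<le> p * K" "p * K \<le> real (bucket K p) + 1"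
proof -
  show "bucket K p < K" using assms by (auto simp: bucket_def)
  have "p * K \<le> K" using assms by (simp add: mult_left_le_one_le)
  then show "real (bucket K p) \<le> p * K" "p * K \<le> real (bucket K p) + 1"
    using assms by (auto simp: bucket_def min_def of_nat_diff) linarith+
qed

lemma offset_bounds:
  assumes "p \<in> {0..1}" "K > 0"
  shows "offset K n p \<le> n" "real (offset K n p) \<le> (p * K - bucket K p) * n"
    "(p * K - bucket K p) * n < real (offset K n p) + 1"
proof -
  let ?y = "(p * K - bucket K p) * n"
  have y: "0 \<le> ?y" using bucket_bounds[OF assms] by simp
  have "?y \<le> 1 * real n" using bucket_bounds[OF assms] by (intro mult_right_mono) auto
  then show "offset K n p \<le> n" unfolding offset_def by linarith
  show "real (offset K n p) \<le> ?y" "?y < real (offset K n p) + 1"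
    using y unfolding offset_def by linarith+
qed

text \<open>Two sets with one profile may consist of different voters. A bijection that respects
  buckets moves both probability vectors to one index set, where transfers make sense.\<close>

lemma bij_betw_same_fibre_card:
  assumes "finite I" "finite J" "\<And>c. card {i \<in> I. g i = c} = card {i \<in> J. g i = c}"
  obtains h where "bij_betw h I J" "\<And>i. i \<in> I \<Longrightarrow> g (h i) = g i"
proof -
  have "\<exists>f. bij_betw f {i \<in> I. g i = c} {i \<in> J. g i = c}" for c
    using assms by (intro finite_same_card_bij) auto
  then obtain f where f: "\<And>c. bij_betw (f c) {i \<in> I. g i = c} {i \<in> J. g i = c}" by metis
  define h where "h i = f (g i) i" for i
  have h: "h i \<in> J \<and> g (h i) = g i" if "i \<in> I" for i
    using bij_betwE[OF f[of "g i"]] that by (auto simp: h_def)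
  have "inj_on h I"
  proof (rule inj_onI)
    fix i i' assume *: "i \<in> I" "i' \<in> I" "h i = h i'"
    then have "g i = g i'" using h by metis
    then show "i = i'" using * inj_onD[OF bij_betw_imp_inj_on[OF f[of "g i"]], of i i'] by (auto simp: h_def)
  qed
  moreover have "h ` I = J"
  proof
    show "J \<subseteq> h ` I"
    proof
      fix j assume "j \<in> J"
      then have "j \<in> f (g j) ` {i \<in> I. g i = g j}" using bij_betw_imp_surj_on[OF f[of "g j"]] by auto
      then obtain i where "i \<in> I" "g i = g j" "j = f (g j) i" by blast
      then show "j \<in> h ` I" by (intro image_eqI[of _ _ i]) (simp_all add: h_def)
    qed
  qed (use h in auto)
  ultimately show thesis using that[of h] h by (auto simp: bij_betw_def)
qed

text \<open>\<open>34 = 32 + 1 + 1\<close>: rounding down to \<open>r\<close> moves at most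
  \<open>n\<close> voters by at most \<open>1 / (K * n)\<close> on either side, and the rounded
  vectors agree in all bucket sums.\<close>

lemma head_gen_same_profile:
  fixes p :: "nat \<Rightarrow> real"
  assumes fin: "finite I" "finite J" and K: "K \<ge> 2" and n: "n > 0" "card I \<le> n" "card J \<le> n"
    and pI: "\<And>i. i \<in> I \<Longrightarrow> p i \<in> {0..1}" and pJ: "\<And>i. i \<in> J \<Longrightarrow> p i \<in> {0..1}"
    and cards: "\<And>c. card {i \<in> I. bucket K (p i) = c} = card {i \<in> J. bucket K (p i) = c}"
    and offs: "\<And>c. (\<Sum>i | i \<in> I \<and> bucket K (p i) = c. offset K n (p i))
        = (\<Sum>i | i \<in> J \<and> bucket K (p i) = c. offset K n (p i))"
  shows "\<bar>head R (gen I p) - head R (gen J p)\<bar> \<le> 34 / K"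
proof -
  let ?g = "\<lambda>i. bucket K (p i)"
  have K0: "real K > 0" "K > 0" using K by auto
  have n0: "real n > 0" using n by simp
  define r where "r i = (real (?g i) + real (offset K n (p i)) / n) / K" for i
  have r: "real (?g i) / K \<le> r i" "r i \<le> (real (?g i) + 1) / K" "\<bar>p i - r i\<bar> \<le> 1 / (real K * n)"
    "r i \<in> {0..1}" if i: "i \<in> I \<or> i \<in> J" for i
  proof -
    have pi: "p i \<in> {0..1}" using pI pJ i by blast
    note b = bucket_bounds[OF pi K0(2)] and o = offset_bounds[OF pi K0(2), of n]
    have o1: "real (offset K n (p i)) / n \<le> 1" using o(1) n0 by simp
    show lo: "real (?g i) / K \<le> r i" unfolding r_def using K0 by (intro divide_right_mono) auto
    show hi: "r i \<le> (real (?g i) + 1) / K" unfolding r_def using K0 o1 by (intro divide_right_mono) auto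
    have "real (offset K n (p i)) / n \<le> p i * K - ?g i" "p i * K - ?g i \<le> (real (offset K n (p i)) + 1) / n"
      using o(2,3) n0 by (simp_all add: pos_divide_le_eq pos_le_divide_eq)
    moreover have "r i * K = real (?g i) + real (offset K n (p i)) / n"
      using K0 by (simp add: r_def)
    ultimately have "r i * K \<le> p i * K" "p i * K \<le> r i * K + 1 / n"
      by (auto simp: add_divide_distrib)
    then have "\<bar>p i - r i\<bar> * K \<le> 1 / n" using K0
      by (simp add: abs_mult_pos[symmetric] left_diff_distrib)
    then show "\<bar>p i - r i\<bar> \<le> 1 / (real K * n)"
      using K0 n0 by (simp add: field_simps)
    have "(real (?g i) + 1) / K \<le> 1" using b(1) K0 by simp
    moreover have "0 \<le> real (?g i) / K" by simp
    ultimately show "r i \<in> {0..1}" using lo hi unfolding atLeastAtMost_iff by linarith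
  qed
  have round: "\<bar>head R (gen A p) - head R (gen A r)\<bar> \<le> 1 / K"
    if A: "finite A" "card A \<le> n" "A \<subseteq> I \<or> A \<subseteq> J" for A
  proof -
    have "\<bar>head R (gen A p) - head R (gen A r)\<bar> \<le> (\<Sum>i\<in>A. \<bar>p i - r i\<bar>)"
      by (rule head_gen_lipschitz) (use A pI pJ r(4) in blast)+
    also have "\<dots> \<le> real (card A) * (1 / (real K * n))"
      by (rule sum_bounded_above) (use A r(3) in blast)
    also have "\<dots> \<le> real n * (1 / (real K * n))" using A by (intro mult_right_mono) auto
    also have "\<dots> = 1 / K" using n0 by simp
    finally show ?thesis .
  qed
  obtain h where h: "bij_betw h I J" "\<And>i. i \<in> I \<Longrightarrow> ?g (h i) = ?g i"
    using bij_betw_same_fibre_card[OF fin cards] by blast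
  have hJ: "i \<in> I \<Longrightarrow> h i \<in> J" for i using bij_betwE[OF h(1)] by blast
  have "gen J r = (gen I (\<lambda>i. r (h i)) :: real poly)"
    unfolding gen_def using prod.reindex_bij_betw[OF h(1), of "\<lambda>i. lin (r i) :: real poly"] by simp
  moreover have "\<bar>head R (gen I r) - head R (gen I (\<lambda>i. r (h i)))\<bar> \<le> 32 / K"
  proof (rule head_gen_same_bucket_sums[where g = ?g])
    show "finite I" "2 \<le> K" by fact+
    show "?g i < K" if "i \<in> I" for i using bucket_bounds(1)[OF pI[OF that] K0(2)] .
    show "real (?g i) / K \<le> r i \<and> r i \<le> (real (?g i) + 1) / K" if "i \<in> I" for i
      using r(1,2) that by blast
    show "real (?g i) / K \<le> r (h i) \<and> r (h i) \<le> (real (?g i) + 1) / K" if "i \<in> I" for i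
      using r(1,2)[of "h i"] hJ[OF that] h(2)[OF that] by simp
    fix c
    \<comment> \<open>A bucket sum of \<open>r\<close> depends only on the two statistics of the
      profile, the number of voters and the sum of offsets.\<close>
    have sum_r: "(\<Sum>i | i \<in> A \<and> ?g i = c. r i)
        = (real c * card {i \<in> A. ?g i = c} + real (\<Sum>i | i \<in> A \<and> ?g i = c. offset K n (p i)) / n) / K" for A
    proof -
      have "(\<Sum>i | i \<in> A \<and> ?g i = c. r i) = (\<Sum>i | i \<in> A \<and> ?g i = c. (real c + real (offset K n (p i)) / n) / K)"
        by (rule sum.cong) (auto simp: r_def)
      then show ?thesis
        by (simp add: sum_divide_distrib[symmetric] sum.distrib mult.commute)
    qed
    have "bij_betw h {i \<in> I. ?g i = c} {i \<in> J. ?g i = c}"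
    proof (rule bij_betw_imageI)
      show "inj_on h {i \<in> I. ?g i = c}" using bij_betw_imp_inj_on[OF h(1)] by (rule inj_on_subset) auto
      show "h ` {i \<in> I. ?g i = c} = {i \<in> J. ?g i = c}"
        using bij_betw_imp_surj_on[OF h(1)] h(2) by force
    qed
    then have "(\<Sum>i | i \<in> I \<and> ?g i = c. r (h i)) = (\<Sum>i | i \<in> J \<and> ?g i = c. r i)"
      by (rule sum.reindex_bij_betw)
    then show "(\<Sum>i | i \<in> I \<and> ?g i = c. r i) = (\<Sum>i | i \<in> I \<and> ?g i = c. r (h i))"
      unfolding sum_r using cards offs by simp
  qed
  ultimately show ?thesis using round[of I] round[of J] fin n by auto
qed

text \<open>The vote counts fix the totals of the rivals and thus the threshold, so only the tails
  have to be compared. \<open>I\<close> has no supporters of the designated candidate, and the vote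
  count for that candidate passes this on to \<open>J\<close>.\<close>

lemma objective_same_profile:
  assumes B: "bvu_instance B" and K: "K \<ge> 2" and n: "n = num_voters B"
    and I: "I \<subseteq> voters B" "I \<inter> supporters B (num_cands B) = {}" and J: "J \<subseteq> voters B"
    and votes: "\<And>j. j \<in> {1..num_cands B} \<Longrightarrow> card {i \<in> I. vote B i = j} = card {i \<in> J. vote B i = j}"
    and cards: "\<And>c. card {i \<in> I. bucket K (prob B i) = c} = card {i \<in> J. bucket K (prob B i) = c}"
    and offs: "\<And>c. (\<Sum>i | i \<in> I \<and> bucket K (prob B i) = c. offset K n (prob B i))
        = (\<Sum>i | i \<in> J \<and> bucket K (prob B i) = c. offset K n (prob B i))"
  shows "objective B J \<ge> objective B I - 34 / K"
proof -
  let ?m = "num_cands B"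
  have m: "?m \<ge> 2" using B by (simp add: bvu_instance_def)
  have fin: "finite I" "finite J" using I J by (auto intro: finite_subset[OF _ finite_voters])
  have "{i \<in> I. vote B i = ?m} = {}" using I by (auto simp: supporters_def)
  then have "card {i \<in> J. vote B i = ?m} = 0" using votes[of ?m] m by (metis atLeastAtMost_iff card.empty
      dual_order.refl le_trans one_le_numeral)
  then have J0: "J \<inter> supporters B ?m = {}" using fin by (auto simp: supporters_def)
  have br: "bribed B I = I" "bribed B J = J" using I J J0 by (auto simp: bribed_def)
  have ub: "unbribed_votes B A j = card (supporters B j) - card {i \<in> A. vote B i = j}"
    if "A \<subseteq> voters B" "bribed B A = A" for A j
  proof -
    have "{i \<in> voters B. i \<notin> A \<and> vote B i = j} = supporters B j - {i \<in> A. vote B i = j}"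
      by (auto simp: supporters_def)
    moreover have "{i \<in> A. vote B i = j} \<subseteq> supporters B j" using that by (auto simp: supporters_def)
    ultimately show ?thesis unfolding unbribed_votes_def that(2)
      by (simp add: card_Diff_subset finite_subset[OF _ finite_supporters])
  qed
  obtain x where x: "rival_max B I x" using rival_max_exists[OF B] .
  have "unbribed_votes B I j = unbribed_votes B J j" if "j \<in> {1..<?m}" for j
    using ub[OF I(1) br(1)] ub[OF J br(2)] votes[of j] that by simp
  then have x': "rival_max B J x" using x unfolding rival_max_def by simp
  have c: "card A \<le> n" if "A \<subseteq> voters B" for A
    using card_mono[OF finite_voters that] by (simp add: voters_def n)
  have "card (supporters B 1) > 0" using B m unfolding bvu_instance_def
    by (metis atLeastAtMost_iff dual_order.refl gr_zeroI not_less0)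
  then have "n > 0" unfolding n by (auto simp: supporters_def voters_def card_gt_0_iff)
  let ?v = "card (supporters B ?m)"
  have "\<bar>head (Suc x - ?v) (gen I (prob B)) - head (Suc x - ?v) (gen J (prob B))\<bar> \<le> 34 / K"
    by (rule head_gen_same_profile[of _ _ _ n])
       (use fin K \<open>n > 0\<close> c I(1) J cards offs B in \<open>auto simp: bvu_instance_def subset_eq\<close>)
  then show ?thesis
    unfolding objective_eq_head[OF B x] objective_eq_head[OF B x'] gen_gain_prob head_monom_mult br
    by (simp add: abs_le_iff)
qed

subsection \<open>Keys of sets of voters\<close>

lemma sum_digits_less:
  fixes W :: nat
  assumes "\<And>t. t < T \<Longrightarrow> d t < W"
  shows "(\<Sum>t<T. d t * W ^ t) < W ^ T"
  using assms
proof (induction T)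
  case (Suc T)
  have "(\<Sum>t<T. d t * W ^ t) < W ^ T" using Suc by simp
  moreover have "Suc (d T) * W ^ T \<le> W * W ^ T" using Suc.prems[of T] by (intro mult_right_mono) auto
  ultimately show ?case by simp
qed simp

lemma digits_unique:
  fixes W :: nat
  assumes "\<And>t. t < T \<Longrightarrow> d t < W" "\<And>t. t < T \<Longrightarrow> e t < W"
    and "(\<Sum>t<T. d t * W ^ t) = (\<Sum>t<T. e t * W ^ t)" and "t < T"
  shows "d t = e t"
  using assms
proof (induction T)
  case (Suc T)
  let ?D = "\<Sum>t<T. d t * W ^ t" and ?E = "\<Sum>t<T. e t * W ^ t"
  have lt: "?D < W ^ T" "?E < W ^ T" using Suc.prems(1,2) by (auto intro!: sum_digits_less)
  have eq: "?D + d T * W ^ T = ?E + e T * W ^ T" using Suc.prems(3) by simp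
  have W: "W ^ T \<noteq> 0" using lt by linarith
  have "d T = (?D + d T * W ^ T) div W ^ T" using lt W by simp
  also have "\<dots> = e T" unfolding eq using lt W by simp
  finally have "d T = e T" .
  then show ?case using Suc eq by (cases "t = T") auto
qed simp

text \<open>At most n codes are added and each has digits of at most n, so no carry occurs.\<close>

definition radix :: "bvu \<Rightarrow> nat" where
  "radix B = num_voters B * num_voters B + 1"

definition num_digits :: "bvu \<Rightarrow> nat \<Rightarrow> nat" where
  "num_digits B K = num_cands B + K + K + 1"

definition vbucket :: "bvu \<Rightarrow> nat \<Rightarrow> nat \<Rightarrow> nat" where
  "vbucket B K i = bucket K (prob B i)"

definition voffset :: "bvu \<Rightarrow> nat \<Rightarrow> nat \<Rightarrow> nat" where
  "voffset B K i = offset K (num_voters B) (prob B i)"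

text \<open>Digits up to \<open>num_cands B\<close> count voters by candidate, the next
  \<open>K\<close> count them by bucket, the last \<open>K\<close> add up offsets. Candidates start
  at 1, so digit 0 of a voter's code is 0.\<close>

definition code :: "bvu \<Rightarrow> nat \<Rightarrow> nat \<Rightarrow> nat" where
  "code B K i = radix B ^ vote B i + radix B ^ (num_cands B + 1 + vbucket B K i)
     + voffset B K i * radix B ^ (num_cands B + 1 + K + vbucket B K i)"

definition vdigit :: "bvu \<Rightarrow> nat \<Rightarrow> nat \<Rightarrow> nat \<Rightarrow> nat" where
  "vdigit B K i t = (if t = vote B i then 1 else 0) + (if t = num_cands B + 1 + vbucket B K i then 1 else 0)
     + (if t = num_cands B + 1 + K + vbucket B K i then voffset B K i else 0)"

definition num_keys :: "bvu \<Rightarrow> nat \<Rightarrow> nat" where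
  "num_keys B K = radix B ^ num_digits B K"

lemma vbucket_less: "bvu_instance B \<Longrightarrow> K > 0 \<Longrightarrow> i \<in> voters B \<Longrightarrow> vbucket B K i < K"
  unfolding vbucket_def by (rule bucket_bounds) (auto simp: bvu_instance_def)

lemma voffset_le: "bvu_instance B \<Longrightarrow> K > 0 \<Longrightarrow> i \<in> voters B \<Longrightarrow> voffset B K i \<le> num_voters B"
  unfolding voffset_def by (rule offset_bounds) (auto simp: bvu_instance_def)

lemma code_eq_digits:
  assumes "bvu_instance B" "K > 0" "i \<in> voters B"
  shows "code B K i = (\<Sum>t<num_digits B K. vdigit B K i t * radix B ^ t)"
proof -
  have v: "vote B i < num_digits B K" using assms by (auto simp: num_digits_def bvu_instance_def)
  have b: "num_cands B + 1 + vbucket B K i < num_digits B K"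
    "num_cands B + 1 + K + vbucket B K i < num_digits B K"
    using vbucket_less[OF assms] by (auto simp: num_digits_def)
  have single: "(\<Sum>t<num_digits B K. (if t = s then c else 0) * radix B ^ t) = c * radix B ^ s"
    if "s < num_digits B K" for s c
  proof -
    have "(\<Sum>t<num_digits B K. (if t = s then c else 0) * radix B ^ t)
        = (\<Sum>t<num_digits B K. if t = s then c * radix B ^ s else 0)"
      by (rule sum.cong) auto
    then show ?thesis using that by simp
  qed
  show ?thesis
    unfolding vdigit_def distrib_right sum.distrib single[OF v] single[OF b(1)] single[OF b(2)]
    by (simp add: code_def)
qed

lemma num_voters_pos: "bvu_instance B \<Longrightarrow> num_voters B > 0"
proof -
  assume B: "bvu_instance B"
  then have "card (supporters B (num_cands B)) < card (supporters B 1)"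
    by (auto simp: bvu_instance_def)
  then have "supporters B 1 \<noteq> {}" by auto
  then show ?thesis by (auto simp: supporters_def voters_def)
qed

lemma sum_code_eq_digits:
  assumes "bvu_instance B" "K > 0" "J \<subseteq> voters B"
  shows "sum (code B K) J = (\<Sum>t<num_digits B K. (\<Sum>i\<in>J. vdigit B K i t) * radix B ^ t)"
proof -
  have "sum (code B K) J = (\<Sum>i\<in>J. \<Sum>t<num_digits B K. vdigit B K i t * radix B ^ t)"
    by (rule sum.cong) (use code_eq_digits assms in auto)
  then show ?thesis by (subst (asm) sum.swap) (simp add: sum_distrib_right)
qed

text \<open>The three positions in \<open>vdigit\<close> are distinct, as a vote is at most
  \<open>num_cands B\<close> and a bucket is below \<open>K\<close>; so one voter contributes at
  most n to a digit.\<close>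

lemma sum_vdigit_less:
  assumes B: "bvu_instance B" "K > 0" and J: "J \<subseteq> voters B"
  shows "(\<Sum>i\<in>J. vdigit B K i t) < radix B"
proof -
  have "vdigit B K i t \<le> num_voters B" if "i \<in> J" for i
  proof -
    have i: "i \<in> voters B" using that J by auto
    have "vote B i \<le> num_cands B" using B i by (auto simp: bvu_instance_def)
    then show ?thesis
      using vbucket_less[OF B i] voffset_le[OF B i] num_voters_pos[OF B(1)] by (auto simp: vdigit_def)
  qed
  then have "(\<Sum>i\<in>J. vdigit B K i t) \<le> card J * num_voters B"
    using sum_bounded_above[of J "\<lambda>i. vdigit B K i t" "num_voters B"] by simp
  also have "\<dots> \<le> num_voters B * num_voters B"
    using card_mono[OF finite_voters J] by (intro mult_right_mono) (auto simp: voters_def)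
  finally show ?thesis by (simp add: radix_def)
qed

lemma sum_code_less:
  assumes "bvu_instance B" "K > 0" "J \<subseteq> voters B"
  shows "sum (code B K) J < num_keys B K"
  unfolding sum_code_eq_digits[OF assms] num_keys_def
  by (rule sum_digits_less) (rule sum_vdigit_less[OF assms])

text \<open>Without carries equal keys have equal digits, and these are the statistics of
  \<open>objective_same_profile\<close>. For \<open>c\<close> outside the range of buckets both
  sides are empty.\<close>

lemma objective_same_key:
  assumes B: "bvu_instance B" and K: "K \<ge> 2"
    and I: "I \<subseteq> voters B" "I \<inter> supporters B (num_cands B) = {}" and J: "J \<subseteq> voters B"
    and eq: "sum (code B K) I = sum (code B K) J"
  shows "objective B J \<ge> objective B I - 34 / K"
proof -
  have K0: "K > 0" using K by simp
  let ?m = "num_cands B"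
  have fin: "finite I" "finite J" using I J by (auto intro: finite_subset[OF _ finite_voters])
  have dig: "(\<Sum>i\<in>I. vdigit B K i t) = (\<Sum>i\<in>J. vdigit B K i t)" if "t < num_digits B K" for t
    by (rule digits_unique[where T = "num_digits B K" and W = "radix B"])
       (use sum_vdigit_less[OF B K0] I(1) J eq sum_code_eq_digits[OF B K0] that in auto)
  have vb: "vbucket B K i < K" "vote B i \<le> ?m" if "i \<in> voters B" for i
    using vbucket_less[OF B K0 that] B that by (auto simp: bvu_instance_def)
  have votes: "(\<Sum>i\<in>A. vdigit B K i j) = card {i \<in> A. vote B i = j}"
    if "finite A" "A \<subseteq> voters B" "j \<in> {1..?m}" for A j
  proof -
    have "(\<Sum>i\<in>A. vdigit B K i j) = (\<Sum>i\<in>A. if vote B i = j then 1 else 0)"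
      by (rule sum.cong) (use that in \<open>auto simp: vdigit_def\<close>)
    then show ?thesis using that by (simp add: sum.If_cases Int_def)
  qed
  have cards: "(\<Sum>i\<in>A. vdigit B K i (?m + 1 + c)) = card {i \<in> A. vbucket B K i = c}"
    if "finite A" "A \<subseteq> voters B" "c < K" for A c
  proof -
    have "(\<Sum>i\<in>A. vdigit B K i (?m + 1 + c)) = (\<Sum>i\<in>A. if vbucket B K i = c then 1 else 0)"
      by (rule sum.cong) (use that vb in \<open>force simp: vdigit_def\<close>)+
    then show ?thesis using that by (simp add: sum.If_cases Int_def)
  qed
  have offs: "(\<Sum>i\<in>A. vdigit B K i (?m + 1 + K + c)) = (\<Sum>i | i \<in> A \<and> vbucket B K i = c. voffset B K i)"
    if "finite A" "A \<subseteq> voters B" "c < K" for A c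
  proof -
    have "(\<Sum>i\<in>A. vdigit B K i (?m + 1 + K + c)) = (\<Sum>i\<in>A. if vbucket B K i = c then voffset B K i else 0)"
    proof (rule sum.cong[OF refl])
      fix i assume "i \<in> A"
      then have "i \<in> voters B" using that by auto
      then show "vdigit B K i (?m + 1 + K + c) = (if vbucket B K i = c then voffset B K i else 0)"
        using vb[of i] by (auto simp: vdigit_def)
    qed
    then show ?thesis using that by (simp add: sum.If_cases Int_def)
  qed
  show ?thesis
  proof (rule objective_same_profile[OF B K refl I J])
    show "card {i \<in> I. vote B i = j} = card {i \<in> J. vote B i = j}" if "j \<in> {1..?m}" for j
      using dig[of j] votes[OF fin(1) I(1) that] votes[OF fin(2) J that] that by (simp add: num_digits_def)
    fix c
    have empty: "{i \<in> A. bucket K (prob B i) = c} = {}" if "A \<subseteq> voters B" "\<not> c < K" for A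
      using that vb(1) by (auto simp: vbucket_def)
    show "card {i \<in> I. bucket K (prob B i) = c} = card {i \<in> J. bucket K (prob B i) = c}"
    proof (cases "c < K")
      case True
      then show ?thesis
        using dig[of "?m + 1 + c"] cards[OF fin(1) I(1), of c] cards[OF fin(2) J, of c]
        by (simp add: num_digits_def vbucket_def)
    next
      case False
      then show ?thesis unfolding empty[OF I(1) False] empty[OF J False] by simp
    qed
    show "(\<Sum>i | i \<in> I \<and> bucket K (prob B i) = c. offset K (num_voters B) (prob B i))
        = (\<Sum>i | i \<in> J \<and> bucket K (prob B i) = c. offset K (num_voters B) (prob B i))"
    proof (cases "c < K")
      case True
      then show ?thesis
        using dig[of "?m + 1 + K + c"] offs[OF fin(1) I(1), of c] offs[OF fin(2) J, of c]
        by (simp add: num_digits_def vbucket_def voffset_def)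
    next
      case False
      then show ?thesis unfolding empty[OF I(1) False] empty[OF J False] by simp
    qed
  qed
qed

subsection \<open>The cheapest set with a given key\<close>

text \<open>
  A set \<open>J\<close> of voters is stored as the number with binary digits \<open>insert 0 J\<close>, so that the
  number \<open>0\<close> is free to mark keys that are not attained.
\<close>

fun cheapest :: "(nat \<Rightarrow> nat) \<Rightarrow> (nat \<Rightarrow> real) \<Rightarrow> nat \<Rightarrow> nat \<Rightarrow> nat \<times> real" where
  "cheapest c q 0 k = (if k = 0 then (1, 0) else (0, 0))"
| "cheapest c q (Suc i) k =
    (if c (Suc i) \<le> k \<and> 0 < fst (cheapest c q i (k - c (Suc i))) \<and>
        (fst (cheapest c q i k) = 0 \<or>
         snd (cheapest c q i (k - c (Suc i))) + q (Suc i) < snd (cheapest c q i k))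
     then (fst (cheapest c q i (k - c (Suc i))) + 2 ^ Suc i, snd (cheapest c q i (k - c (Suc i))) + q (Suc i))
     else cheapest c q i k)"

lemma cheapest_sound:
  "0 < fst (cheapest c q i k) \<Longrightarrow>
   \<exists>J\<subseteq>{1..i}. fst (cheapest c q i k) = set_encode (insert 0 J) \<and> sum c J = k \<and> snd (cheapest c q i k) = sum q J"
proof (induction i arbitrary: k)
  case 0
  then show ?case by (auto simp: set_encode_def split: if_splits)
next
  case (Suc i)
  show ?case
  proof (cases "c (Suc i) \<le> k \<and> 0 < fst (cheapest c q i (k - c (Suc i))) \<and>
        (fst (cheapest c q i k) = 0 \<or>
         snd (cheapest c q i (k - c (Suc i))) + q (Suc i) < snd (cheapest c q i k))")
    case False
    then have eq: "cheapest c q (Suc i) k = cheapest c q i k"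
      unfolding cheapest.simps(2) by (rule if_not_P)
    obtain J where "J \<subseteq> {1..i}" "fst (cheapest c q i k) = set_encode (insert 0 J)" "sum c J = k"
      "snd (cheapest c q i k) = sum q J"
      using Suc.IH[of k] Suc.prems unfolding eq by blast
    moreover from this have "J \<subseteq> {1..Suc i}" by auto
    ultimately show ?thesis unfolding eq by blast
  next
    case True
    then have eq: "cheapest c q (Suc i) k = (fst (cheapest c q i (k - c (Suc i))) + 2 ^ Suc i,
        snd (cheapest c q i (k - c (Suc i))) + q (Suc i))"
      unfolding cheapest.simps(2) by (rule if_P)
    have pos: "0 < fst (cheapest c q i (k - c (Suc i)))" and le: "c (Suc i) \<le> k"
      using True by iprover+
    obtain J where J: "J \<subseteq> {1..i}" "fst (cheapest c q i (k - c (Suc i))) = set_encode (insert 0 J)"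
      "sum c J = k - c (Suc i)" "snd (cheapest c q i (k - c (Suc i))) = sum q J"
      using Suc.IH[OF pos] by blast
    have fin: "finite J" "Suc i \<notin> insert 0 J" using J(1) finite_subset[OF J(1)] by auto
    then have "set_encode (insert 0 (insert (Suc i) J)) = set_encode (insert 0 J) + 2 ^ Suc i"
      by (subst insert_commute, subst set_encode_insert) auto
    moreover have "insert (Suc i) J \<subseteq> {1..Suc i}" using J(1) by auto
    moreover have "sum c (insert (Suc i) J) = k" using fin J(3) le by simp
    moreover have "sum q (insert (Suc i) J) = sum q J + q (Suc i)" using fin by simp
    ultimately show ?thesis unfolding eq fst_conv snd_conv J(2,4)
      by (intro exI[of _ "insert (Suc i) J"] conjI) simp_all
  qed
qed

text \<open>The entry need not encode \<open>J\<close>, only some set with the same key that costs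
  no more; the objective value of that set is controlled through
  \<open>objective_same_key\<close>.\<close>

lemma cheapest_complete:
  assumes "J \<subseteq> {1..i}"
  shows "0 < fst (cheapest c q i (sum c J)) \<and> snd (cheapest c q i (sum c J)) \<le> sum q J"
  using assms
proof (induction i arbitrary: J)
  case (Suc i)
  show ?case
  proof (cases "Suc i \<in> J")
    case False
    then have "J \<subseteq> {1..i}" using Suc.prems by (auto simp: le_Suc_eq)
    from Suc.IH[OF this] show ?thesis by auto
  next
    case True
    define J' where "J' = J - {Suc i}"
    have J': "J' \<subseteq> {1..i}" "J = insert (Suc i) J'" "Suc i \<notin> J'" "finite J'"
      using Suc.prems True by (auto simp: J'_def le_Suc_eq intro: finite_subset)
    have c: "sum c J - c (Suc i) = sum c J'" "c (Suc i) \<le> sum c J" "sum q J = sum q J' + q (Suc i)"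
      using J' by simp_all
    from Suc.IH[OF J'(1)] show ?thesis using c by auto
  qed
qed simp

text \<open>The bits up to \<open>i\<close> stay below the next power of 2, so comparing with
  \<open>2 ^ Suc i\<close> reveals the top bit. This is how the program decodes a set without
  division.\<close>

lemma set_encode_atMost_less: "set_encode (A \<inter> {..i}) < 2 ^ Suc i"
proof -
  have "set_encode (A \<inter> {..i}) \<le> (\<Sum>l\<le>i. 2 ^ l)"
    unfolding set_encode_def by (rule sum_mono2) auto
  also have "\<dots> < 2 ^ Suc i" by (induction i) auto
  finally show ?thesis .
qed

lemma set_encode_atMost_Suc:
  "set_encode (A \<inter> {..Suc i}) = (if Suc i \<in> A then 2 ^ Suc i else 0) + set_encode (A \<inter> {..i})"
proof (cases "Suc i \<in> A")
  case True
  then have "A \<inter> {..Suc i} = insert (Suc i) (A \<inter> {..i})" by (auto simp: le_Suc_eq)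
  then show ?thesis using True by simp
next
  case False
  then have "A \<inter> {..Suc i} = A \<inter> {..i}" by (auto simp: le_Suc_eq)
  then show ?thesis using False by simp
qed

lemma set_encode_insert_0_inj:
  assumes "J \<subseteq> voters B" "J' \<subseteq> voters B" "set_encode (insert 0 J) = set_encode (insert 0 J')"
  shows "J = J'"
proof -
  have "finite J" "finite J'" "0 \<notin> J" "0 \<notin> J'"
    using assms finite_subset[OF _ finite_voters] by (auto simp: voters_def)
  then show ?thesis using assms(3) by (auto simp: set_encode_eq insert_ident)
qed

subsection \<open>Reasoning about programs\<close>

text \<open>The final store of a program without loops, in a form that simplification can compute;
  the equation for \<open>While\<close> is a placeholder excluded by
  \<open>loopfree\<close>.\<close>

primrec run :: "com \<Rightarrow> store \<Rightarrow> store" where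
  "run Skip s = s"
| "run (NAssign x a e) s = nupd x (nval a s) (nval e s) s"
| "run (RAssign x a e) s = rupd x (nval a s) (rval e s) s"
| "run (Seq c d) s = run d (run c s)"
| "run (Cond b c d) s = (if cval b s then run c s else run d s)"
| "run (While b c) s = s"

primrec loopfree :: "com \<Rightarrow> bool" where
  "loopfree Skip = True"
| "loopfree (NAssign x a e) = True"
| "loopfree (RAssign x a e) = True"
| "loopfree (Seq c d) = (loopfree c \<and> loopfree d)"
| "loopfree (Cond b c d) = (loopfree c \<and> loopfree d)"
| "loopfree (While b c) = False"

text \<open>Only an upper bound: both branches of a conditional are charged.\<close>

primrec maxcost :: "com \<Rightarrow> nat" where
  "maxcost Skip = 1"
| "maxcost (NAssign x a e) = 1 + ncost a + ncost e"
| "maxcost (RAssign x a e) = 1 + ncost a + rcost e"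
| "maxcost (Seq c d) = maxcost c + maxcost d"
| "maxcost (Cond b c d) = 1 + ccost b + maxcost c + maxcost d"
| "maxcost (While b c) = 0"

lemma exec_run: "loopfree c \<Longrightarrow> \<exists>t\<le>maxcost c. exec c s t (run c s)"
proof (induction c arbitrary: s)
  case Skip
  show ?case using exec.Skip by auto
next
  case (NAssign x a e)
  show ?case using exec.NAssign by auto
next
  case (RAssign x a e)
  show ?case using exec.RAssign by auto
next
  case (Seq c d)
  obtain t where "t \<le> maxcost c" "exec c s t (run c s)" using Seq by auto
  moreover obtain t' where "t' \<le> maxcost d" "exec d (run c s) t' (run d (run c s))" using Seq by auto
  ultimately show ?case using exec.Seq by (intro exI[of _ "t + t'"]) auto
next
  case (Cond b c d)
  obtain t where t: "t \<le> maxcost c" "exec c s t (run c s)" using Cond by auto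
  obtain t' where t': "t' \<le> maxcost d" "exec d s t' (run d s)" using Cond by auto
  show ?case
  proof (cases "cval b s")
    case True
    then show ?thesis using t exec.CondTrue[OF True t(2)] by (intro exI[of _ "1 + ccost b + t"]) auto
  next
    case False
    then show ?thesis using t' exec.CondFalse[OF False t'(2)] by (intro exI[of _ "1 + ccost b + t'"]) auto
  qed
qed simp

text \<open>
  Total correctness, with running times measured in the form \<open>A * M ^ d\<close> where \<open>M\<close> bounds the number
  of iterations of every loop.
\<close>

definition triple :: "nat \<Rightarrow> (store \<Rightarrow> bool) \<Rightarrow> com \<Rightarrow> nat \<Rightarrow> nat \<Rightarrow> (store \<Rightarrow> bool) \<Rightarrow> bool" where
  "triple M P c A d Q \<longleftrightarrow> (\<forall>s. P s \<longrightarrow> (\<exists>t s'. exec c s t s' \<and> t \<le> A * M ^ d \<and> Q s'))"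

lemma triple_straight:
  assumes "M \<ge> 1" "loopfree c" "maxcost c \<le> A" "\<And>s. P s \<Longrightarrow> Q (run c s)"
  shows "triple M P c A d Q"
  unfolding triple_def
proof (intro allI impI)
  fix s assume "P s"
  obtain t where t: "t \<le> maxcost c" "exec c s t (run c s)" using exec_run[OF assms(2)] by blast
  have "A * 1 \<le> A * M ^ d" using assms(1) by (intro mult_left_mono) auto
  then have "t \<le> A * M ^ d" using t(1) assms(3) by linarith
  then show "\<exists>t s'. exec c s t s' \<and> t \<le> A * M ^ d \<and> Q s'"
    using t(2) assms(4)[OF \<open>P s\<close>] by blast
qed

lemma triple_seq:
  assumes "triple M P c A d Q" "triple M Q c' A' d' R" "M \<ge> 1" "d \<le> e" "d' \<le> e" "A + A' \<le> A''"
  shows "triple M P (Seq c c') A'' e R"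
  unfolding triple_def
proof (intro allI impI)
  fix s assume "P s"
  then obtain t s' where t: "exec c s t s'" "t \<le> A * M ^ d" "Q s'" using assms(1) by (auto simp: triple_def)
  then obtain t' s'' where t': "exec c' s' t' s''" "t' \<le> A' * M ^ d'" "R s''"
    using assms(2) unfolding triple_def by blast
  have "t + t' \<le> A * M ^ e + A' * M ^ e"
    using t t' assms by (intro add_mono order.trans[OF t(2)] order.trans[OF t'(2)] mult_left_mono power_increasing) auto
  also have "\<dots> = (A + A') * M ^ e" by (simp add: distrib_right)
  also have "\<dots> \<le> A'' * M ^ e" using assms by (intro mult_right_mono) auto
  finally show "\<exists>t s'. exec (Seq c c') s t s' \<and> t \<le> A'' * M ^ e \<and> R s'"
    using exec.Seq[OF t(1) t'(1)] t'(3) by blast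
qed

lemma triple_cond:
  assumes "triple M (\<lambda>s. P s \<and> cval b s) c A d Q" "triple M (\<lambda>s. P s \<and> \<not> cval b s) c' A' d Q"
    "M \<ge> 1" "1 + ccost b + A + A' \<le> A''"
  shows "triple M P (Cond b c c') A'' d Q"
  unfolding triple_def
proof (intro allI impI)
  fix s assume P: "P s"
  have "1 \<le> M ^ d" using assms by simp
  then have "(1 + ccost b) * 1 \<le> (1 + ccost b) * M ^ d" by (intro mult_left_mono) auto
  moreover have "(1 + ccost b + A + A') * M ^ d \<le> A'' * M ^ d" using assms by (intro mult_right_mono) auto
  ultimately have le: "1 + ccost b + A * M ^ d + A' * M ^ d \<le> A'' * M ^ d" unfolding distrib_right by linarith
  show "\<exists>t s'. exec (Cond b c c') s t s' \<and> t \<le> A'' * M ^ d \<and> Q s'"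
  proof (cases "cval b s")
    case True
    then obtain t s' where t: "exec c s t s'" "t \<le> A * M ^ d" "Q s'" using P assms(1) by (auto simp: triple_def)
    have "1 + ccost b + t \<le> A'' * M ^ d" using le t(2) by linarith
    then show ?thesis using exec.CondTrue[OF True t(1)] t(3) by blast
  next
    case False
    then obtain t s' where t: "exec c' s t s'" "t \<le> A' * M ^ d" "Q s'" using P assms(2) by (auto simp: triple_def)
    have "1 + ccost b + t \<le> A'' * M ^ d" using le t(2) by linarith
    then show ?thesis using exec.CondFalse[OF False t(1)] t(3) by blast
  qed
qed

text \<open>\<open>I j\<close> holds after \<open>j\<close> rounds. With
  \<open>g = 1 + ccost b\<close> the cost is at most \<open>M * (g + A * M ^ d) + g\<close>, hence
  at most \<open>(2 * g + A) * M ^ Suc d\<close>; this is the origin of the condition on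
  \<open>A'\<close>.\<close>

lemma triple_for:
  assumes body: "\<And>j. j < N \<Longrightarrow> triple M (I j) c A d (I (Suc j))"
    and guard: "\<And>j s. j \<le> N \<Longrightarrow> I j s \<Longrightarrow> cval b s \<longleftrightarrow> j < N"
    and "M \<ge> 1" "N \<le> M" "2 * (1 + ccost b) + A \<le> A'"
    and pre: "\<And>s. P s \<Longrightarrow> I 0 s" and post: "\<And>s. I N s \<Longrightarrow> Q s"
  shows "triple M P (While b c) A' (Suc d) Q"
  unfolding triple_def
proof (intro allI impI)
  let ?g = "1 + ccost b"
  fix s assume "P s"
  have *: "\<exists>t s'. exec (While b c) s t s' \<and> t \<le> (N - j) * (?g + A * M ^ d) + ?g \<and> I N s'"
    if "j \<le> N" "I j s" for j s
    using that
  proof (induction "N - j" arbitrary: j s)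
    case 0
    then have "j = N" by simp
    then have "\<not> cval b s" using guard[of j s] 0 by simp
    then show ?case using exec.WhileFalse[of b s c] 0 \<open>j = N\<close> by auto
  next
    case (Suc l)
    then have j: "j < N" by simp
    have l: "l = N - Suc j" using Suc.hyps(2) by simp
    have b: "cval b s" using j guard[of j s] Suc by simp
    obtain t s' where t: "exec c s t s'" "t \<le> A * M ^ d" "I (Suc j) s'"
      using body[OF j] Suc.prems by (auto simp: triple_def)
    obtain t' s'' where t': "exec (While b c) s' t' s''" "t' \<le> (N - Suc j) * (?g + A * M ^ d) + ?g" "I N s''"
      using Suc.hyps(1)[OF l Suc_leI[OF j] t(3)] by blast
    have "N - j = Suc (N - Suc j)" using j by simp
    then have "?g + t + t' \<le> (N - j) * (?g + A * M ^ d) + ?g" using t(2) t'(2) by simp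
    then show ?case using exec.WhileTrue[OF b t(1) t'(1)] t'(3) by blast
  qed
  obtain t s' where t: "exec (While b c) s t s'" "t \<le> (N - 0) * (?g + A * M ^ d) + ?g" "I N s'"
    using *[of 0 s] pre[OF \<open>P s\<close>] by auto
  have M1: "1 \<le> M ^ d" "1 \<le> M ^ Suc d" using assms by simp_all
  have "t \<le> M * (?g + A * M ^ d) + ?g"
    using t(2) mult_right_mono[OF \<open>N \<le> M\<close>, of "?g + A * M ^ d"] by simp
  also have "\<dots> \<le> M * (?g * M ^ d + A * M ^ d) + ?g * M ^ Suc d"
    using mult_left_mono[OF M1(1), of ?g] mult_left_mono[OF M1(2), of ?g]
    by (intro add_mono mult_left_mono) auto
  also have "\<dots> = (2 * ?g + A) * M ^ Suc d" by (simp add: algebra_simps)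
  also have "\<dots> \<le> A' * M ^ Suc d" using assms by (intro mult_right_mono) auto
  finally show "\<exists>t s'. exec (While b c) s t s' \<and> t \<le> A' * M ^ Suc d \<and> Q s'"
    using t(1,3) post by blast
qed

lemma triple_down:
  assumes body: "\<And>i. i < N \<Longrightarrow> triple M (I (Suc i)) c A d (I i)"
    and guard: "\<And>i s. i \<le> N \<Longrightarrow> I i s \<Longrightarrow> cval b s \<longleftrightarrow> 0 < i"
    and "M \<ge> 1" "N \<le> M" "2 * (1 + ccost b) + A \<le> A'"
    and pre: "\<And>s. P s \<Longrightarrow> I N s" and post: "\<And>s. I 0 s \<Longrightarrow> Q s"
  shows "triple M P (While b c) A' (Suc d) Q"
proof (rule triple_for[where I = "\<lambda>j. I (N - j)" and N = N])
  fix j assume "j < N"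
  then have "N - j = Suc (N - Suc j)" by simp
  then show "triple M (I (N - j)) c A d (I (N - Suc j))" using body[of "N - Suc j"] \<open>j < N\<close> by simp
next
  show "cval b s \<longleftrightarrow> j < N" if "j \<le> N" "I (N - j) s" for j s
    using guard[of "N - j" s] that by simp
qed (use assms in auto)

lemma triple_conseq:
  assumes "triple M P c A d Q" "\<And>s. P' s \<Longrightarrow> P s" "\<And>s. Q s \<Longrightarrow> Q' s"
  shows "triple M P' c A d Q'"
  using assms unfolding triple_def by blast

text \<open>Freezes two program variables as logical constants, so that the evaluation of a set can
  be specified as leaving them unchanged.\<close>

lemma triple_split_best:
  assumes "\<And>b v. triple M (\<lambda>s. P s \<and> nats s ''best'' 0 = b \<and> reals s ''bv'' 0 = v) c A d Q"
  shows "triple M P c A d Q"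
  using assms unfolding triple_def by blast

lemma triple_vacuous: "(\<And>s. \<not> P s) \<Longrightarrow> triple M P c A d Q"
  by (simp add: triple_def)

lemma triple_ex:
  assumes "\<And>x. triple M (P x) c A d Q"
  shows "triple M (\<lambda>s. \<exists>x. P x s) c A d Q"
  using assms unfolding triple_def by blast

lemma nats_nupd [simp]: "nats (nupd x k v s) = (nats s)(x := (nats s x)(k := v))"
  and reals_nupd [simp]: "reals (nupd x k v s) = reals s"
  and nats_rupd [simp]: "nats (rupd x k v' s) = nats s"
  and reals_rupd [simp]: "reals (rupd x k v' s) = (reals s)(x := (reals s x)(k := v'))"
  by (simp_all add: nupd_def rupd_def)

abbreviation (input) seq_infix :: "com \<Rightarrow> com \<Rightarrow> com" (infixr ";;" 60) where
  "c ;; d \<equiv> Seq c d"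

abbreviation (input) nvar :: "string \<Rightarrow> nexp" where
  "nvar x \<equiv> NGet x (NConst 0)"

abbreviation (input) rvar :: "string \<Rightarrow> rexp" where
  "rvar x \<equiv> RGet x (NConst 0)"

abbreviation (input) nset :: "string \<Rightarrow> nexp \<Rightarrow> com" where
  "nset x e \<equiv> NAssign x (NConst 0) e"

abbreviation (input) rset :: "string \<Rightarrow> rexp \<Rightarrow> com" where
  "rset x e \<equiv> RAssign x (NConst 0) e"

abbreviation (input) nincr :: "string \<Rightarrow> com" where
  "nincr x \<equiv> NAssign x (NConst 0) (NPlus (NGet x (NConst 0)) (NConst 1))"

abbreviation (input) ndecr :: "string \<Rightarrow> com" where
  "ndecr x \<equiv> NAssign x (NConst 0) (NMinus (NGet x (NConst 0)) (NConst 1))"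

subsection \<open>The program\<close>

text \<open>
  Arrays: \<open>U\<close> holds the powers of the radix \<open>W\<close>, \<open>E\<close> those of \<open>2\<close>, and \<open>c\<close> the codes of the
  voters. For every key, \<open>S\<close> holds the cheapest set as a number and \<open>C\<close> its price. In the evaluation
  of one set, \<open>T\<close> at \<open>x\<close> is the probability that the designated candidate gets at least \<open>x\<close> votes from
  the voters seen so far, and \<open>cnt\<close> and \<open>mx\<close> are the votes of the rivals and their maximum. The scalars
  \<open>best\<close> and \<open>bv\<close> are the best set so far and its value. The loops over \<open>k\<close> and \<open>x\<close> run downwards so
  that the tables can be updated in place.
\<close>

definition prog_radix :: com where
  "prog_radix = (nset ''W'' (NConst 1) ;; nset ''t'' (NConst 0)) ;;
     While (NLess (nvar ''t'') (nvar ''n'')) (nset ''W'' (NPlus (nvar ''W'') (nvar ''n'')) ;; nincr ''t'')"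

definition top_digit :: "nat \<Rightarrow> nexp" where
  "top_digit K = NPlus (nvar ''m'') (NConst (K + K + 1))"

text \<open>Naturals cannot be multiplied, so the next power is summed up from \<open>W\<close>
  copies of the previous one.\<close>

definition prog_powers :: "nat \<Rightarrow> com" where
  "prog_powers K = (NAssign ''U'' (NConst 0) (NConst 1) ;; nset ''t'' (NConst 0)) ;;
     While (NLess (nvar ''t'') (top_digit K))
       ((NAssign ''U'' (NPlus (nvar ''t'') (NConst 1)) (NConst 0) ;; nset ''j'' (NConst 0)) ;;
        While (NLess (nvar ''j'') (nvar ''W''))
          (NAssign ''U'' (NPlus (nvar ''t'') (NConst 1))
            (NPlus (NGet ''U'' (NPlus (nvar ''t'') (NConst 1))) (NGet ''U'' (nvar ''t''))) ;; nincr ''j'') ;;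
        nincr ''t'')"

definition prog_bits :: com where
  "prog_bits = (NAssign ''E'' (NConst 0) (NConst 1) ;; nset ''t'' (NConst 0)) ;;
     While (NLess (nvar ''t'') (nvar ''n''))
       (NAssign ''E'' (NPlus (nvar ''t'') (NConst 1))
          (NPlus (NGet ''E'' (nvar ''t'')) (NGet ''E'' (nvar ''t''))) ;; nincr ''t'')"

text \<open>Reals cannot be rounded, so bucket and offset are found by counting. The test
  \<open>b + 1 < K\<close> realizes the minimum in \<open>bucket\<close>, and each unit of the
  offset adds one more copy of its power to the code.\<close>

definition prog_codes :: "nat \<Rightarrow> com" where
  "prog_codes K = nset ''i'' (NConst 0) ;;
     While (NLess (nvar ''i'') (nvar ''n''))
       ((nincr ''i'' ;; nset ''b'' (NConst 0)) ;;
        While (CAnd (NLess (NPlus (nvar ''b'') (NConst 1)) (NConst K))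
            (CNot (RLess (RTimes (RGet ''p'' (nvar ''i'')) (ROfNat (NConst K)))
               (ROfNat (NPlus (nvar ''b'') (NConst 1))))))
          (nincr ''b'') ;;
        (NAssign ''c'' (nvar ''i'') (NPlus (NGet ''U'' (NGet ''vote'' (nvar ''i'')))
            (NGet ''U'' (NPlus (NPlus (nvar ''m'') (NConst 1)) (nvar ''b'')))) ;;
         nset ''a'' (NConst 0)) ;;
        While (CNot (RLess
            (RTimes (RMinus (RTimes (RGet ''p'' (nvar ''i'')) (ROfNat (NConst K))) (ROfNat (nvar ''b'')))
               (ROfNat (nvar ''n'')))
            (ROfNat (NPlus (nvar ''a'') (NConst 1)))))
          (NAssign ''c'' (nvar ''i'') (NPlus (NGet ''c'' (nvar ''i''))
              (NGet ''U'' (NPlus (NPlus (nvar ''m'') (NConst (1 + K))) (nvar ''b'')))) ;;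
           nincr ''a''))"

definition prog_clear :: "nat \<Rightarrow> com" where
  "prog_clear K = nset ''k'' (NGet ''U'' (top_digit K)) ;;
     While (NLess (NConst 0) (nvar ''k''))
       (ndecr ''k'' ;; NAssign ''S'' (nvar ''k'') (NConst 0) ;; RAssign ''C'' (nvar ''k'') (ROfNat (NConst 0))) ;;
     NAssign ''S'' (NConst 0) (NConst 1)"

definition key_rest :: nexp where
  "key_rest = NMinus (nvar ''k'') (NGet ''c'' (nvar ''i''))"

definition new_price :: rexp where
  "new_price = RPlus (RGet ''C'' key_rest) (RGet ''q'' (nvar ''i''))"

text \<open>The disjunction in \<open>cheapest\<close> is expressed by negations. Where
  \<open>key_rest\<close> is truncated wrongly, the first conjunct is already false.\<close>

definition improves :: cond where
  "improves = CAnd (CNot (NLess (nvar ''k'') (NGet ''c'' (nvar ''i''))))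
     (CAnd (NLess (NConst 0) (NGet ''S'' key_rest))
       (CNot (CAnd (NLess (NConst 0) (NGet ''S'' (nvar ''k'')))
          (CNot (RLess new_price (RGet ''C'' (nvar ''k'')))))))"

definition prog_table :: "nat \<Rightarrow> com" where
  "prog_table K = nset ''i'' (NConst 0) ;;
     While (NLess (nvar ''i'') (nvar ''n''))
       ((nincr ''i'' ;; nset ''k'' (NGet ''U'' (top_digit K))) ;;
        While (NLess (NConst 0) (nvar ''k''))
          (ndecr ''k'' ;;
           Cond improves
             (NAssign ''S'' (nvar ''k'') (NPlus (NGet ''S'' key_rest) (NGet ''E'' (nvar ''i''))) ;;
              RAssign ''C'' (nvar ''k'') new_price)
             Skip))"

definition prog_voter :: com where
  "prog_voter =
     Cond (NLess (nvar ''rem'') (NGet ''E'' (nvar ''i'')))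
       (nset ''d'' (NConst 0))
       (nset ''rem'' (NMinus (nvar ''rem'') (NGet ''E'' (nvar ''i''))) ;; nset ''d'' (NConst 1)) ;;
     Cond (NLess (NGet ''vote'' (nvar ''i'')) (nvar ''m''))
       (Cond (NLess (NConst 0) (nvar ''d''))
          (rset ''g'' (RGet ''p'' (nvar ''i'')))
          (rset ''g'' (ROfNat (NConst 0)) ;;
           NAssign ''cnt'' (NGet ''vote'' (nvar ''i''))
             (NPlus (NGet ''cnt'' (NGet ''vote'' (nvar ''i''))) (NConst 1)) ;;
           Cond (NLess (nvar ''mx'') (NGet ''cnt'' (NGet ''vote'' (nvar ''i''))))
             (nset ''mx'' (NGet ''cnt'' (NGet ''vote'' (nvar ''i'')))) Skip))
       (rset ''g'' (ROfNat (NConst 1))) ;;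
     nset ''x'' (NPlus (nvar ''n'') (NConst 1))"

definition prog_convolve :: com where
  "prog_convolve =
     While (NLess (NConst 0) (nvar ''x''))
       (RAssign ''T'' (nvar ''x'')
          (RPlus (RTimes (RMinus (ROfNat (NConst 1)) (rvar ''g'')) (RGet ''T'' (nvar ''x'')))
             (RTimes (rvar ''g'') (RGet ''T'' (NMinus (nvar ''x'') (NConst 1))))) ;;
        ndecr ''x'')"

definition prog_reset :: com where
  "prog_reset =
     nset ''x'' (NPlus (nvar ''n'') (NConst 1)) ;;
     While (NLess (NConst 0) (nvar ''x'')) (RAssign ''T'' (nvar ''x'') (ROfNat (NConst 0)) ;; ndecr ''x'') ;;
     nset ''j'' (nvar ''m'') ;;
     While (NLess (NConst 0) (nvar ''j'')) (ndecr ''j'' ;; NAssign ''cnt'' (nvar ''j'') (NConst 0)) ;;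
     RAssign ''T'' (NConst 0) (ROfNat (NConst 1)) ;;
     nset ''mx'' (NConst 0) ;; nset ''rem'' (NGet ''S'' (nvar ''k'')) ;; nset ''i'' (nvar ''n'')"

definition prog_eval :: com where
  "prog_eval = prog_reset ;;
     While (NLess (NConst 0) (nvar ''i'')) (prog_voter ;; prog_convolve ;; ndecr ''i'')"

definition prog_update :: com where
  "prog_update =
     Cond (RLess (rvar ''bv'') (RGet ''T'' (NPlus (nvar ''mx'') (NConst 1))))
       (rset ''bv'' (RGet ''T'' (NPlus (nvar ''mx'') (NConst 1))) ;; nset ''best'' (NGet ''S'' (nvar ''k'')))
       Skip"

definition prog_select :: "nat \<Rightarrow> com" where
  "prog_select K =
     (nset ''best'' (NConst 1) ;; rset ''bv'' (ROfNat (NConst 0)) ;; nset ''k'' (NConst 0)) ;;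
     While (NLess (nvar ''k'') (NGet ''U'' (top_digit K)))
       (Cond (CAnd (NLess (NConst 0) (NGet ''S'' (nvar ''k'')))
            (CNot (RLess (rvar ''Q'') (RGet ''C'' (nvar ''k'')))))
          (prog_eval ;; prog_update) Skip ;;
        nincr ''k'')"

definition prog_output :: com where
  "prog_output = nset ''i'' (nvar ''n'') ;;
     While (NLess (NConst 0) (nvar ''i''))
       (Cond (NLess (nvar ''best'') (NGet ''E'' (nvar ''i'')))
          (NAssign ''I'' (nvar ''i'') (NConst 0))
          (nset ''best'' (NMinus (nvar ''best'') (NGet ''E'' (nvar ''i''))) ;;
           NAssign ''I'' (nvar ''i'') (NConst 1)) ;;
        ndecr ''i'')"

definition prog_main :: "nat \<Rightarrow> com" where
  "prog_main K = prog_radix ;; prog_powers K ;; prog_bits ;; prog_codes K ;; prog_clear K ;;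
     prog_table K ;; prog_select K ;; prog_output"

text \<open>With a single voter the claimed bound is a constant, so this case cannot go through the table.\<close>

definition prog_single :: com where
  "prog_single = Cond (RLess (rvar ''Q'') (RGet ''q'' (NConst 1))) Skip (NAssign ''I'' (NConst 1) (NConst 1))"

definition prog :: "nat \<Rightarrow> com" where
  "prog K = Cond (NLess (nvar ''n'') (NConst 2)) prog_single (prog_main K)"

subsection \<open>Correctness of the program\<close>

definition inputs_ok :: "bvu \<Rightarrow> store \<Rightarrow> bool" where
  "inputs_ok B s \<longleftrightarrow> nats s ''m'' 0 = num_cands B \<and> nats s ''n'' 0 = num_voters B \<and>
     (\<forall>i\<in>voters B. nats s ''vote'' i = vote B i) \<and> reals s ''Q'' 0 = budget B \<and>
     (\<forall>i\<in>voters B. reals s ''q'' i = price B i \<and> reals s ''p'' i = prob B i)"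

definition powers_ok :: "bvu \<Rightarrow> nat \<Rightarrow> store \<Rightarrow> bool" where
  "powers_ok B K s \<longleftrightarrow> inputs_ok B s \<and> (\<forall>t\<le>num_digits B K. nats s ''U'' t = radix B ^ t) \<and>
     (\<forall>i\<le>num_voters B. nats s ''E'' i = 2 ^ i)"

definition codes_ok :: "bvu \<Rightarrow> nat \<Rightarrow> store \<Rightarrow> bool" where
  "codes_ok B K s \<longleftrightarrow> powers_ok B K s \<and> (\<forall>i\<in>voters B. nats s ''c'' i = code B K i)"

definition table_ok :: "bvu \<Rightarrow> nat \<Rightarrow> nat \<Rightarrow> store \<Rightarrow> bool" where
  "table_ok B K i s \<longleftrightarrow> codes_ok B K s \<and>
     (\<forall>k<num_keys B K. (nats s ''S'' k, reals s ''C'' k) = cheapest (code B K) (price B) i k)"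

lemma inputs_ok_upd [simp]:
  "x \<notin> {''m'', ''n'', ''vote''} \<Longrightarrow> inputs_ok B (nupd x k v s) = inputs_ok B s"
  "y \<notin> {''Q'', ''q'', ''p''} \<Longrightarrow> inputs_ok B (rupd y k v' s) = inputs_ok B s"
  by (auto simp: inputs_ok_def)

lemma powers_ok_upd [simp]:
  "x \<notin> {''m'', ''n'', ''vote'', ''U'', ''E''} \<Longrightarrow> powers_ok B K (nupd x k v s) = powers_ok B K s"
  "y \<notin> {''Q'', ''q'', ''p''} \<Longrightarrow> powers_ok B K (rupd y k v' s) = powers_ok B K s"
  by (auto simp: powers_ok_def)

lemma codes_ok_upd [simp]:
  "x \<notin> {''m'', ''n'', ''vote'', ''U'', ''E'', ''c''} \<Longrightarrow> codes_ok B K (nupd x k v s) = codes_ok B K s"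
  "y \<notin> {''Q'', ''q'', ''p''} \<Longrightarrow> codes_ok B K (rupd y k v' s) = codes_ok B K s"
  by (auto simp: codes_ok_def)

lemma table_ok_upd [simp]:
  "x \<notin> {''m'', ''n'', ''vote'', ''U'', ''E'', ''c'', ''S''} \<Longrightarrow> table_ok B K i (nupd x k v s) = table_ok B K i s"
  "y \<notin> {''Q'', ''q'', ''p'', ''C''} \<Longrightarrow> table_ok B K i (rupd y k v' s) = table_ok B K i s"
  by (auto simp: table_ok_def)

lemma inputs_okD:
  assumes "inputs_ok B s"
  shows "nats s ''m'' 0 = num_cands B" "nats s ''n'' 0 = num_voters B"
    "i \<in> voters B \<Longrightarrow> nats s ''vote'' i = vote B i" "reals s ''Q'' 0 = budget B"
    "i \<in> voters B \<Longrightarrow> reals s ''q'' i = price B i" "i \<in> voters B \<Longrightarrow> reals s ''p'' i = prob B i"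
  using assms by (auto simp: inputs_ok_def)

lemma powers_okD:
  assumes "powers_ok B K s"
  shows "inputs_ok B s" "t \<le> num_digits B K \<Longrightarrow> nats s ''U'' t = radix B ^ t"
    "i \<le> num_voters B \<Longrightarrow> nats s ''E'' i = 2 ^ i"
  using assms by (auto simp: powers_ok_def)

lemma codes_okD:
  assumes "codes_ok B K s"
  shows "powers_ok B K s" "i \<in> voters B \<Longrightarrow> nats s ''c'' i = code B K i"
  using assms by (auto simp: codes_ok_def)

lemma table_okD:
  assumes "table_ok B K i s"
  shows "codes_ok B K s" "k < num_keys B K \<Longrightarrow> nats s ''S'' k = fst (cheapest (code B K) (price B) i k)"
    "k < num_keys B K \<Longrightarrow> reals s ''C'' k = snd (cheapest (code B K) (price B) i k)"
  using assms by (auto simp: table_ok_def prod_eq_iff)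

lemma radix_ge: "num_voters B \<ge> 2 \<Longrightarrow> radix B \<ge> 5"
  using mult_mono[of 2 "num_voters B" 2 "num_voters B"] by (simp add: radix_def)

text \<open>All loop lengths of the main program are bounded by the number of keys, so running times
  can be stated as powers of this one parameter.\<close>

lemma num_keys_bounds:
  assumes n: "num_voters B \<ge> 2"
  shows "1 \<le> num_keys B K" "num_digits B K \<le> num_keys B K" "radix B \<le> num_keys B K"
    "num_voters B + 1 \<le> num_keys B K" "num_cands B \<le> num_keys B K" "K \<le> num_keys B K"
proof -
  have W: "radix B \<ge> 2" using radix_ge[OF n] by simp
  show "1 \<le> num_keys B K" using W by (simp add: num_keys_def)
  have "num_digits B K < 2 ^ num_digits B K" by (rule less_exp)
  also have "\<dots> \<le> num_keys B K" unfolding num_keys_def using W by (intro power_mono) auto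
  finally show d: "num_digits B K \<le> num_keys B K" by simp
  have "radix B ^ 1 \<le> radix B ^ num_digits B K"
    using W by (intro power_increasing) (auto simp: num_digits_def)
  then show r: "radix B \<le> num_keys B K" by (simp add: num_keys_def)
  have "num_voters B + 1 \<le> radix B" using n by (simp add: radix_def)
  then show "num_voters B + 1 \<le> num_keys B K" using r by simp
  show "num_cands B \<le> num_keys B K" "K \<le> num_keys B K" using d by (auto simp: num_digits_def)
qed

locale bvu_run =
  fixes B :: bvu and K :: nat
  assumes inst: "bvu_instance B" and K2: "K \<ge> 2" and n2: "num_voters B \<ge> 2"
begin

abbreviation "n \<equiv> num_voters B"
abbreviation "m \<equiv> num_cands B"
abbreviation "W \<equiv> radix B"
abbreviation "M \<equiv> num_keys B K"

lemmas M_ge = num_keys_bounds[OF n2, of K]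
lemmas okD = inputs_okD[where B = B] powers_okD[where B = B and K = K]
lemmas cokD = okD codes_okD[where B = B and K = K]

lemma prog_radix_correct:
  "triple M (inputs_ok B) prog_radix 40 1 (\<lambda>s. inputs_ok B s \<and> nats s ''W'' 0 = W)"
proof -
  let ?I = "\<lambda>j s. inputs_ok B s \<and> nats s ''t'' 0 = j \<and> nats s ''W'' 0 = j * n + 1"
  show ?thesis
    unfolding prog_radix_def
  proof (rule triple_seq[where Q = "?I 0" and d = 0 and d' = "Suc 0" and A = 10 and A' = 30], goal_cases)
    case 1
    show ?case by (rule triple_straight) (use M_ge in auto)
  next
    case 2
    show ?case
    proof (rule triple_for[where I = ?I and N = n and A = 16], goal_cases)
      case (1 j)
      show ?case by (rule triple_straight) (use M_ge in \<open>auto simp: inputs_okD\<close>)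
    qed (use M_ge in \<open>auto simp: inputs_okD radix_def\<close>)
  qed (use M_ge in auto)
qed

lemma prog_powers_correct:
  "triple M (\<lambda>s. inputs_ok B s \<and> nats s ''W'' 0 = W) (prog_powers K) 130 2
     (\<lambda>s. inputs_ok B s \<and> (\<forall>t\<le>num_digits B K. nats s ''U'' t = W ^ t))"
proof -
  let ?J = "\<lambda>j s. inputs_ok B s \<and> nats s ''W'' 0 = W \<and> nats s ''t'' 0 = j \<and> (\<forall>t\<le>j. nats s ''U'' t = W ^ t)"
  let ?I = "\<lambda>j l s. ?J j s \<and> nats s ''j'' 0 = l \<and> nats s ''U'' (Suc j) = l * W ^ j"
  show ?thesis
    unfolding prog_powers_def
  proof (rule triple_seq[where Q = "?J 0" and d = 0 and d' = "Suc (Suc 0)" and A = 10 and A' = 120], goal_cases)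
    case 1
    show ?case by (rule triple_straight) (use M_ge in auto)
  next
    case 2
    show ?case
    proof (rule triple_for[where I = ?J and N = "num_digits B K" and A = 100], goal_cases)
      case (1 j)
      show ?case
      proof (rule triple_seq[where Q = "?I j 0" and d = 0 and d' = "Suc 0" and A = 15 and A' = 60], goal_cases)
        case 1
        show ?case by (rule triple_straight) (use M_ge in auto)
      next
        case 2
        show ?case
        proof (rule triple_seq[where Q = "?I j W" and d = "Suc 0" and d' = 0 and A = 40 and A' = 10], goal_cases)
          case 1
          show ?case
          proof (rule triple_for[where I = "?I j" and N = W and A = 25], goal_cases)
            case (1 l)
            show ?case by (rule triple_straight) (use M_ge in auto)
          qed (use M_ge in auto)
        next
          case 2
          show ?case by (rule triple_straight) (use M_ge in \<open>auto simp: le_Suc_eq\<close>)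
        qed (use M_ge in auto)
      qed (use M_ge in auto)
    qed (use M_ge in \<open>auto simp: top_digit_def inputs_okD num_digits_def\<close>)
  qed (use M_ge in auto)
qed

lemma prog_bits_correct:
  "triple M (\<lambda>s. inputs_ok B s \<and> (\<forall>t\<le>num_digits B K. nats s ''U'' t = W ^ t)) prog_bits 50 1 (powers_ok B K)"
proof -
  let ?P = "\<lambda>s. inputs_ok B s \<and> (\<forall>t\<le>num_digits B K. nats s ''U'' t = W ^ t)"
  let ?I = "\<lambda>j s. ?P s \<and> nats s ''t'' 0 = j \<and> (\<forall>i\<le>j. nats s ''E'' i = 2 ^ i)"
  show ?thesis
    unfolding prog_bits_def
  proof (rule triple_seq[where Q = "?I 0" and d = 0 and d' = "Suc 0" and A = 10 and A' = 40], goal_cases)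
    case 1
    show ?case by (rule triple_straight) (use M_ge in auto)
  next
    case 2
    show ?case
    proof (rule triple_for[where I = ?I and N = n and A = 25], goal_cases)
      case (1 j)
      show ?case by (rule triple_straight) (use M_ge in \<open>auto simp: inputs_okD le_Suc_eq\<close>)
    qed (use M_ge in \<open>auto simp: inputs_okD powers_ok_def\<close>)
  qed (use M_ge in auto)
qed

lemma prog_codes_correct: "triple M (powers_ok B K) (prog_codes K) 250 2 (codes_ok B K)"
proof -
  let ?O = "\<lambda>i s. powers_ok B K s \<and> nats s ''i'' 0 = i \<and> (\<forall>l\<in>{1..i}. nats s ''c'' l = code B K l)"
  let ?I1 = "\<lambda>i b s. powers_ok B K s \<and> nats s ''i'' 0 = Suc i \<and> (\<forall>l\<in>{1..i}. nats s ''c'' l = code B K l) \<and>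
      nats s ''b'' 0 = b"
  let ?I2 = "\<lambda>i a s. ?I1 i (vbucket B K (Suc i)) s \<and> nats s ''a'' 0 = a \<and>
      nats s ''c'' (Suc i) = W ^ vote B (Suc i) + W ^ (m + 1 + vbucket B K (Suc i))
        + a * W ^ (m + 1 + K + vbucket B K (Suc i))"
  have p01: "prob B i \<in> {0..1}" if "i \<in> voters B" for i using inst that by (auto simp: bvu_instance_def)
  \<comment> \<open>Counting replaces the floor because \<open>b + 1 \<le> y\<close> is equivalent
    to \<open>b < nat \<lfloor>y\<rfloor>\<close>.\<close>
  have guard1: "b + 1 < K \<and> \<not> prob B i * K < real (b + 1) \<longleftrightarrow> b < vbucket B K i" if "i \<in> voters B" for b i
    using p01[OF that] K2 unfolding vbucket_def bucket_def by (auto simp: le_nat_floor) linarith+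
  have guard2: "\<not> (prob B i * K - vbucket B K i) * n < real (a + 1) \<longleftrightarrow> a < voffset B K i" if "i \<in> voters B" for a i
    unfolding voffset_def offset_def vbucket_def[symmetric] by linarith
  have small: "vbucket B K i < K" "voffset B K i \<le> n" "vote B i \<le> m" if "i \<in> voters B" for i
    using vbucket_less[OF inst _ that] voffset_le[OF inst _ that] K2 inst that by (auto simp: bvu_instance_def)
  show ?thesis
    unfolding prog_codes_def
  proof (rule triple_seq[where Q = "?O 0" and d = 0 and d' = "Suc (Suc 0)" and A = 10 and A' = 240], goal_cases)
    case 1
    show ?case by (rule triple_straight) (use M_ge in auto)
  next
    case 2
    show ?case
    proof (rule triple_for[where I = ?O and N = n and A = 220], goal_cases)
      case (1 i)
      then have v: "Suc i \<in> voters B" by (simp add: voters_def)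
      show ?case
      proof (rule triple_seq[where Q = "?I1 i 0" and d = 0 and d' = "Suc 0" and A = 15 and A' = 200], goal_cases)
        case 1
        show ?case by (rule triple_straight) (use M_ge in auto)
      next
        case 2
        show ?case
        proof (rule triple_seq[where Q = "?I1 i (vbucket B K (Suc i))" and d = "Suc 0" and d' = "Suc 0"
              and A = 60 and A' = 140], goal_cases)
          case 1
          show ?case
          proof (rule triple_for[where I = "?I1 i" and N = "vbucket B K (Suc i)" and A = 10], goal_cases)
            case (1 b)
            show ?case by (rule triple_straight) (use M_ge in auto)
          next
            case (2 b s)
            then show ?case using guard1[OF v, of b] v by (auto simp: okD)
          qed (use M_ge small[OF v] in auto)
        next
          case 2
          show ?case
          proof (rule triple_seq[where Q = "?I2 i 0" and d = 0 and d' = "Suc 0" and A = 40 and A' = 100], goal_cases)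
            case 1
            show ?case
              by (rule triple_straight)
                 (use M_ge v small[OF v] in \<open>auto simp: okD num_digits_def\<close>)
          next
            case 2
            show ?case
            proof (rule triple_for[where I = "?I2 i" and N = "voffset B K (Suc i)" and A = 40], goal_cases)
              case (1 a)
              show ?case
                by (rule triple_straight)
                   (use M_ge v small[OF v] in \<open>auto simp: okD num_digits_def\<close>)
            next
              case (2 a s)
              then show ?case using guard2[OF v, of a] v by (auto simp: okD)
            next
              case (7 s)
              then show ?case by (auto simp: code_def le_Suc_eq)
            qed (use M_ge small[OF v] in auto)
          qed (use M_ge in auto)
        qed (use M_ge in auto)
      qed (use M_ge in auto)
    qed (use M_ge in \<open>auto simp: okD codes_ok_def voters_def\<close>)
  qed (use M_ge in auto)
qed

lemma radix_power_top: "W ^ num_digits B K = M"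
  by (simp add: num_keys_def)

lemma nval_top_digit: "inputs_ok B s \<Longrightarrow> nval (top_digit K) s = num_digits B K"
  by (simp add: top_digit_def okD num_digits_def)

lemma ncost_top_digit: "ncost (top_digit K) = 4"
  by (simp add: top_digit_def)

lemma prog_clear_correct: "triple M (codes_ok B K) (prog_clear K) 60 1 (table_ok B K 0)"
proof -
  let ?I = "\<lambda>k s. codes_ok B K s \<and> nats s ''k'' 0 = k \<and> (\<forall>l. k \<le> l \<and> l < M \<longrightarrow> nats s ''S'' l = 0 \<and> reals s ''C'' l = 0)"
  show ?thesis
    unfolding prog_clear_def
  proof (rule triple_seq[where Q = "?I M" and d = 0 and d' = "Suc 0" and A = 10 and A' = 50], goal_cases)
    case 1
    show ?case
      by (rule triple_straight) (use M_ge in \<open>auto simp: ncost_top_digit nval_top_digit cokD radix_power_top\<close>)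
  next
    case 2
    show ?case
    proof (rule triple_seq[where Q = "?I 0" and d = "Suc 0" and d' = 0 and A = 40 and A' = 10], goal_cases)
      case 1
      show ?case
      proof (rule triple_down[where I = ?I and N = M and A = 25], goal_cases)
        case (1 k)
        show ?case by (rule triple_straight) (use M_ge 1 in \<open>auto simp: le_Suc_eq\<close>)
      qed (use M_ge in auto)
    next
      case 2
      show ?case by (rule triple_straight) (use M_ge in \<open>auto simp: table_ok_def\<close>)
    qed (use M_ge in auto)
  qed (use M_ge in auto)
qed

lemma code_pos: "i \<in> voters B \<Longrightarrow> 0 < code B K i"
  using radix_ge[OF n2] by (simp add: code_def)

lemma prog_table_correct: "triple M (table_ok B K 0) (prog_table K) 200 2 (table_ok B K n)"
proof -
  let ?F = "\<lambda>i. cheapest (code B K) (price B) i"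
  let ?O = "\<lambda>i s. table_ok B K i s \<and> nats s ''i'' 0 = i"
  \<comment> \<open>Row \<open>Suc i\<close> from \<open>k\<close> upwards, row \<open>i\<close>
    below. An update reads only its own index and smaller ones, which are still in row
    \<open>i\<close>.\<close>
  let ?I = "\<lambda>i k s. codes_ok B K s \<and> nats s ''i'' 0 = Suc i \<and> nats s ''k'' 0 = k \<and>
      (\<forall>l<M. nats s ''S'' l = fst (?F (if k \<le> l then Suc i else i) l) \<and>
             reals s ''C'' l = snd (?F (if k \<le> l then Suc i else i) l))"
  show ?thesis
    unfolding prog_table_def
  proof (rule triple_seq[where Q = "?O 0" and d = 0 and d' = "Suc (Suc 0)" and A = 10 and A' = 190], goal_cases)
    case 1
    show ?case by (rule triple_straight) (use M_ge in auto)
  next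
    case 2
    show ?case
    proof (rule triple_for[where I = ?O and N = n and A = 170], goal_cases)
      case (1 i)
      then have v: "Suc i \<in> voters B" by (simp add: voters_def)
      show ?case
      proof (rule triple_seq[where Q = "?I i M" and d = 0 and d' = "Suc 0" and A = 20 and A' = 150], goal_cases)
        case 1
        show ?case
          by (rule triple_straight)
             (use M_ge in \<open>auto simp: ncost_top_digit nval_top_digit cokD radix_power_top table_ok_def prod_eq_iff
                simp del: cheapest.simps\<close>)
      next
        case 2
        show ?case
        proof (rule triple_down[where I = "?I i" and N = M and A = 130], goal_cases)
          case (1 k)
          show ?case
          proof (rule triple_straight, goal_cases)
            case (4 s)
            let ?c = "code B K (Suc i)"
            have c: "0 < ?c" "nats s ''c'' (Suc i) = ?c" "reals s ''q'' (Suc i) = price B (Suc i)"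
              "nats s ''E'' (Suc i) = 2 ^ Suc i"
              using code_pos[OF v] v 4 by (auto simp: cokD voters_def)
            have old: "nats s ''S'' l = fst (?F i l)" "reals s ''C'' l = snd (?F i l)" if "l \<le> k" for l
              using 4 that 1 by auto
            have new: "nats s ''S'' l = fst (?F (Suc i) l)" "reals s ''C'' l = snd (?F (Suc i) l)" if "k < l" "l < M" for l
              using 4 that 1 by (auto simp del: cheapest.simps)
            let ?s = "nupd ''k'' 0 k s"
            have imp: "cval improves ?s \<longleftrightarrow> ?c \<le> k \<and> 0 < fst (?F i (k - ?c)) \<and>
                (fst (?F i k) = 0 \<or> snd (?F i (k - ?c)) + price B (Suc i) < snd (?F i k))"
              using c 4 old by (auto simp: improves_def new_price_def key_rest_def)
            show ?case
            proof (cases "cval improves ?s")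
              case True
              then have F: "?F (Suc i) k = (fst (?F i (k - ?c)) + 2 ^ Suc i, snd (?F i (k - ?c)) + price B (Suc i))"
                using imp unfolding cheapest.simps by (intro if_P) simp
              have "k - ?c \<noteq> k" using True imp c(1) by auto
              then show ?thesis
                using True F 4 c old new
                by (auto simp: key_rest_def new_price_def simp del: cheapest.simps)
            next
              case False
              then have F: "?F (Suc i) k = ?F i k"
                using imp unfolding cheapest.simps by (intro if_not_P) simp
              have "fst (?F (Suc i) l) = nats s ''S'' l \<and> snd (?F (Suc i) l) = reals s ''C'' l" if "k \<le> l" "l < M" for l
                using F old[of k] new[of l] that by (cases "l = k") (auto simp del: cheapest.simps)
              then show ?thesis
                using False 4 old by (auto simp del: cheapest.simps)
            qed
          qed (use M_ge in \<open>auto simp: improves_def new_price_def key_rest_def\<close>)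
        next
          case (7 s)
          then show ?case by (auto simp: table_ok_def prod_eq_iff simp del: cheapest.simps)
        qed (use M_ge in auto)
      qed (use M_ge in auto)
    qed (use M_ge in \<open>auto simp: okD codes_okD(1)[where B = B and K = K] table_okD(1)[where B = B and K = K]\<close>)
  qed (use M_ge in auto)
qed

lemma prog_output_correct:
  assumes "J \<subseteq> voters B"
  shows "triple M (\<lambda>s. powers_ok B K s \<and> nats s ''best'' 0 = set_encode (insert 0 J)) prog_output 100 1
     (\<lambda>s. output_set B s = J)"
proof -
  let ?I = "\<lambda>i s. powers_ok B K s \<and> nats s ''i'' 0 = i \<and> nats s ''best'' 0 = set_encode (insert 0 J \<inter> {..i}) \<and>
     (\<forall>l\<in>{i<..n}. nats s ''I'' l = (if l \<in> J then 1 else 0))"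
  have J: "insert 0 J \<inter> {..n} = insert 0 J" using assms by (auto simp: voters_def)
  show ?thesis
    unfolding prog_output_def
  proof (rule triple_seq[where Q = "?I n" and d = 0 and d' = "Suc 0" and A = 10 and A' = 90], goal_cases)
    case 1
    show ?case by (rule triple_straight) (use M_ge in \<open>auto simp: okD J\<close>)
  next
    case 2
    show ?case
    proof (rule triple_down[where I = ?I and N = n and A = 70], goal_cases)
      case (1 i)
      have enc: "set_encode (insert 0 J \<inter> {..Suc i}) = (if Suc i \<in> J then 2 ^ Suc i else 0) + set_encode (insert 0 J \<inter> {..i})"
        using set_encode_atMost_Suc[of "insert 0 J" i] by simp
      have lt: "set_encode (insert 0 J \<inter> {..i}) < 2 ^ Suc i" by (rule set_encode_atMost_less)
      have set: "{i<..n} = insert (Suc i) {Suc i<..n}" using 1 by auto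
      show ?case
      proof (rule triple_straight, goal_cases)
        case (4 s)
        have E: "nats s ''E'' (Suc i) = 2 ^ Suc i" using 4 1 by (auto simp: okD simp del: power_Suc)
        show ?case
          using 4 E enc lt unfolding set by (cases "Suc i \<in> J") (auto simp del: power_Suc)
      qed (use M_ge in auto)
    next
      case (7 s)
      then show ?case using assms by (auto simp: output_set_def voters_def split: if_splits)
    qed (use M_ge in auto)
  qed (use M_ge in auto)
qed

section \<open>Evaluating the objective of one set\<close>

lemma prog_convolve_correct:
  assumes F: "\<And>s k v. F (rupd ''T'' k v s) = F s" "\<And>s k v. F (nupd ''x'' k v s) = F s"
  shows "triple M (\<lambda>s. F s \<and> nats s ''x'' 0 = n + 1 \<and> reals s ''g'' 0 = g \<and> (\<forall>y\<le>n + 1. reals s ''T'' y = 1 - head y q))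
     prog_convolve 50 1 (\<lambda>s. F s \<and> (\<forall>y\<le>n + 1. reals s ''T'' y = 1 - head y (lin g * q)))"
proof -
  let ?I = "\<lambda>x s. F s \<and> nats s ''x'' 0 = x \<and> reals s ''g'' 0 = g \<and>
      (\<forall>y\<le>n + 1. reals s ''T'' y = 1 - head y (if x < y then lin g * q else q))"
  have "triple M (\<lambda>s. F s \<and> nats s ''x'' 0 = n + 1 \<and> reals s ''g'' 0 = g \<and> (\<forall>y\<le>n + 1. reals s ''T'' y = 1 - head y q))
     prog_convolve 50 (Suc 0) (\<lambda>s. F s \<and> (\<forall>y\<le>n + 1. reals s ''T'' y = 1 - head y (lin g * q)))"
    unfolding prog_convolve_def
  proof (rule triple_down[where I = ?I and N = "n + 1" and A = 30], goal_cases)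
    case (1 x)
    show ?case
    proof (rule triple_straight, goal_cases)
      case (4 s)
      have "(1 - g) * (1 - head (Suc x) q) + g * (1 - head x q) = 1 - head (Suc x) (lin g * q)"
        unfolding head_lin_mult_Suc by (simp add: algebra_simps)
      then show ?case using 4 1 F by (auto simp: less_Suc_eq)
    qed (use M_ge in auto)
  next
    case (7 s)
    then have F0: "F s" and T: "\<And>y. y \<le> n + 1 \<Longrightarrow> reals s ''T'' y = 1 - head y (if 0 < y then lin g * q else q)"
      by auto
    \<comment> \<open>Entry 0 is never written in this loop; it is 1 before and after because
      \<open>head 0\<close> vanishes.\<close>
    have "reals s ''T'' y = 1 - head y (lin g * q)" if "y \<le> n + 1" for y
      using T[OF that] by (cases "y = 0") (auto simp: head_0)
    then show ?case using F0 by blast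
  qed (use M_ge in auto)
  then show ?thesis by simp
qed

definition unbribed_after :: "nat set \<Rightarrow> nat \<Rightarrow> nat \<Rightarrow> nat" where
  "unbribed_after J i u = card {l \<in> {i<..n}. l \<notin> J \<and> vote B l = u}"

text \<open>The form of \<open>rival_max\<close> for the voters above \<open>i\<close>, who are
  processed in descending order; at \<open>i = 0\<close> it turns into
  \<open>rival_max\<close>.\<close>

definition tally :: "nat set \<Rightarrow> nat \<Rightarrow> store \<Rightarrow> bool" where
  "tally J i s \<longleftrightarrow> (\<forall>v<m. nats s ''cnt'' v = unbribed_after J i v) \<and>
     (\<forall>v\<in>{1..<m}. nats s ''cnt'' v \<le> nats s ''mx'' 0) \<and>
     (nats s ''mx'' 0 = 0 \<or> (\<exists>v\<in>{1..<m}. nats s ''mx'' 0 = nats s ''cnt'' v))"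

definition frame :: "nat \<Rightarrow> nat \<Rightarrow> real \<Rightarrow> store \<Rightarrow> bool" where
  "frame k b v s \<longleftrightarrow> table_ok B K n s \<and> nats s ''k'' 0 = k \<and> nats s ''best'' 0 = b \<and> reals s ''bv'' 0 = v"

lemma tally_upd [simp]:
  "x \<notin> {''cnt'', ''mx''} \<Longrightarrow> tally J i (nupd x k v s) = tally J i s"
  "tally J i (rupd y k v' s) = tally J i s"
  by (auto simp: tally_def)

lemma frame_upd [simp]:
  "x \<notin> {''m'', ''n'', ''vote'', ''U'', ''E'', ''c'', ''S'', ''k'', ''best''} \<Longrightarrow> frame k b v (nupd x l w s) = frame k b v s"
  "y \<notin> {''Q'', ''q'', ''p'', ''C'', ''bv''} \<Longrightarrow> frame k b v (rupd y l w' s) = frame k b v s"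
  by (auto simp: frame_def)

lemma frameD:
  assumes "frame k b v s"
  shows "inputs_ok B s" "i \<le> n \<Longrightarrow> nats s ''E'' i = 2 ^ i" "nats s ''k'' 0 = k"
    "l < M \<Longrightarrow> nats s ''S'' l = fst (cheapest (code B K) (price B) n l)"
  using assms by (auto simp: frame_def table_okD cokD dest: table_okD(1))

lemma prog_voter_correct:
  assumes i: "Suc i \<le> n"
  shows "triple M (\<lambda>s. frame k b v s \<and> nats s ''i'' 0 = Suc i \<and> nats s ''rem'' 0 = set_encode (insert 0 J \<inter> {..Suc i})
       \<and> tally J (Suc i) s \<and> (\<forall>y\<le>n + 1. reals s ''T'' y = 1 - head y q))
     prog_voter 150 0
     (\<lambda>s. (frame k b v s \<and> nats s ''i'' 0 = Suc i \<and> nats s ''rem'' 0 = set_encode (insert 0 J \<inter> {..i}) \<and> tally J i s)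
       \<and> nats s ''x'' 0 = n + 1 \<and> reals s ''g'' 0 = gain_prob B J (Suc i) \<and> (\<forall>y\<le>n + 1. reals s ''T'' y = 1 - head y q))"
  unfolding prog_voter_def
proof (rule triple_straight, goal_cases)
  case (4 s)
  have v: "Suc i \<in> voters B" using i by (simp add: voters_def)
  have vote: "vote B (Suc i) \<in> {1..m}" using inst v by (auto simp: bvu_instance_def)
  have in': "nats s ''vote'' (Suc i) = vote B (Suc i)" "nats s ''m'' 0 = m" "nats s ''n'' 0 = n"
    "reals s ''p'' (Suc i) = prob B (Suc i)" "nats s ''E'' (Suc i) = 2 ^ Suc i"
    using 4 v i frameD[of k b v s] by (auto simp: okD simp del: power_Suc)
  have enc: "set_encode (insert 0 J \<inter> {..Suc i}) = (if Suc i \<in> J then 2 ^ Suc i else 0) + set_encode (insert 0 J \<inter> {..i})"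
    using set_encode_atMost_Suc[of "insert 0 J" i] by simp
  have lt: "set_encode (insert 0 J \<inter> {..i}) < 2 ^ Suc i" by (rule set_encode_atMost_less)
  have set: "{i<..n} = insert (Suc i) {Suc i<..n}" using i by auto
  have cnt: "unbribed_after J i u =
      (if Suc i \<notin> J \<and> vote B (Suc i) = u then 1 else 0) + unbribed_after J (Suc i) u" for u
  proof -
    have "{l \<in> {i<..n}. l \<notin> J \<and> vote B l = u} =
        (if Suc i \<notin> J \<and> vote B (Suc i) = u then insert (Suc i) else id) {l \<in> {Suc i<..n}. l \<notin> J \<and> vote B l = u}"
      unfolding set by auto
    then show ?thesis by (simp add: unbribed_after_def)
  qed
  have told: "\<forall>u<m. nats s ''cnt'' u = unbribed_after J (Suc i) u"
    "\<forall>u\<in>{1..<m}. nats s ''cnt'' u \<le> nats s ''mx'' 0"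
    "nats s ''mx'' 0 = 0 \<or> (\<exists>u\<in>{1..<m}. nats s ''mx'' 0 = nats s ''cnt'' u)"
    using 4 by (auto simp: tally_def)
  consider "Suc i \<in> J" "vote B (Suc i) < m" | "Suc i \<in> J" "vote B (Suc i) = m"
    | "Suc i \<notin> J" "vote B (Suc i) < m" | "Suc i \<notin> J" "vote B (Suc i) = m"
    using vote by force
  then show ?case
  proof cases
    case 1
    then show ?thesis using 4 in' enc lt told vote
      by (auto simp: gain_prob_def tally_def cnt simp del: power_Suc)
  next
    case 2
    then show ?thesis using 4 in' enc lt told vote
      by (auto simp: gain_prob_def tally_def cnt simp del: power_Suc)
  next
    case 3
    let ?u = "vote B (Suc i)"
    have u: "?u \<in> {1..<m}" using 3 vote by auto
    show ?thesis
    proof (cases "nats s ''mx'' 0 < Suc (nats s ''cnt'' ?u)")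
      case True
      then have "\<forall>w\<in>{1..<m}. nats s ''cnt'' w \<le> Suc (nats s ''cnt'' ?u)" using told(2) by force
      then show ?thesis using True 3 4 in' enc lt told u
        by (auto simp: gain_prob_def tally_def cnt simp del: power_Suc)
    next
      \<comment> \<open>Here \<open>mx\<close> exceeds the old count of \<open>?u\<close>, so it is
        positive and attained by another rival, whose count does not change.\<close>
      case False
      then obtain w where "w \<in> {1..<m}" "nats s ''mx'' 0 = nats s ''cnt'' w"
        using told(3) by auto
      moreover from this have "w \<noteq> ?u" using False by auto
      ultimately have "\<exists>w\<in>{1..<m}. w \<noteq> ?u \<and> nats s ''mx'' 0 = nats s ''cnt'' w" by blast
      then show ?thesis using False 3 4 in' enc lt told u
        by (auto simp: gain_prob_def tally_def cnt simp del: power_Suc)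
    qed
  next
    case 4
    then show ?thesis using \<open>frame k b v s \<and> _\<close> in' enc lt told vote
      by (auto simp: gain_prob_def tally_def cnt simp del: power_Suc)
  qed
qed (use M_ge in auto)

lemma prog_reset_correct:
  assumes k: "k < M" and J: "J \<subseteq> voters B" and S: "fst (cheapest (code B K) (price B) n k) = set_encode (insert 0 J)"
  shows "triple M (frame k b v) prog_reset 150 1
     (\<lambda>s. frame k b v s \<and> nats s ''i'' 0 = n \<and> nats s ''rem'' 0 = set_encode (insert 0 J \<inter> {..n})
       \<and> tally J n s \<and> (\<forall>y\<le>n + 1. reals s ''T'' y = 1 - head y 1))"
proof -
  let ?X = "\<lambda>x s. frame k b v s \<and> nats s ''x'' 0 = x \<and> (\<forall>y\<in>{x<..n + 1}. reals s ''T'' y = 0)"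
  let ?C = "\<lambda>j s. frame k b v s \<and> (\<forall>y\<in>{0<..n + 1}. reals s ''T'' y = 0) \<and> nats s ''j'' 0 = j \<and>
      (\<forall>u. j \<le> u \<and> u < m \<longrightarrow> nats s ''cnt'' u = 0)"
  have J': "insert 0 J \<inter> {..n} = insert 0 J" using J by (auto simp: voters_def)
  have head1: "head y 1 = (if y = 0 then 0 else 1)" for y
    by (cases y) (simp_all add: head_def coeff_1 sum.If_cases)
  show ?thesis
    unfolding prog_reset_def
  proof (rule triple_seq[where Q = "?X (n + 1)" and d = 0 and d' = "Suc 0" and A = 10 and A' = 140], goal_cases)
    case 1
    show ?case by (rule triple_straight) (use M_ge in \<open>auto simp: frameD okD\<close>)
  next
    case 2
    show ?case
    proof (rule triple_seq[where Q = "?X 0" and d = "Suc 0" and d' = "Suc 0" and A = 30 and A' = 110], goal_cases)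
      case 1
      show ?case
      proof (rule triple_down[where I = ?X and N = "n + 1" and A = 20], goal_cases)
        case (1 x)
        show ?case
        proof (rule triple_straight, goal_cases)
          case (4 s)
          have "{x<..Suc n} = insert (Suc x) {Suc x<..Suc n}" using 1 by auto
          then show ?case using 4 by auto
        qed (use M_ge in auto)
      qed (use M_ge in auto)
    next
      case 2
      show ?case
      proof (rule triple_seq[where Q = "?C m" and d = 0 and d' = "Suc 0" and A = 10 and A' = 100], goal_cases)
        case 1
        show ?case by (rule triple_straight) (use M_ge in \<open>auto simp: frameD okD\<close>)
      next
        case 2
        show ?case
        proof (rule triple_seq[where Q = "?C 0" and d = "Suc 0" and d' = 0 and A = 40 and A' = 40], goal_cases)
          case 1
          show ?case
          proof (rule triple_down[where I = ?C and N = m and A = 20], goal_cases)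
            case (1 j)
            show ?case by (rule triple_straight) (use M_ge in \<open>auto simp: le_Suc_eq\<close>)
          qed (use M_ge in auto)
        next
          case 2
          show ?case
            by (rule triple_straight)
               (use M_ge k S J' in \<open>auto simp: frameD okD tally_def unbribed_after_def head1\<close>)
        qed (use M_ge in auto)
      qed (use M_ge in auto)
    qed (use M_ge in auto)
  qed (use M_ge in auto)
qed

lemma prog_eval_correct:
  assumes k: "k < M" and J: "J \<subseteq> voters B" and S: "fst (cheapest (code B K) (price B) n k) = set_encode (insert 0 J)"
  shows "triple M (frame k b v) prog_eval 500 2
     (\<lambda>s. frame k b v s \<and> reals s ''T'' (nats s ''mx'' 0 + 1) = objective B J)"
proof -
  let ?I = "\<lambda>i s. frame k b v s \<and> nats s ''i'' 0 = i \<and> nats s ''rem'' 0 = set_encode (insert 0 J \<inter> {..i})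
       \<and> tally J i s \<and> (\<forall>y\<le>n + 1. reals s ''T'' y = 1 - head y (gen {i<..n} (gain_prob B J)))"
  show ?thesis
    unfolding prog_eval_def
  proof (rule triple_seq[where Q = "?I n" and d = 1 and d' = "Suc 1" and A = 150 and A' = 300], goal_cases)
    case 1
    show ?case
      by (rule triple_conseq[OF prog_reset_correct[OF assms]]) (auto simp: gen_def)
  next
    case 2
    show ?case
    proof (rule triple_down[where I = ?I and N = n and A = 250], goal_cases)
      case (1 i)
      then have i: "Suc i \<le> n" by simp
      let ?q = "gen {Suc i<..n} (gain_prob B J)"
      let ?F = "\<lambda>s. frame k b v s \<and> nats s ''i'' 0 = Suc i \<and> nats s ''rem'' 0 = set_encode (insert 0 J \<inter> {..i}) \<and> tally J i s"
      have "{i<..n} = insert (Suc i) {Suc i<..n}" using i by auto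
      then have gen: "gen {i<..n} (gain_prob B J) = lin (gain_prob B J (Suc i)) * ?q"
        by (simp add: gen_insert)
      show ?case
      proof (rule triple_seq[OF prog_voter_correct[OF i, where q = ?q] _, where d' = 1 and A' = 90], goal_cases)
        case 1
        show ?case
        proof (rule triple_seq[OF prog_convolve_correct[where F = ?F] _, where d' = 0 and A' = 20], goal_cases)
          case 3
          show ?case by (rule triple_straight) (use M_ge in \<open>auto simp: gen\<close>)
        qed (use M_ge in auto)
      qed (use M_ge in auto)
    next
      case (7 s)
      have V: "{0<..n} = voters B" by (auto simp: voters_def)
      have ub: "unbribed_after J 0 u = unbribed_votes B J u" if "u < m" for u
        unfolding unbribed_votes_def unbribed_after_def V
        by (rule arg_cong[where f = card]) (use that in \<open>auto simp: bribed_def supporters_def\<close>)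
      have cnt: "nats s ''cnt'' u = unbribed_votes B J u" if "u < m" for u
        using 7 that ub by (auto simp: tally_def)
      have rm: "rival_max B J (nats s ''mx'' 0)"
        using 7 cnt unfolding rival_max_def tally_def by auto
      \<comment> \<open>Ensures that \<open>mx + 1\<close> lies in the range where \<open>T\<close>
        is maintained.\<close>
      have "unbribed_votes B J u \<le> n" for u
      proof -
        have "unbribed_votes B J u \<le> card (voters B)"
          unfolding unbribed_votes_def by (rule card_mono) auto
        then show ?thesis by (simp add: voters_def)
      qed
      then have "nats s ''mx'' 0 \<le> n" using rm by (auto simp: rival_max_def)
      then show ?case using 7 objective_eq_head[OF inst rm] by (simp add: V)
    qed (use M_ge in auto)
  qed (use M_ge in auto)
qed

section \<open>Selecting the best affordable key\<close>

definition candidate :: "nat \<Rightarrow> nat set \<Rightarrow> bool" where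
  "candidate l J \<longleftrightarrow> J \<subseteq> voters B \<and> fst (cheapest (code B K) (price B) n l) = set_encode (insert 0 J) \<and>
     snd (cheapest (code B K) (price B) n l) \<le> budget B"

text \<open>Demanding \<open>v \<le> objective B J\<close> instead of equality admits the start with
  the empty set and value 0 by mere nonnegativity.\<close>

definition best_upto :: "nat \<Rightarrow> nat \<Rightarrow> real \<Rightarrow> bool" where
  "best_upto a b v \<longleftrightarrow> (\<exists>J. feasible B J \<and> b = set_encode (insert 0 J) \<and> v \<le> objective B J) \<and>
     (\<forall>l<a. \<forall>J. candidate l J \<longrightarrow> objective B J \<le> v)"

text \<open>The encoding is injective on sets of voters, so \<open>J\<close> is the set whose price
  \<open>cheapest_sound\<close> identifies with the table entry.\<close>

lemma candidate_feasible: "candidate l J \<Longrightarrow> feasible B J"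
proof -
  assume J: "candidate l J"
  then have fin: "finite J" by (auto simp: candidate_def intro: finite_subset[OF _ finite_voters])
  then have "0 < set_encode (insert 0 J)" by (simp add: set_encode_def sum_pos)
  then obtain J' where J': "J' \<subseteq> {1..n}" "set_encode (insert 0 J) = set_encode (insert 0 J')"
      "snd (cheapest (code B K) (price B) n l) = sum (price B) J'"
    using cheapest_sound[of "code B K" "price B" n l] J by (auto simp: candidate_def)
  then have "J = J'"
    using J by (intro set_encode_insert_0_inj[of J B J']) (auto simp: candidate_def voters_def)
  then show ?thesis using J J' by (auto simp: candidate_def feasible_def)
qed

lemma best_upto_Suc_update:
  assumes "best_upto k b v" "candidate k J" "v < objective B J"
  shows "best_upto (Suc k) (set_encode (insert 0 J)) (objective B J)"
  unfolding best_upto_def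
proof (intro conjI allI impI)
  show "\<exists>J'. feasible B J' \<and> set_encode (insert 0 J) = set_encode (insert 0 J') \<and> objective B J \<le> objective B J'"
    using candidate_feasible[OF assms(2)] by blast
  fix l J' assume l: "l < Suc k" "candidate l J'"
  show "objective B J' \<le> objective B J"
  proof (cases "l = k")
    case True
    then have "J' = J" using l(2) assms(2) by (intro set_encode_insert_0_inj[of J' B J]) (auto simp: candidate_def)
    then show ?thesis by simp
  next
    case False
    then have "l < k" using l(1) by simp
    then have "objective B J' \<le> v" using assms(1) l(2) unfolding best_upto_def by blast
    then show ?thesis using assms(3) by simp
  qed
qed

lemma best_upto_Suc_keep:
  assumes "best_upto k b v" "\<And>J. candidate k J \<Longrightarrow> objective B J \<le> v"
  shows "best_upto (Suc k) b v"
  using assms by (auto simp: best_upto_def less_Suc_eq)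

lemma prog_select_correct:
  "triple M (table_ok B K n) (prog_select K) 700 3
     (\<lambda>s. powers_ok B K s \<and> best_upto M (nats s ''best'' 0) (reals s ''bv'' 0))"
proof -
  let ?I = "\<lambda>a k s. table_ok B K n s \<and> nats s ''k'' 0 = k \<and> best_upto a (nats s ''best'' 0) (reals s ''bv'' 0)"
  have "feasible B {}" using inst by (auto simp: feasible_def bvu_instance_def)
  moreover have "Suc 0 = set_encode (insert 0 {})" by (simp add: set_encode_def)
  ultimately have init: "best_upto 0 (Suc 0) 0" unfolding best_upto_def using objective_bounds(1)[of B "{}"] by auto
  show ?thesis
    unfolding prog_select_def
  proof (rule triple_seq[where Q = "?I 0 0" and d = 0 and d' = "Suc 2" and A = 20 and A' = 680], goal_cases)
    case 1
    show ?case by (rule triple_straight) (use M_ge init in auto)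
  next
    case 2
    show ?case
    proof (rule triple_for[where I = "\<lambda>k. ?I k k" and N = M and A = 640], goal_cases)
      case (1 k)
      show ?case
      proof (rule triple_seq[where Q = "?I (Suc k) k" and d = 2 and d' = 0 and A = 620 and A' = 10], goal_cases)
        case 1
        show ?case
        proof (rule triple_cond[where A = 590 and A' = 10], goal_cases)
          case 1
          show ?case
          proof (cases "\<exists>J. candidate k J")
            case False
            show ?thesis
            \<comment> \<open>By \<open>cheapest_sound\<close>, an attained and affordable entry
              would yield a candidate, so this branch cannot be entered.\<close>
            proof (rule triple_vacuous)
              fix s
              show "\<not> (?I k k s \<and> cval (CAnd (NLess (NConst 0) (NGet ''S'' (nvar ''k'')))
                  (CNot (RLess (rvar ''Q'') (RGet ''C'' (nvar ''k''))))) s)"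
              proof
                assume *: "?I k k s \<and> cval (CAnd (NLess (NConst 0) (NGet ''S'' (nvar ''k'')))
                  (CNot (RLess (rvar ''Q'') (RGet ''C'' (nvar ''k''))))) s"
                then have t: "table_ok B K n s" by blast
                then have "inputs_ok B s" by (auto simp: cokD dest: table_okD(1))
                then have "0 < fst (cheapest (code B K) (price B) n k)"
                  "snd (cheapest (code B K) (price B) n k) \<le> budget B"
                  using * \<open>k < M\<close> table_okD(2,3)[OF t] by (auto simp: okD)
                then have "\<exists>J. candidate k J"
                  using cheapest_sound[of "code B K" "price B" n k] by (auto simp: candidate_def voters_def)
                then show False using False by blast
              qed
            qed
          next
            case True
            then obtain J where J: "candidate k J" by blast
            then have ev: "triple M (frame k b v) prog_eval 500 2
                (\<lambda>s. frame k b v s \<and> reals s ''T'' (nats s ''mx'' 0 + 1) = objective B J)" for b v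
              using prog_eval_correct[OF \<open>k < M\<close>] by (simp add: candidate_def)
            show ?thesis
            proof (rule triple_split_best)
              fix b v
              show "triple M (\<lambda>s. (?I k k s \<and> cval (CAnd (NLess (NConst 0) (NGet ''S'' (nvar ''k'')))
                  (CNot (RLess (rvar ''Q'') (RGet ''C'' (nvar ''k''))))) s) \<and> nats s ''best'' 0 = b \<and> reals s ''bv'' 0 = v)
                  (prog_eval ;; prog_update) 590 2 (?I (Suc k) k)"
              proof (cases "best_upto k b v")
                case False
                then show ?thesis by (intro triple_vacuous) auto
              next
                case True
                show ?thesis
                proof (rule triple_seq[where A = 500 and d = 2 and d' = 0 and A' = 90])
                  show "triple M (\<lambda>s. (?I k k s \<and> cval (CAnd (NLess (NConst 0) (NGet ''S'' (nvar ''k'')))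
                      (CNot (RLess (rvar ''Q'') (RGet ''C'' (nvar ''k''))))) s) \<and> nats s ''best'' 0 = b \<and> reals s ''bv'' 0 = v)
                      prog_eval 500 2 (\<lambda>s. frame k b v s \<and> reals s ''T'' (nats s ''mx'' 0 + 1) = objective B J)"
                    by (rule triple_conseq[OF ev[of b v]]) (auto simp: frame_def)
                  show "triple M (\<lambda>s. frame k b v s \<and> reals s ''T'' (nats s ''mx'' 0 + 1) = objective B J)
                      prog_update 90 0 (?I (Suc k) k)"
                    unfolding prog_update_def
                  proof (rule triple_straight, goal_cases)
                    case (4 s)
                    then have s: "frame k b v s" "reals s ''T'' (Suc (nats s ''mx'' 0)) = objective B J" by auto
                    have S: "nats s ''S'' k = set_encode (insert 0 J)"
                      using frameD(4)[OF s(1) \<open>k < M\<close>] J by (simp add: candidate_def)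
                    show ?case
                    proof (cases "v < objective B J")
                      case True
                      then show ?thesis
                        using s S best_upto_Suc_update[OF \<open>best_upto k b v\<close> J True] by (auto simp: frame_def)
                    next
                      case False
                      have "best_upto (Suc k) b v"
                      proof (rule best_upto_Suc_keep[OF \<open>best_upto k b v\<close>])
                        fix J' assume "candidate k J'"
                        then have "J' = J"
                          using J by (intro set_encode_insert_0_inj[of J' B J]) (auto simp: candidate_def)
                        then show "objective B J' \<le> v" using False by simp
                      qed
                      then show ?thesis using s False by (auto simp: frame_def)
                    qed
                  qed (use M_ge in auto)
                qed (use M_ge in auto)
              qed
            qed
          qed
        next
          case 2
          show ?case
          proof (rule triple_straight, goal_cases)
            case (4 s)
            then have t: "table_ok B K n s" by blast
            then have "inputs_ok B s" by (auto simp: cokD dest: table_okD(1))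
            then have no: "\<not> (0 < fst (cheapest (code B K) (price B) n k) \<and>
                snd (cheapest (code B K) (price B) n k) \<le> budget B)"
              using 4 \<open>k < M\<close> table_okD(2,3)[OF t] by (auto simp: okD)
            have "\<not> candidate k J" for J
            proof
              assume J: "candidate k J"
              then have "finite J" by (auto simp: candidate_def intro: finite_subset[OF _ finite_voters])
              then have "0 < set_encode (insert 0 J)" by (simp add: set_encode_def sum_pos)
              then show False using J no by (auto simp: candidate_def)
            qed
            then have "best_upto (Suc k) (nats s ''best'' 0) (reals s ''bv'' 0)"
              using 4 by (intro best_upto_Suc_keep) auto
            then show ?case using 4 by simp
          qed (use M_ge in auto)
        qed (use M_ge in auto)
      next
        case 2
        show ?case by (rule triple_straight) (use M_ge in auto)
      qed (use M_ge in auto)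
    next
      case (2 k s)
      then have "powers_ok B K s" by (auto simp: cokD dest: table_okD(1))
      then show ?case using 2 by (auto simp: nval_top_digit okD radix_power_top)
    next
      case (5)
      show ?case by (simp add: ncost_top_digit)
    qed (use M_ge in \<open>auto dest: table_okD(1) codes_okD(1)\<close>)
  qed (use M_ge in auto)
qed

text \<open>Removing the designated candidate's own supporters from an optimal set keeps its value
  and, prices being nonnegative, its feasibility. The table entry at the key of the rest costs no
  more, is therefore a candidate, and loses at most \<open>34 / K\<close>.\<close>

lemma best_upto_near_optimal:
  assumes "best_upto M b v"
  obtains J where "feasible B J" "b = set_encode (insert 0 J)" "objective B J \<ge> OPT B - 34 / K"
proof -
  obtain I where I: "feasible B I" "OPT B = objective B I" using OPT_attained[OF inst] .
  define I0 where "I0 = I - supporters B m"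
  have price: "\<And>i. i \<in> voters B \<Longrightarrow> 0 \<le> price B i" using inst by (auto simp: bvu_instance_def)
  have I0: "I0 \<subseteq> voters B" "I0 \<inter> supporters B m = {}" using I by (auto simp: I0_def feasible_def)
  have "sum (price B) I0 \<le> sum (price B) I"
    by (rule sum_mono2) (use I price in \<open>auto simp: I0_def feasible_def intro: finite_subset[OF _ finite_voters]\<close>)
  then have cost: "sum (price B) I0 \<le> budget B" using I by (simp add: feasible_def)
  have opt: "OPT B = objective B I0"
    unfolding I(2) by (rule objective_bribed) (auto simp: bribed_def I0_def)
  let ?k = "sum (code B K) I0"
  have k: "?k < M" using sum_code_less[OF inst _ I0(1)] K2 by simp
  have I0': "I0 \<subseteq> {1..n}" using I0 by (simp add: voters_def)
  have ch: "0 < fst (cheapest (code B K) (price B) n ?k)" "snd (cheapest (code B K) (price B) n ?k) \<le> budget B"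
    using cheapest_complete[OF I0', of "code B K" "price B"] cost by auto
  obtain J where J: "J \<subseteq> {1..n}" "fst (cheapest (code B K) (price B) n ?k) = set_encode (insert 0 J)"
      "sum (code B K) J = ?k"
    using cheapest_sound[OF ch(1)] by blast
  have Jv: "J \<subseteq> voters B" using J by (simp add: voters_def)
  have "objective B J \<ge> objective B I0 - 34 / K"
    by (rule objective_same_key[OF inst K2 I0 Jv]) (use J in simp)
  moreover have "candidate ?k J" using ch Jv J by (simp add: candidate_def)
  then have "objective B J \<le> v" using assms k by (auto simp: best_upto_def)
  ultimately show thesis using that assms opt unfolding best_upto_def by force
qed

lemma prog_main_correct:
  "triple M (inputs_ok B) (prog_main K) 2000 3
     (\<lambda>s. feasible B (output_set B s) \<and> objective B (output_set B s) \<ge> OPT B - 34 / K)"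
proof -
  let ?good = "\<lambda>J. feasible B J \<and> objective B J \<ge> OPT B - 34 / K"
  have "triple M (\<lambda>s. \<exists>J. ?good J \<and> powers_ok B K s \<and> nats s ''best'' 0 = set_encode (insert 0 J))
      prog_output 100 1 (\<lambda>s. ?good (output_set B s))"
  proof (rule triple_ex)
    fix J
    show "triple M (\<lambda>s. ?good J \<and> powers_ok B K s \<and> nats s ''best'' 0 = set_encode (insert 0 J))
      prog_output 100 1 (\<lambda>s. ?good (output_set B s))"
    proof (cases "?good J")
      case True
      then have "J \<subseteq> voters B" by (simp add: feasible_def)
      from triple_conseq[OF prog_output_correct[OF this]] True show ?thesis by simp
    next
      case False
      then show ?thesis by (intro triple_vacuous) auto
    qed
  qed
  then have out: "triple M (\<lambda>s. powers_ok B K s \<and> best_upto M (nats s ''best'' 0) (reals s ''bv'' 0))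
      prog_output 100 1 (\<lambda>s. ?good (output_set B s))"
    by (rule triple_conseq) (use best_upto_near_optimal in blast)+
  have M1: "M \<ge> 1" using M_ge by simp
  note seq = triple_seq[where e = 3, OF _ _ M1 _ _ order.refl]
  have "triple M (inputs_ok B) (prog_main K) (40 + (130 + (50 + (250 + (60 + (200 + (700 + 100))))))) 3
     (\<lambda>s. ?good (output_set B s))"
    unfolding prog_main_def
    by (rule seq[OF prog_radix_correct], rule seq[OF prog_powers_correct], rule seq[OF prog_bits_correct],
        rule seq[OF prog_codes_correct], rule seq[OF prog_clear_correct], rule seq[OF prog_table_correct],
        rule seq[OF prog_select_correct out]) simp_all
  then show ?thesis unfolding triple_def by (force intro: order.trans[OF _ mult_right_mono])
qed

end

section \<open>Running time in terms of the number of voters, and the theorem\<close>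

lemma inputs_ok_input_store: "inputs_ok B (input_store B)"
  by (auto simp: inputs_ok_def input_store_def)

lemma output_set_input_store: "output_set B (input_store B) = {}"
  by (simp add: output_set_def input_store_def)

lemma num_keys_le:
  assumes "num_voters B \<ge> 2"
  shows "num_keys B K \<le> num_voters B ^ (3 * num_digits B K)"
proof -
  let ?n = "num_voters B"
  have "?n * ?n + 1 \<le> 2 * (?n * ?n)" using assms by simp
  also have "\<dots> \<le> ?n * (?n * ?n)" using assms by (intro mult_right_mono) auto
  finally have "radix B \<le> ?n ^ 3" by (simp add: radix_def power3_eq_cube mult.assoc)
  then have "num_keys B K \<le> (?n ^ 3) ^ num_digits B K" unfolding num_keys_def by (intro power_mono) auto
  then show ?thesis by (simp add: power_mult)
qed

lemma objective_empty:
  assumes "bvu_instance B"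
  shows "objective B {} = 0"
proof -
  have "counted_votes B {} w j = card (supporters B j)" for w j
    by (auto simp: counted_votes_def supporters_def ballot_def bribed_def intro!: arg_cong[where f = card])
  moreover have "card (supporters B (num_cands B)) < card (supporters B 1)" "1 \<in> {1..<num_cands B}"
    using assms by (auto simp: bvu_instance_def)
  ultimately have "\<not> designated_wins B {} w" for w
    unfolding designated_wins_def by (metis less_asym)
  then show ?thesis by (simp add: objective_def)
qed

lemma prog_single_correct:
  assumes B: "bvu_instance B" and n: "num_voters B = 1"
  obtains t s where "exec (prog K) (input_store B) t s" "t \<le> 30" "feasible B (output_set B s)"
    "objective B (output_set B s) \<ge> OPT B"
proof -
  let ?i = "input_store B"
  let ?s = "run prog_single ?i"
  note io = inputs_okD[OF inputs_ok_input_store[of B]]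
  have v: "voters B = {1}" by (simp add: voters_def n)
  obtain t where t: "t \<le> maxcost prog_single" "exec prog_single ?i t ?s"
    using exec_run[of prog_single ?i] by (auto simp: prog_single_def)
  have "exec (prog K) ?i (1 + ccost (NLess (nvar ''n'') (NConst 2)) + t) ?s"
    unfolding prog_def by (rule exec.CondTrue[OF _ t(2)]) (simp add: io n)
  moreover have "1 + ccost (NLess (nvar ''n'') (NConst 2)) + t \<le> 30"
    using t(1) by (simp add: prog_single_def)
  moreover have out: "output_set B ?s = (if budget B < price B 1 then {} else {1})"
    using v io by (auto simp: prog_single_def output_set_def input_store_def)
  obtain I where I: "feasible B I" "OPT B = objective B I" using OPT_attained[OF B] .
  have "I \<subseteq> {1}" using I v by (simp add: feasible_def)
  then have "I = {} \<or> I = {1}" by auto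
  then have "feasible B (output_set B ?s) \<and> objective B (output_set B ?s) \<ge> OPT B"
    using I objective_empty[OF B] objective_bounds(1)[of B "{1}"] B v unfolding out
    by (auto simp: feasible_def bvu_instance_def)
  ultimately show thesis using that by blast
qed

text \<open>\<open>9 = 3 * 3\<close> comes from the cube of the number of keys and the bound
  \<open>n ^ 3\<close> on the radix, \<open>11\<close> from \<open>2048 = 2 ^ 11\<close>. The sum is
  at most \<open>20 + 9 * m + 630 / \<epsilon>\<close>, and 1, \<open>m\<close> and
  \<open>1 / \<epsilon>\<close> are all at most \<open>m ^ 5 / \<epsilon> ^ 5\<close>.\<close>

lemma exponent_bound:
  fixes \<epsilon> :: real
  assumes e: "0 < \<epsilon>" "\<epsilon> < 1" and m: "m \<ge> (2::nat)" and K: "K = nat \<lceil>34 / \<epsilon>\<rceil>"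
  shows "real (11 + 9 * (m + K + K + 1)) \<le> 1000 * (real m ^ 5 / \<epsilon> ^ 5)"
proof -
  define x where "x = 1 / \<epsilon>"
  have x: "1 \<le> x" using e by (simp add: x_def)
  have "0 \<le> 34 / \<epsilon>" using e by simp
  then have "real K \<le> 34 / \<epsilon> + 1" unfolding K by linarith
  then have K': "real K \<le> 35 * x" using x by (simp add: x_def)
  have x5: "x \<le> x ^ 5" "1 \<le> x ^ 5" using power_increasing[of 1 5 x] x by (auto simp: one_le_power)
  have m5: "real m \<le> real m ^ 5" "1 \<le> real m ^ 5" using power_increasing[of 1 5 "real m"] m by (auto simp: one_le_power)
  have mx: "real m \<le> real m ^ 5 * x ^ 5" "x \<le> real m ^ 5 * x ^ 5" "1 \<le> real m ^ 5 * x ^ 5"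
    using mult_mono[of "real m" "real m ^ 5" 1 "x ^ 5"] mult_mono[of 1 "real m ^ 5" x "x ^ 5"]
      mult_mono[of 1 "real m ^ 5" 1 "x ^ 5"] x5 m5 x by auto
  have "real (11 + 9 * (m + K + K + 1)) \<le> 20 + 9 * real m + 630 * x" using K' by simp
  also have "\<dots> \<le> 1000 * (real m ^ 5 * x ^ 5)" using mx by linarith
  also have "real m ^ 5 * x ^ 5 = real m ^ 5 / \<epsilon> ^ 5" by (simp add: x_def power_divide)
  finally show ?thesis .
qed

theorem theorem4:
  shows "\<exists>C::real. C > 0 \<and>
    (\<forall>\<epsilon>::real. \<epsilon> > 0 \<longrightarrow>
      (\<exists>alg::com. \<forall>B::bvu. bvu_instance B \<longrightarrow>
        OPT B \<in> {0..1} \<and>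
        (\<exists>t s. exec alg (input_store B) t s \<and>
          real t \<le> C * (real (gap B) powr (C * (real (num_cands B) * real (gap B) / \<epsilon>)) +
                        real (num_voters B) powr (C * (real (num_cands B) ^ 5 / \<epsilon> ^ 5))) \<and>
          feasible B (output_set B s) \<and>
          objective B (output_set B s) \<ge> OPT B - \<epsilon>)))"
proof (intro exI[of _ "1000::real"] conjI allI impI)
  fix \<epsilon> :: real assume e: "\<epsilon> > 0"
  let ?K = "nat \<lceil>34 / \<epsilon>\<rceil>"
  let ?bound = "\<lambda>B. 1000 * (real (gap B) powr (1000 * (real (num_cands B) * real (gap B) / \<epsilon>)) +
        real (num_voters B) powr (1000 * (real (num_cands B) ^ 5 / \<epsilon> ^ 5)))"
  have bound: "1000 * real (num_voters B) powr (1000 * (real (num_cands B) ^ 5 / \<epsilon> ^ 5)) \<le> ?bound B" for B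
    by simp
  have bound1: "1000 \<le> ?bound B" if "bvu_instance B" for B
  proof -
    have "1 \<le> real (num_voters B) powr (1000 * (real (num_cands B) ^ 5 / \<epsilon> ^ 5))"
      using num_voters_pos[OF that] e by (intro ge_one_powr_ge_zero) auto
    then show ?thesis using bound[of B] by linarith
  qed
  show "\<exists>alg. \<forall>B. bvu_instance B \<longrightarrow> OPT B \<in> {0..1} \<and>
      (\<exists>t s. exec alg (input_store B) t s \<and> real t \<le> ?bound B \<and> feasible B (output_set B s) \<and>
         objective B (output_set B s) \<ge> OPT B - \<epsilon>)"
  \<comment> \<open>For \<open>\<epsilon> \<ge> 1\<close> bribing nobody suffices. The exponent can
    be close to 0 here, so constant time is needed.\<close>
  proof (cases "\<epsilon> \<ge> 1")
    case True
    show ?thesis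
    proof (intro exI[of _ Skip] allI impI conjI)
      fix B assume B: "bvu_instance B"
      obtain I where I: "OPT B \<in> {0..1}" using OPT_attained[OF B] .
      then show "OPT B \<in> {0..1}" .
      have "feasible B {}" using B by (auto simp: feasible_def bvu_instance_def)
      moreover have "objective B {} \<ge> OPT B - \<epsilon>" using I True objective_bounds(1)[of B "{}"] by auto
      ultimately show "\<exists>t s. exec Skip (input_store B) t s \<and> real t \<le> ?bound B \<and> feasible B (output_set B s) \<and>
         objective B (output_set B s) \<ge> OPT B - \<epsilon>"
        using exec.Skip[of "input_store B"] bound1[OF B]
        by (intro exI[of _ 1] exI[of _ "input_store B"]) (auto simp: output_set_input_store)
    qed
  next
    case False
    show ?thesis
    proof (intro exI[of _ "prog ?K"] allI impI conjI)
      fix B assume B: "bvu_instance B"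
      obtain I where I: "OPT B \<in> {0..1}" using OPT_attained[OF B] .
      then show "OPT B \<in> {0..1}" .
      have K: "34 / \<epsilon> \<le> real ?K" by linarith
      have "34 < 34 / \<epsilon>" using e False by (simp add: field_simps)
      then have K2: "?K \<ge> 2" using K by linarith
      show "\<exists>t s. exec (prog ?K) (input_store B) t s \<and> real t \<le> ?bound B \<and> feasible B (output_set B s) \<and>
         objective B (output_set B s) \<ge> OPT B - \<epsilon>"
      proof (cases "num_voters B \<ge> 2")
        case n1: False
        then have "num_voters B = 1" using num_voters_pos[OF B] by simp
        then obtain t s where t: "exec (prog ?K) (input_store B) t s" "t \<le> 30" "feasible B (output_set B s)"
            "objective B (output_set B s) \<ge> OPT B"
          using prog_single_correct[OF B] by metis
        then have "real t \<le> ?bound B" "objective B (output_set B s) \<ge> OPT B - \<epsilon>"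
          using bound1[OF B] e by linarith+
        then show ?thesis using t by blast
      next
        case n2: True
        interpret bvu_run B ?K by unfold_locales (use B K2 n2 in auto)
        obtain t s where t: "exec (prog_main ?K) (input_store B) t s" "t \<le> 2000 * M ^ 3"
            "feasible B (output_set B s)" "objective B (output_set B s) \<ge> OPT B - 34 / ?K"
          using prog_main_correct inputs_ok_input_store[of B] unfolding triple_def by blast
        have "34 \<le> \<epsilon> * real ?K" using K e by (simp only: pos_divide_le_eq mult.commute)
        then have d: "34 / real ?K \<le> \<epsilon>" using K2 e by (subst pos_divide_le_eq) auto
        let ?c = "1 + ccost (NLess (nvar ''n'') (NConst 2))"
        have "exec (prog ?K) (input_store B) (?c + t) s"
          unfolding prog_def
          by (rule exec.CondFalse[OF _ t(1)]) (use n2 inputs_okD(2)[OF inputs_ok_input_store[of B]] in simp)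
        moreover have "real (?c + t) \<le> ?bound B"
        proof -
          have "1 \<le> M ^ 3" using M_ge(1) by simp
          \<comment> \<open>The initial test fits into the step from 2000 to \<open>2 ^ 11\<close>,
            a constant that \<open>n ^ 11\<close> then absorbs.\<close>
          then have "?c + t \<le> 2048 * M ^ 3" using t(2) by simp
          also have "\<dots> \<le> n ^ 11 * (n ^ (3 * num_digits B ?K)) ^ 3"
            using power_mono[of 2 n 11] n2 num_keys_le[OF n2, of ?K] by (intro mult_mono power_mono) auto
          also have "\<dots> = n ^ (11 + 9 * (m + ?K + ?K + 1))"
            by (simp add: power_add[symmetric] power_mult[symmetric] num_digits_def algebra_simps)
          finally have "real (?c + t) \<le> real (n ^ (11 + 9 * (m + ?K + ?K + 1)))"
            by (rule of_nat_mono)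
          also have "\<dots> = real n powr real (11 + 9 * (m + ?K + ?K + 1))"
            using n2 by (subst powr_realpow) auto
          also have "\<dots> \<le> real n powr (1000 * (real m ^ 5 / \<epsilon> ^ 5))"
            by (intro powr_mono exponent_bound) (use e False n2 B in \<open>auto simp: bvu_instance_def\<close>)
          also have "\<dots> \<le> 1000 * real n powr (1000 * (real m ^ 5 / \<epsilon> ^ 5))" by simp
          finally show ?thesis using bound[of B] by linarith
        qed
        moreover have "objective B (output_set B s) \<ge> OPT B - \<epsilon>"
          by (rule order.trans[OF diff_left_mono[OF d] t(4)])
        ultimately show ?thesis using t(3) by blast
      qed
    qed
  qed
qed simp

end
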